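(* Let $R$ be a commutative Noetherian ring, let $C$ be a semidualizing $R$-module, let $M$, $N$ be $R$-modules, and assume $C\text{-}\mathrm{qpd}_R M<\infty$. (1) Suppose $\operatorname{Tor}^R_i(C,N)=0$ for all $i>0$. If $\operatorname{Tor}^R_i(M,N)=0$ for all sufficiently large $i$, then $\operatorname{Tor}^R_i(M,N)=0$ for all $i>C\text{-}\mathrm{qpd}_R M$. (2) Suppose $\operatorname{Ext}^i_R(C,N)=0$ for all $i>0$. If $\operatorname{Ext}^i_R(M,N)=0$ for all sufficiently large $i$, then $\operatorname{Ext}^i_R(M,N)=0$ for all $i>C\text{-}\mathrm{qpd}_R M$.
   Context: A finitely generated $R$-module $C$ is semidualizing if the homothety map $R\to\operatorname{Hom}_R(C,C)$ is an isomorphism and $\operatorname{Ext}^i_R(C,C)=0$ for all $i>0$. For a complex $X_\bullet$ of $R$-modules (homological indexing), $\sup X_\bullet=\sup\{i: X_i\neq0\}$ and $\operatorname{hsup}X_\bullet=\sup\{i:\mathrm H_i(X_\bullet)\neq0\}$. A $C$-quasi-projective resolution of an $R$-module $M$ is a bounded complex $P_\bullet$ of projective $R$-modules such that $P_\bullet\otimes_R C$ is not acyclic and each $\mathrm H_i(P_\bullet\otimes_R C)$ is zero or a finite direct sum of copies of $M$. The $C$-quasi-projective dimension $C\text{-}\mathrm{qpd}_R M$ is the infimum of $\sup(P_\bullet\otimes_R C)-\operatorname{hsup}(P_\bullet\otimes_R C)$ over all $C$-quasi-projective resolutions $P_\bullet$ of $M$ ($\infty$ if there are none), and it is $-\infty$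 if $M=0$. Modules are not assumed finitely generated. *)

theory Defs
  imports "HOL-Algebra.Module" "HOL-Algebra.AbelCoset" "HOL-Algebra.Ring_Divisibility" "HOL-Library.Extended_Real"
begin

text \<open>
  Modules are those of \<open>HOL-Algebra\<close>: a record with an explicit carrier over a commutative
  ring \<open>R\<close>. The multiplicative fields that the module record inherits from the ring record
  play no role and are left \<open>undefined\<close> in the constructions below.
\<close>

section \<open>Modules\<close>

definition zero_module :: "('r, 'm) module \<Rightarrow> bool" where
  "zero_module M \<longleftrightarrow> carrier M = {\<zero>\<^bsub>M\<^esub>}"

definition module_hom :: "'r ring \<Rightarrow> ('r, 'a) module \<Rightarrow> ('r, 'b) module \<Rightarrow> ('a \<Rightarrow> 'b) set" where
  "module_hom R M N = {f \<in> carrier M \<rightarrow> carrier N.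
     (\<forall>x\<in>carrier M. \<forall>y\<in>carrier M. f (x \<oplus>\<^bsub>M\<^esub> y) = f x \<oplus>\<^bsub>N\<^esub> f y) \<and>
     (\<forall>r\<in>carrier R. \<forall>x\<in>carrier M. f (r \<odot>\<^bsub>M\<^esub> x) = r \<odot>\<^bsub>N\<^esub> f x)}"

definition module_iso :: "'r ring \<Rightarrow> ('r, 'a) module \<Rightarrow> ('r, 'b) module \<Rightarrow> ('a \<Rightarrow> 'b) set" where
  "module_iso R M N = {f \<in> module_hom R M N. bij_betw f (carrier M) (carrier N)}"

definition isomorphic_modules :: "'r ring \<Rightarrow> ('r, 'a) module \<Rightarrow> ('r, 'b) module \<Rightarrow> bool" where
  "isomorphic_modules R M N \<longleftrightarrow> module_iso R M N \<noteq> {}"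

definition regular_module :: "'r ring \<Rightarrow> ('r, 'r) module" where
  "regular_module R = \<lparr>carrier = carrier R, monoid.mult = undefined, one = undefined,
     ring.zero = \<zero>\<^bsub>R\<^esub>, add = (\<oplus>\<^bsub>R\<^esub>), smult = (\<otimes>\<^bsub>R\<^esub>)\<rparr>"

definition module_span :: "'r ring \<Rightarrow> ('r, 'm) module \<Rightarrow> 'm set \<Rightarrow> 'm set" where
  "module_span R M S = \<Inter>{H. submodule H R M \<and> S \<subseteq> H}"

definition finitely_generated :: "'r ring \<Rightarrow> ('r, 'm) module \<Rightarrow> bool" where
  "finitely_generated R M \<longleftrightarrow>
     (\<exists>S. finite S \<and> S \<subseteq> carrier M \<and> module_span R M S = carrier M)"

definition quotient_module :: "('r, 'm) module \<Rightarrow> 'm set \<Rightarrow> ('r, 'm set) module" where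
  "quotient_module M H = \<lparr>carrier = a_rcosets\<^bsub>M\<^esub> H, monoid.mult = undefined, one = undefined,
     ring.zero = H, add = (<+>\<^bsub>M\<^esub>), smult = (\<lambda>r X. \<Union>x\<in>X. H +>\<^bsub>M\<^esub> (r \<odot>\<^bsub>M\<^esub> x))\<rparr>"

definition direct_power :: "('r, 'm) module \<Rightarrow> nat \<Rightarrow> ('r, nat \<Rightarrow> 'm) module" where
  "direct_power M k = \<lparr>carrier = {..<k} \<rightarrow>\<^sub>E carrier M, monoid.mult = undefined, one = undefined,
     ring.zero = (\<lambda>j\<in>{..<k}. \<zero>\<^bsub>M\<^esub>),
     add = (\<lambda>f g. \<lambda>j\<in>{..<k}. f j \<oplus>\<^bsub>M\<^esub> g j),
     smult = (\<lambda>r f. \<lambda>j\<in>{..<k}. r \<odot>\<^bsub>M\<^esub> f j)\<rparr>"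

definition Hom_module :: "'r ring \<Rightarrow> ('r, 'a) module \<Rightarrow> ('r, 'b) module \<Rightarrow> ('r, 'a \<Rightarrow> 'b) module" where
  "Hom_module R M N = \<lparr>carrier = module_hom R M N \<inter> extensional (carrier M),
     monoid.mult = undefined, one = undefined,
     ring.zero = (\<lambda>x\<in>carrier M. \<zero>\<^bsub>N\<^esub>),
     add = (\<lambda>f g. \<lambda>x\<in>carrier M. f x \<oplus>\<^bsub>N\<^esub> g x),
     smult = (\<lambda>r f. \<lambda>x\<in>carrier M. r \<odot>\<^bsub>N\<^esub> f x)\<rparr>"

section \<open>Free and projective modules\<close>

definition free_module :: "'r ring \<Rightarrow> 's set \<Rightarrow> ('r, 's \<Rightarrow> 'r) module" where
  "free_module R S = \<lparr>carrier = {v. range v \<subseteq> carrier R \<and> finite {s. v s \<noteq> \<zero>\<^bsub>R\<^esub>} \<and> {s. v s \<noteq> \<zero>\<^bsub>R\<^esub>} \<subseteq> S},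
     monoid.mult = undefined, one = undefined,
     ring.zero = (\<lambda>s. \<zero>\<^bsub>R\<^esub>),
     add = (\<lambda>v w s. v s \<oplus>\<^bsub>R\<^esub> w s),
     smult = (\<lambda>r v s. r \<otimes>\<^bsub>R\<^esub> v s)\<rparr>"

definition basis_vector :: "'r ring \<Rightarrow> 's \<Rightarrow> 's \<Rightarrow> 'r" where
  "basis_vector R s = (\<lambda>t. if t = s then \<one>\<^bsub>R\<^esub> else \<zero>\<^bsub>R\<^esub>)"

text \<open>The linear extension to a free module of a map \<open>\<phi>\<close> from its basis to \<open>M\<close>.\<close>

definition linear_extension :: "'r ring \<Rightarrow> ('r, 'm) module \<Rightarrow> ('s \<Rightarrow> 'm) \<Rightarrow> ('s \<Rightarrow> 'r) \<Rightarrow> 'm" where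
  "linear_extension R M \<phi> v = (\<Oplus>\<^bsub>M\<^esub>s\<in>{s. v s \<noteq> \<zero>\<^bsub>R\<^esub>}. v s \<odot>\<^bsub>M\<^esub> \<phi> s)"

text \<open>
  Projective modules are the direct summands (up to isomorphism) of free modules. A basis
  inside the type of elements of \<open>P\<close> is no restriction, since \<open>P\<close> is a quotient of the free module
  on \<open>carrier P\<close>.
\<close>

definition projective_module :: "'r ring \<Rightarrow> ('r, 'p) module \<Rightarrow> bool" where
  "projective_module R P \<longleftrightarrow> module R P \<and>
     (\<exists>(S :: 'p set) \<iota> \<pi>. \<iota> \<in> module_hom R P (free_module R S) \<and>
        \<pi> \<in> module_hom R (free_module R S) P \<and> (\<forall>x\<in>carrier P. \<pi> (\<iota> x) = x))"

section \<open>Tensor products\<close>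

definition tensor_relations ::
  "'r ring \<Rightarrow> ('r, 'a) module \<Rightarrow> ('r, 'b) module \<Rightarrow> ('a \<times> 'b \<Rightarrow> 'r) set" where
  "tensor_relations R A B =
    (let F = free_module R (carrier A \<times> carrier B); e = basis_vector R in
       {e (a \<oplus>\<^bsub>A\<^esub> a', b) \<ominus>\<^bsub>F\<^esub> (e (a, b) \<oplus>\<^bsub>F\<^esub> e (a', b)) | a a' b.
          a \<in> carrier A \<and> a' \<in> carrier A \<and> b \<in> carrier B} \<union>
       {e (a, b \<oplus>\<^bsub>B\<^esub> b') \<ominus>\<^bsub>F\<^esub> (e (a, b) \<oplus>\<^bsub>F\<^esub> e (a, b')) | a b b'.
          a \<in> carrier A \<and> b \<in> carrier B \<and> b' \<in> carrier B} \<union>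
       {e (r \<odot>\<^bsub>A\<^esub> a, b) \<ominus>\<^bsub>F\<^esub> (r \<odot>\<^bsub>F\<^esub> e (a, b)) | r a b.
          r \<in> carrier R \<and> a \<in> carrier A \<and> b \<in> carrier B} \<union>
       {e (a, r \<odot>\<^bsub>B\<^esub> b) \<ominus>\<^bsub>F\<^esub> (r \<odot>\<^bsub>F\<^esub> e (a, b)) | r a b.
          r \<in> carrier R \<and> a \<in> carrier A \<and> b \<in> carrier B})"

definition tensor_kernel ::
  "'r ring \<Rightarrow> ('r, 'a) module \<Rightarrow> ('r, 'b) module \<Rightarrow> ('a \<times> 'b \<Rightarrow> 'r) set" where
  "tensor_kernel R A B =
     module_span R (free_module R (carrier A \<times> carrier B)) (tensor_relations R A B)"

definition tensor_module ::
  "'r ring \<Rightarrow> ('r, 'a) module \<Rightarrow> ('r, 'b) module \<Rightarrow> ('r, ('a \<times> 'b \<Rightarrow> 'r) set) module" where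
  "tensor_module R A B =
     quotient_module (free_module R (carrier A \<times> carrier B)) (tensor_kernel R A B)"

definition pure_tensor ::
  "'r ring \<Rightarrow> ('r, 'a) module \<Rightarrow> ('r, 'b) module \<Rightarrow> 'a \<Rightarrow> 'b \<Rightarrow> ('a \<times> 'b \<Rightarrow> 'r) set" where
  "pure_tensor R A B a b =
     tensor_kernel R A B +>\<^bsub>free_module R (carrier A \<times> carrier B)\<^esub> basis_vector R (a, b)"

text \<open>
  For linear \<open>f : A \<rightarrow> A'\<close>, the map \<open>f \<otimes> id : A \<otimes> B \<rightarrow> A' \<otimes> B\<close>. An element \<open>X\<close> of \<open>A \<otimes> B\<close> is a coset
  of formal combinations of pairs, on which the linear extension of
  \<open>(a, b) \<mapsto> f a \<otimes> b\<close> is constant.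
\<close>

definition tensor_map ::
  "'r ring \<Rightarrow> ('r, 'a) module \<Rightarrow> ('r, 'b) module \<Rightarrow> ('e \<Rightarrow> 'a) \<Rightarrow>
   ('e \<times> 'b \<Rightarrow> 'r) set \<Rightarrow> ('a \<times> 'b \<Rightarrow> 'r) set" where
  "tensor_map R A' B f X =
     the_elem (linear_extension R (tensor_module R A' B) (\<lambda>(a, b). pure_tensor R A' B (f a) b) ` X)"

section \<open>Complexes\<close>

text \<open>A complex is a family of modules with \<open>d i : X i \<rightarrow> X (i - 1)\<close>.\<close>

definition chain_complex :: "'r ring \<Rightarrow> (int \<Rightarrow> ('r, 'p) module) \<Rightarrow> (int \<Rightarrow> 'p \<Rightarrow> 'p) \<Rightarrow> bool" where
  "chain_complex R X d \<longleftrightarrow>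
     (\<forall>i. module R (X i) \<and> d i \<in> module_hom R (X i) (X (i - 1)) \<and>
          (\<forall>x\<in>carrier (X i). d (i - 1) (d i x) = \<zero>\<^bsub>X (i - 1 - 1)\<^esub>))"

definition bounded_complex :: "(int \<Rightarrow> ('r, 'p) module) \<Rightarrow> bool" where
  "bounded_complex X \<longleftrightarrow> finite {i. \<not> zero_module (X i)}"

definition homology ::
  "(int \<Rightarrow> ('r, 'p) module) \<Rightarrow> (int \<Rightarrow> 'p \<Rightarrow> 'p) \<Rightarrow> int \<Rightarrow> ('r, 'p set) module" where
  "homology X d i =
     quotient_module ((X i)\<lparr>carrier := a_kernel (X i) (X (i - 1)) (d i)\<rparr>)
       (d (i + 1) ` carrier (X (i + 1)))"

definition complex_sup :: "(int \<Rightarrow> ('r, 'p) module) \<Rightarrow> ereal" where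
  "complex_sup X = Sup {ereal (of_int i) | i. \<not> zero_module (X i)}"

definition complex_hsup :: "(int \<Rightarrow> ('r, 'p) module) \<Rightarrow> (int \<Rightarrow> 'p \<Rightarrow> 'p) \<Rightarrow> ereal" where
  "complex_hsup X d = Sup {ereal (of_int i) | i. \<not> zero_module (homology X d i)}"

definition tensor_complex ::
  "'r ring \<Rightarrow> (int \<Rightarrow> ('r, 'p) module) \<Rightarrow> ('r, 'b) module \<Rightarrow> int \<Rightarrow> ('r, ('p \<times> 'b \<Rightarrow> 'r) set) module" where
  "tensor_complex R X B i = tensor_module R (X i) B"

definition tensor_differential ::
  "'r ring \<Rightarrow> (int \<Rightarrow> ('r, 'p) module) \<Rightarrow> (int \<Rightarrow> 'p \<Rightarrow> 'p) \<Rightarrow> ('r, 'b) module \<Rightarrow>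
   int \<Rightarrow> ('p \<times> 'b \<Rightarrow> 'r) set \<Rightarrow> ('p \<times> 'b \<Rightarrow> 'r) set" where
  "tensor_differential R X d B i = tensor_map R (X (i - 1)) B (d i)"

section \<open>The standard free resolution, Tor and Ext\<close>

text \<open>
  Tor and Ext are computed from a functorial free resolution
  \<open>\<cdots> \<rightarrow> F 1 \<rightarrow> F 0 \<rightarrow> M \<rightarrow> 0\<close>. The basis of \<open>F 0\<close> consists of the elements of \<open>M\<close>, and the
  basis of \<open>F (n + 1)\<close> of all formal linear combinations of basis elements of \<open>F n\<close> whose
  value in \<open>F n\<close> lies in the kernel of \<open>F n \<rightarrow> F (n - 1)\<close> (of \<open>F 0 \<rightarrow> M\<close> if \<open>n = 0\<close>); the
  differential sends such a combination to its value. Representing formal linear combinations by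
  lists keeps all basis elements in one type.
\<close>

datatype ('r, 'm) syzygy = Gen 'm | Syz "('r \<times> ('r, 'm) syzygy) list"

definition combination :: "'r ring \<Rightarrow> ('r \<times> 's) list \<Rightarrow> 's \<Rightarrow> 'r" where
  "combination R xs =
     foldr (\<lambda>(r, s) v. (r \<odot>\<^bsub>free_module R UNIV\<^esub> basis_vector R s) \<oplus>\<^bsub>free_module R UNIV\<^esub> v)
       xs \<zero>\<^bsub>free_module R UNIV\<^esub>"

fun syzygy_boundary :: "'r ring \<Rightarrow> ('r, 'm) syzygy \<Rightarrow> ('r, 'm) syzygy \<Rightarrow> 'r" where
  "syzygy_boundary R (Gen m) = (\<lambda>s. \<zero>\<^bsub>R\<^esub>)"
| "syzygy_boundary R (Syz xs) = combination R xs"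

text \<open>
  All differentials of the resolution are restrictions of one linear map. Its values are sums in
  the free module on the whole type of basis elements, of which each \<open>F n\<close> is a submodule.
\<close>

definition resolution_boundary ::
  "'r ring \<Rightarrow> (('r, 'm) syzygy \<Rightarrow> 'r) \<Rightarrow> ('r, 'm) syzygy \<Rightarrow> 'r" where
  "resolution_boundary R = linear_extension R (free_module R UNIV) (syzygy_boundary R)"

definition resolution_augmentation ::
  "'r ring \<Rightarrow> ('r, 'm) module \<Rightarrow> (('r, 'm) syzygy \<Rightarrow> 'r) \<Rightarrow> 'm" where
  "resolution_augmentation R M =
     linear_extension R M (\<lambda>s. case s of Gen m \<Rightarrow> m | Syz _ \<Rightarrow> \<zero>\<^bsub>M\<^esub>)"

primrec resolution_basis :: "'r ring \<Rightarrow> ('r, 'm) module \<Rightarrow> nat \<Rightarrow> ('r, 'm) syzygy set" where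
  "resolution_basis R M 0 = Gen ` carrier M"
| "resolution_basis R M (Suc n) =
     {Syz xs | xs. set xs \<subseteq> carrier R \<times> resolution_basis R M n \<and>
        (if n = 0 then resolution_augmentation R M (combination R xs) = \<zero>\<^bsub>M\<^esub>
         else resolution_boundary R (combination R xs) = (\<lambda>s. \<zero>\<^bsub>R\<^esub>))}"

definition free_resolution ::
  "'r ring \<Rightarrow> ('r, 'm) module \<Rightarrow> int \<Rightarrow> ('r, ('r, 'm) syzygy \<Rightarrow> 'r) module" where
  "free_resolution R M i = free_module R (if i < 0 then {} else resolution_basis R M (nat i))"

text \<open>\<open>Tor i (M, N)\<close> is the homology of \<open>F \<otimes> N\<close>; it is zero for negative \<open>i\<close>.\<close>

definition Tor ::
  "'r ring \<Rightarrow> ('r, 'm) module \<Rightarrow> ('r, 'n) module \<Rightarrow> int \<Rightarrow>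
   ('r, ((('r, 'm) syzygy \<Rightarrow> 'r) \<times> 'n \<Rightarrow> 'r) set set) module" where
  "Tor R M N i =
     homology (tensor_complex R (free_resolution R M) N)
       (tensor_differential R (free_resolution R M) (\<lambda>_. resolution_boundary R) N) i"

definition Ext_differential ::
  "'r ring \<Rightarrow> ('r, 'm) module \<Rightarrow> int \<Rightarrow> ((('r, 'm) syzygy \<Rightarrow> 'r) \<Rightarrow> 'n) \<Rightarrow> (('r, 'm) syzygy \<Rightarrow> 'r) \<Rightarrow> 'n" where
  "Ext_differential R M i \<phi> =
     compose (carrier (free_resolution R M (i + 1))) \<phi> (resolution_boundary R)"

text \<open>
  \<open>Ext i (M, N)\<close> is the cohomology at the middle of
  \<open>Hom (F (i - 1), N) \<rightarrow> Hom (F i, N) \<rightarrow> Hom (F (i + 1), N)\<close>; it is zero for negative \<open>i\<close>.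
\<close>

definition Ext ::
  "'r ring \<Rightarrow> ('r, 'm) module \<Rightarrow> ('r, 'n) module \<Rightarrow> int \<Rightarrow>
   ('r, ((('r, 'm) syzygy \<Rightarrow> 'r) \<Rightarrow> 'n) set) module" where
  "Ext R M N i =
     (let H = (\<lambda>j. Hom_module R (free_resolution R M j) N) in
      quotient_module ((H i)\<lparr>carrier := a_kernel (H i) (H (i + 1)) (Ext_differential R M i)\<rparr>)
        (Ext_differential R M (i - 1) ` carrier (H (i - 1))))"

section \<open>Semidualizing modules and quasi-projective dimension\<close>

definition homothety :: "('r, 'c) module \<Rightarrow> 'r \<Rightarrow> 'c \<Rightarrow> 'c" where
  "homothety C r = (\<lambda>x\<in>carrier C. r \<odot>\<^bsub>C\<^esub> x)"

definition semidualizing :: "'r ring \<Rightarrow> ('r, 'c) module \<Rightarrow> bool" where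
  "semidualizing R C \<longleftrightarrow> module R C \<and> finitely_generated R C \<and>
     homothety C \<in> module_iso R (regular_module R) (Hom_module R C C) \<and>
     (\<forall>i>0. zero_module (Ext R C C i))"

definition quasi_projective_resolution ::
  "'r ring \<Rightarrow> ('r, 'c) module \<Rightarrow> ('r, 'm) module \<Rightarrow>
   (int \<Rightarrow> ('r, 'p) module) \<Rightarrow> (int \<Rightarrow> 'p \<Rightarrow> 'p) \<Rightarrow> bool" where
  "quasi_projective_resolution R C M P d \<longleftrightarrow>
     chain_complex R P d \<and> bounded_complex P \<and> (\<forall>i. projective_module R (P i)) \<and>
     (let H = homology (tensor_complex R P C) (tensor_differential R P d C) in
        (\<exists>i. \<not> zero_module (H i)) \<and>
        (\<forall>i. \<exists>k. isomorphic_modules R (H i) (direct_power M k)))"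

text \<open>
  The resolutions range over the complexes whose modules have their elements in the type \<open>'p\<close>,
  which plays the role of a universe: HOL cannot quantify over all types inside a definition.
  Statements about \<open>quasi_projective_dim TYPE('p)\<close> should be polymorphic in \<open>'p\<close>. Any particular
  bounded complex of modules can be realised in a suitable \<open>'p\<close>, and an infimum of natural
  numbers is attained, so the dimension in the literature is the value for any \<open>'p\<close> that is large
  enough (and a lower bound for the value at every \<open>'p\<close>).

  For a quasi-projective resolution both suprema are finite, as the complex is bounded and not
  acyclic after tensoring, so the extended real subtraction is that of integers.
\<close>

definition quasi_projective_dim ::
  "'p itself \<Rightarrow> 'r ring \<Rightarrow> ('r, 'c) module \<Rightarrow> ('r, 'm) module \<Rightarrow> ereal" where
  "quasi_projective_dim _ R C M =
     (if zero_module M then - \<infinity>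
      else Inf {complex_sup (tensor_complex R P C) -
                complex_hsup (tensor_complex R P C) (tensor_differential R P d C) |
                (P :: int \<Rightarrow> ('r, 'p) module) d. quasi_projective_resolution R C M P d})"

end

theory Submission
  imports Defs
begin

text \<open>
  Write \<open>T\<^sub>j\<close> for \<open>Tor\<^sub>j(-, N)\<close> or \<open>Ext\<^sup>j(-, N)\<close>. For \<open>j > 0\<close> it vanishes on \<open>C\<close>, hence on every term of
  \<open>X = P \<otimes> C\<close>, which is a direct summand of a direct sum of copies of \<open>C\<close>. Let \<open>Z\<^sub>i\<close>, \<open>B\<^sub>i\<close>, \<open>H\<^sub>i\<close> be
  the cycles, boundaries and homology of \<open>X\<close>, and put \<open>s = sup X\<close>, \<open>h = hsup X\<close>. As \<open>X\<close> is exact above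
  degree \<open>h\<close>, dimension shifting along \<open>0 \<rightarrow> Z\<^sub>i\<^sub>+\<^sub>1 \<rightarrow> X\<^sub>i\<^sub>+\<^sub>1 \<rightarrow> B\<^sub>i \<rightarrow> 0\<close> from the top gives \<open>T\<^sub>j(B\<^sub>i) = 0\<close> for
  \<open>i \<ge> h\<close> and \<open>j \<ge> s - i\<close>. If \<open>T\<^sub>j(M) = 0\<close> for all \<open>j > t\<close>, where \<open>t > s - h\<close>, then shifting from the bottom,
  also along \<open>0 \<rightarrow> B\<^sub>i \<rightarrow> Z\<^sub>i \<rightarrow> H\<^sub>i \<rightarrow> 0\<close>, gives \<open>T\<^sub>j(Z\<^sub>i) = 0\<close> for \<open>i \<le> h\<close> and \<open>j \<ge> t + h - i\<close>. In degree
  \<open>h\<close> the two meet: \<open>T\<^sub>t(H\<^sub>h) = 0\<close>, and \<open>H\<^sub>h\<close> is a nonzero power of \<open>M\<close>, so \<open>T\<^sub>t(M) = 0\<close>. Descending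
  induction on \<open>t\<close> finishes the proof. Connecting homomorphisms are avoided: for a short exact
  sequence \<open>0 \<rightarrow> A \<rightarrow> B \<rightarrow> E \<rightarrow> 0\<close>, the mapping cone of a lift of \<open>A \<rightarrow> B\<close> to free resolutions is a free
  resolution of \<open>E\<close>, and the two vanishing statements needed are diagram chases in that cone.
\<close>

section \<open>Homomorphisms, quotients and free modules\<close>

text \<open>The bound is the length of the exact top part of \<open>X\<close>. Since \<open>0
  \<rightarrow> X\<^sub>s \<rightarrow> ... \<rightarrow> X\<^sub>h\<^sub>+\<^sub>1 \<rightarrow>
  B\<^sub>h \<rightarrow> 0\<close> is exact (with \<open>B\<^sub>h = 0\<close> if
  \<open>s = h\<close>), \<open>B\<^sub>h\<close> is resolved in \<open>s - h\<close> terms by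
  modules whose higher \<open>T\<close> vanishes. Below degree \<open>h\<close> there is homology,
  but it consists of powers of \<open>M\<close>, so the known vanishing for \<open>M\<close> takes
  the place of exactness. Strictness of \<open>t > s - h\<close> is what puts \<open>t - 1\<close>
  into the range known for \<open>B\<^sub>h\<close>. The obstacle is that Tor and Ext are defined by
  one particular resolution, whose type depends on the module. The comparison theorem is therefore
  proved for free resolutions with bases in arbitrary types; after that each vanishing statement is
  read off from the most convenient resolution: a cone, a direct sum, or the empty one. Cones are
  described by equations between maps, because equations survive tensoring with \<open>N\<close>
  while descriptions by elements do not.\<close>

lemma module_homI:
  assumes "\<And>x. x \<in> carrier M \<Longrightarrow> f x \<in> carrier N"
    and "\<And>x y. x \<in> carrier M \<Longrightarrow> y \<in> carrier M \<Longrightarrow> f (x \<oplus>\<^bsub>M\<^esub> y) = f x \<oplus>\<^bsub>N\<^esub> f y"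
    and "\<And>r x. r \<in> carrier R \<Longrightarrow> x \<in> carrier M \<Longrightarrow> f (r \<odot>\<^bsub>M\<^esub> x) = r \<odot>\<^bsub>N\<^esub> f x"
  shows "f \<in> module_hom R M N"
  using assms by (auto simp: module_hom_def)

lemma module_hom_closed: "f \<in> module_hom R M N \<Longrightarrow> x \<in> carrier M \<Longrightarrow> f x \<in> carrier N"
  by (auto simp: module_hom_def)

lemma module_hom_add:
  "f \<in> module_hom R M N \<Longrightarrow> x \<in> carrier M \<Longrightarrow> y \<in> carrier M \<Longrightarrow> f (x \<oplus>\<^bsub>M\<^esub> y) = f x \<oplus>\<^bsub>N\<^esub> f y"
  by (auto simp: module_hom_def)

lemma module_hom_smult:
  "f \<in> module_hom R M N \<Longrightarrow> r \<in> carrier R \<Longrightarrow> x \<in> carrier M \<Longrightarrow> f (r \<odot>\<^bsub>M\<^esub> x) = r \<odot>\<^bsub>N\<^esub> f x"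
  by (auto simp: module_hom_def)

lemma module_group: "Module.module R M \<Longrightarrow> abelian_group M"
  by (simp add: module_def)

lemma module_ring: "Module.module R M \<Longrightarrow> cring R"
  by (simp add: module_def)

lemma module_r_zero: "Module.module R M \<Longrightarrow> x \<in> carrier M \<Longrightarrow> x \<oplus>\<^bsub>M\<^esub> \<zero>\<^bsub>M\<^esub> = x"
  by (simp add: module_def abelian_group_def abelian_monoid.r_zero)

lemma module_add_closed:
  "Module.module R M \<Longrightarrow> x \<in> carrier M \<Longrightarrow> y \<in> carrier M \<Longrightarrow> x \<oplus>\<^bsub>M\<^esub> y \<in> carrier M"
  by (simp add: module_def abelian_group_def abelian_monoid.a_closed)

lemma module_hom_zero:
  assumes "Module.module R M" "Module.module R N" "f \<in> module_hom R M N"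
  shows "f \<zero>\<^bsub>M\<^esub> = \<zero>\<^bsub>N\<^esub>"
proof -
  interpret M: Module.module R M by fact
  interpret N: Module.module R N by fact
  have "f (\<zero>\<^bsub>R\<^esub> \<odot>\<^bsub>M\<^esub> \<zero>\<^bsub>M\<^esub>) = \<zero>\<^bsub>R\<^esub> \<odot>\<^bsub>N\<^esub> f \<zero>\<^bsub>M\<^esub>"
    using assms(3) by (intro module_hom_smult) auto
  then show ?thesis
    using module_hom_closed[OF assms(3) M.zero_closed] by simp
qed

lemma module_hom_neg:
  assumes "Module.module R M" "Module.module R N" "f \<in> module_hom R M N" "x \<in> carrier M"
  shows "f (\<ominus>\<^bsub>M\<^esub> x) = \<ominus>\<^bsub>N\<^esub> f x"
proof -
  interpret M: Module.module R M by fact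
  interpret N: Module.module R N by fact
  have "f (\<ominus>\<^bsub>M\<^esub> x) \<oplus>\<^bsub>N\<^esub> f x = \<zero>\<^bsub>N\<^esub>"
    using module_hom_add[OF assms(3), of "\<ominus>\<^bsub>M\<^esub> x" x] assms module_hom_zero[OF assms(1-3)]
    by (simp add: M.l_neg)
  then show ?thesis
    using assms module_hom_closed[OF assms(3)] by (simp add: N.minus_equality)
qed

lemma module_hom_diff:
  assumes "Module.module R M" "Module.module R N" "f \<in> module_hom R M N" "x \<in> carrier M" "y \<in> carrier M"
  shows "f (x \<ominus>\<^bsub>M\<^esub> y) = f x \<ominus>\<^bsub>N\<^esub> f y"
proof -
  interpret M: Module.module R M by fact
  interpret N: Module.module R N by fact
  show ?thesis
    using assms by (simp add: M.minus_eq N.minus_eq module_hom_add[OF assms(3)] module_hom_neg[OF assms(1-3)])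
qed

lemma module_hom_id: "(\<lambda>x. x) \<in> module_hom R M M"
  by (rule module_homI) auto

lemma module_hom_comp:
  assumes "f \<in> module_hom R A B" "g \<in> module_hom R B D"
  shows "(\<lambda>x. g (f x)) \<in> module_hom R A D"
  using assms by (auto intro!: module_homI simp: module_hom_closed module_hom_add module_hom_smult)

lemma module_hom_const_zero:
  assumes "Module.module R N"
  shows "(\<lambda>x. \<zero>\<^bsub>N\<^esub>) \<in> module_hom R M N"
proof -
  interpret N: Module.module R N by fact
  show ?thesis by (rule module_homI) auto
qed

lemma module_hom_plus:
  assumes "Module.module R N" "f \<in> module_hom R M N" "g \<in> module_hom R M N"
  shows "(\<lambda>x. f x \<oplus>\<^bsub>N\<^esub> g x) \<in> module_hom R M N"
proof -
  interpret N: Module.module R N by fact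
  show ?thesis
    using module_hom_closed[OF assms(2)] module_hom_closed[OF assms(3)]
    by (intro module_homI)
      (auto simp: module_hom_add[OF assms(2)] module_hom_add[OF assms(3)] N.smult_r_distr
        module_hom_smult[OF assms(2)] module_hom_smult[OF assms(3)] N.a_ac)
qed

lemma module_hom_uminus:
  assumes "Module.module R N" "f \<in> module_hom R M N"
  shows "(\<lambda>x. \<ominus>\<^bsub>N\<^esub> f x) \<in> module_hom R M N"
proof -
  interpret N: Module.module R N by fact
  show ?thesis
    using module_hom_closed[OF assms(2)]
    by (intro module_homI)
      (auto simp: module_hom_add[OF assms(2)] module_hom_smult[OF assms(2)] N.minus_add N.smult_r_minus N.a_ac)
qed

lemma module_hom_minus:
  assumes "Module.module R N" "f \<in> module_hom R M N" "g \<in> module_hom R M N"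
  shows "(\<lambda>x. f x \<ominus>\<^bsub>N\<^esub> g x) \<in> module_hom R M N"
proof -
  interpret N: Module.module R N by fact
  show ?thesis
    using module_hom_plus[OF assms(1,2) module_hom_uminus[OF assms(1,3)]] by (simp add: N.minus_eq)
qed

lemma (in abelian_group) a_inv_zero [simp]: "\<ominus> \<zero> = \<zero>"
  by (rule minus_equality) auto

lemma submodule_zero: "submodule H R M \<Longrightarrow> \<zero>\<^bsub>M\<^esub> \<in> H"
  unfolding submodule_def using subgroup.one_closed[of H "add_monoid M"] by simp

lemma (in abelian_group) minus_eq_zero_iff:
  assumes "x \<in> carrier G" "y \<in> carrier G"
  shows "x \<ominus> y = \<zero> \<longleftrightarrow> x = y"
  using assms by (metis add.inv_closed add.inv_solve_right' l_zero minus_eq zero_closed)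

lemma (in abelian_group) minus_eq_iff:
  assumes "x \<in> carrier G" "y \<in> carrier G" "z \<in> carrier G"
  shows "x \<ominus> y = z \<longleftrightarrow> x = z \<oplus> y"
proof
  assume "x \<ominus> y = z"
  then have "z \<oplus> y = (x \<ominus> y) \<oplus> y" by simp
  then show "x = z \<oplus> y" using assms by (simp add: minus_eq a_assoc l_neg)
next
  assume "x = z \<oplus> y"
  then show "x \<ominus> y = z" using assms by (simp add: minus_eq a_assoc r_neg)
qed

section \<open>Kernels, images and quotient modules\<close>

lemma module_kernel_submodule:
  assumes "Module.module R M" "Module.module R N" "f \<in> module_hom R M N"
  shows "submodule {x \<in> carrier M. f x = \<zero>\<^bsub>N\<^esub>} R M"
proof -
  interpret M: Module.module R M by fact
  interpret N: Module.module R N by fact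
  show ?thesis
    using assms
    by (intro M.submoduleI)
      (auto simp: module_hom_zero module_hom_neg[OF assms] module_hom_add[OF assms(3)] module_hom_smult[OF assms(3)])
qed

lemma module_image_submodule:
  assumes "Module.module R M" "Module.module R N" "f \<in> module_hom R M N"
  shows "submodule (f ` carrier M) R N"
proof -
  interpret M: Module.module R M by fact
  interpret N: Module.module R N by fact
  show ?thesis
  proof (rule N.submoduleI)
    show "f ` carrier M \<subseteq> carrier N" using module_hom_closed[OF assms(3)] by auto
    show "\<zero>\<^bsub>N\<^esub> \<in> f ` carrier M" using module_hom_zero[OF assms] by (metis M.zero_closed image_eqI)
    show "\<ominus>\<^bsub>N\<^esub> a \<in> f ` carrier M" if "a \<in> f ` carrier M" for a
      using that module_hom_neg[OF assms] by (metis (no_types, lifting) M.a_inv_closed image_iff)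
    show "a \<oplus>\<^bsub>N\<^esub> b \<in> f ` carrier M" if "a \<in> f ` carrier M" "b \<in> f ` carrier M" for a b
      using that module_hom_add[OF assms(3)] by (metis (no_types, lifting) M.a_closed image_iff)
    show "r \<odot>\<^bsub>N\<^esub> x \<in> f ` carrier M" if "r \<in> carrier R" "x \<in> f ` carrier M" for r x
      using that module_hom_smult[OF assms(3)] by (metis (no_types, lifting) M.smult_closed image_iff)
  qed
qed

text \<open>The axioms pass along a surjection that respects the operations, so \<open>N\<close> has
  to be known only as a record. Quotient modules and direct powers obtain their module structure in
  this way.\<close>

lemma module_surj_image:
  assumes "Module.module R M"
    and im: "f ` carrier M = carrier N"
    and add: "\<And>x y. x \<in> carrier M \<Longrightarrow> y \<in> carrier M \<Longrightarrow> f (x \<oplus>\<^bsub>M\<^esub> y) = f x \<oplus>\<^bsub>N\<^esub> f y"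
    and smult: "\<And>r x. r \<in> carrier R \<Longrightarrow> x \<in> carrier M \<Longrightarrow> f (r \<odot>\<^bsub>M\<^esub> x) = r \<odot>\<^bsub>N\<^esub> f x"
    and zero: "f \<zero>\<^bsub>M\<^esub> = \<zero>\<^bsub>N\<^esub>"
  shows "Module.module R N"
proof -
  interpret M: Module.module R M by fact
  have f: "f x \<in> carrier N" if "x \<in> carrier M" for x using that im by auto
  have ex: "\<exists>y\<in>carrier M. x = f y" if "x \<in> carrier N" for x using that im by auto
  show ?thesis
  proof (rule moduleI)
    show "cring R" by (rule M.is_cring)
    show "abelian_group N"
    proof (rule abelian_groupI)
      show "\<zero>\<^bsub>N\<^esub> \<in> carrier N" using f[OF M.zero_closed] zero by simp
    next
      fix x assume "x \<in> carrier N"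
      then obtain a where a: "a \<in> carrier M" "x = f a" using ex by auto
      show "\<zero>\<^bsub>N\<^esub> \<oplus>\<^bsub>N\<^esub> x = x" using a add[of "\<zero>\<^bsub>M\<^esub>" a] zero by simp
      show "\<exists>y\<in>carrier N. y \<oplus>\<^bsub>N\<^esub> x = \<zero>\<^bsub>N\<^esub>"
        using a add[of "\<ominus>\<^bsub>M\<^esub> a" a] zero f by (intro bexI[of _ "f (\<ominus>\<^bsub>M\<^esub> a)"]) (auto simp: M.l_neg)
    next
      fix x y assume "x \<in> carrier N" "y \<in> carrier N"
      then obtain a b where ab: "a \<in> carrier M" "x = f a" "b \<in> carrier M" "y = f b" using ex by metis
      then show "x \<oplus>\<^bsub>N\<^esub> y \<in> carrier N" "x \<oplus>\<^bsub>N\<^esub> y = y \<oplus>\<^bsub>N\<^esub> x"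
        using add[of a b, symmetric] add[of b a, symmetric] f by (auto simp: M.a_comm)
      fix z assume "z \<in> carrier N"
      then obtain c where c: "c \<in> carrier M" "z = f c" using ex by metis
      show "x \<oplus>\<^bsub>N\<^esub> y \<oplus>\<^bsub>N\<^esub> z = x \<oplus>\<^bsub>N\<^esub> (y \<oplus>\<^bsub>N\<^esub> z)"
        using ab c by (simp flip: add add: M.a_assoc)
    qed
    fix r x assume r: "r \<in> carrier R" and "x \<in> carrier N"
    then obtain a where a: "a \<in> carrier M" "x = f a" using ex by metis
    show "r \<odot>\<^bsub>N\<^esub> x \<in> carrier N" using r a smult[OF r a(1)] f[of "r \<odot>\<^bsub>M\<^esub> a"] by simp
    show "(r \<oplus>\<^bsub>R\<^esub> q) \<odot>\<^bsub>N\<^esub> x = r \<odot>\<^bsub>N\<^esub> x \<oplus>\<^bsub>N\<^esub> q \<odot>\<^bsub>N\<^esub> x" if q: "q \<in> carrier R" for q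
      using r q a by (simp flip: add smult add: M.smult_l_distr)
    show "(r \<otimes>\<^bsub>R\<^esub> q) \<odot>\<^bsub>N\<^esub> x = r \<odot>\<^bsub>N\<^esub> (q \<odot>\<^bsub>N\<^esub> x)" if q: "q \<in> carrier R" for q
      using r q a by (simp flip: add smult add: M.smult_assoc1)
    show "r \<odot>\<^bsub>N\<^esub> (x \<oplus>\<^bsub>N\<^esub> y) = r \<odot>\<^bsub>N\<^esub> x \<oplus>\<^bsub>N\<^esub> r \<odot>\<^bsub>N\<^esub> y" if y: "y \<in> carrier N" for y
    proof -
      obtain b where b: "b \<in> carrier M" "y = f b" using ex[OF y] by auto
      show ?thesis using r a b by (simp flip: add smult add: M.smult_r_distr)
    qed
  next
    fix x assume "x \<in> carrier N"
    then obtain a where a: "a \<in> carrier M" "x = f a" using ex by metis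
    then show "\<one>\<^bsub>R\<^esub> \<odot>\<^bsub>N\<^esub> x = x" using smult[of "\<one>\<^bsub>R\<^esub>" a, symmetric] by simp
  qed
qed

lemma quotient_module_simps:
  "carrier (quotient_module M H) = (\<lambda>x. H +>\<^bsub>M\<^esub> x) ` carrier M"
  "\<zero>\<^bsub>quotient_module M H\<^esub> = H"
  by (auto simp: quotient_module_def A_RCOSETS_def')

context
  fixes R :: "'r ring" and M :: "('r, 'm) module" and H
  assumes M: "Module.module R M" and H: "submodule H R M"
begin

interpretation M: Module.module R M by (rule M)

interpretation H: abelian_subgroup H M
proof (rule abelian_subgroupI3)
  show "additive_subgroup H M"
    using H by (simp add: additive_subgroup_def submodule_def)
qed (rule M.abelian_group_axioms)

lemma coset_add: 
  "x \<in> carrier M \<Longrightarrow> y \<in> carrier M \<Longrightarrow>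
    H +>\<^bsub>M\<^esub> (x \<oplus>\<^bsub>M\<^esub> y) = (H +>\<^bsub>M\<^esub> x) \<oplus>\<^bsub>quotient_module M H\<^esub> (H +>\<^bsub>M\<^esub> y)"
  by (simp add: quotient_module_def H.a_rcos_sum)

lemma coset_eq_iff:
  "x \<in> carrier M \<Longrightarrow> y \<in> carrier M \<Longrightarrow> H +>\<^bsub>M\<^esub> x = H +>\<^bsub>M\<^esub> y \<longleftrightarrow> x \<ominus>\<^bsub>M\<^esub> y \<in> H"
proof -
  assume x: "x \<in> carrier M" and y: "y \<in> carrier M"
  have "x \<in> H +>\<^bsub>M\<^esub> y" if "x \<ominus>\<^bsub>M\<^esub> y \<in> H"
  proof -
    have "x = (x \<ominus>\<^bsub>M\<^esub> y) \<oplus>\<^bsub>M\<^esub> y" using x y by (simp add: M.minus_eq M.a_assoc M.l_neg)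
    then show ?thesis using that by (auto simp: a_r_coset_def')
  qed
  moreover have "x \<ominus>\<^bsub>M\<^esub> y \<in> H" if xy: "x \<in> H +>\<^bsub>M\<^esub> y"
  proof -
    obtain h where h: "h \<in> H" "x = h \<oplus>\<^bsub>M\<^esub> y" using xy by (auto simp: a_r_coset_def')
    then show ?thesis using y by (simp add: M.minus_eq M.a_assoc M.r_neg)
  qed
  ultimately show ?thesis
    using H.a_repr_independence'[of x y] H.a_rcos_self[of x] x y by auto
qed

text \<open>Scalar multiplication on the quotient is a union of cosets over all representatives.
  These cosets coincide, as representatives differ by an element of the submodule \<open>H\<close>,
  and so the union is a single coset.\<close>

lemma coset_smult:
  assumes "r \<in> carrier R" "x \<in> carrier M"
  shows "H +>\<^bsub>M\<^esub> (r \<odot>\<^bsub>M\<^esub> x) = r \<odot>\<^bsub>quotient_module M H\<^esub> (H +>\<^bsub>M\<^esub> x)"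
proof -
  have "H +>\<^bsub>M\<^esub> (r \<odot>\<^bsub>M\<^esub> y) = H +>\<^bsub>M\<^esub> (r \<odot>\<^bsub>M\<^esub> x)" if y: "y \<in> H +>\<^bsub>M\<^esub> x" for y
  proof -
    obtain h where h: "h \<in> H" "y = h \<oplus>\<^bsub>M\<^esub> x" using y by (auto simp: a_r_coset_def')
    have hc: "h \<in> carrier M" using h(1) by simp
    have rh: "r \<odot>\<^bsub>M\<^esub> h \<in> H" using submodule.smult_closed[OF H assms(1) h(1)] .
    have "r \<odot>\<^bsub>M\<^esub> y \<ominus>\<^bsub>M\<^esub> r \<odot>\<^bsub>M\<^esub> x = r \<odot>\<^bsub>M\<^esub> h"
      using assms hc h(2) by (simp add: M.smult_r_distr M.minus_eq M.a_assoc M.r_neg)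
    then show ?thesis using rh assms hc h(2) by (simp add: coset_eq_iff)
  qed
  moreover have "H +>\<^bsub>M\<^esub> x \<noteq> {}" using H.a_rcos_self[OF assms(2)] by blast
  ultimately have "(\<Union>y\<in>H +>\<^bsub>M\<^esub> x. H +>\<^bsub>M\<^esub> (r \<odot>\<^bsub>M\<^esub> y)) = H +>\<^bsub>M\<^esub> (r \<odot>\<^bsub>M\<^esub> x)"
    by (intro SUP_eq_const)
  then show ?thesis by (simp add: quotient_module_def)
qed

lemma coset_zero: "H +>\<^bsub>M\<^esub> \<zero>\<^bsub>M\<^esub> = H"
  using H.a_subset by simp

lemma coset_eq_zero_iff: "x \<in> carrier M \<Longrightarrow> H +>\<^bsub>M\<^esub> x = H \<longleftrightarrow> x \<in> H"
  using coset_eq_iff[of x "\<zero>\<^bsub>M\<^esub>"] coset_zero by (simp add: M.minus_eq)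

lemma module_quotient: "Module.module R (quotient_module M H)"
  by (rule module_surj_image[OF M, where f = "\<lambda>x. H +>\<^bsub>M\<^esub> x"])
    (simp_all only: quotient_module_simps coset_add coset_smult coset_zero)

lemma coset_hom: "(\<lambda>x. H +>\<^bsub>M\<^esub> x) \<in> module_hom R M (quotient_module M H)"
  by (rule module_homI) (simp_all only: quotient_module_simps coset_add coset_smult imageI)

lemma zero_module_quotient_iff: "zero_module (quotient_module M H) \<longleftrightarrow> carrier M \<subseteq> H"
proof -
  have "carrier M \<noteq> {}" using M.zero_closed by blast
  then have "zero_module (quotient_module M H) \<longleftrightarrow> (\<forall>x\<in>carrier M. H +>\<^bsub>M\<^esub> x = H)"
    unfolding zero_module_def quotient_module_simps by (metis (no_types, lifting) imageI image_constant_conv image_cong singletonD)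
  then show ?thesis by (auto simp: coset_eq_zero_iff)
qed

end

lemma module_span_submodule:
  assumes "Module.module R M" "S \<subseteq> carrier M"
  shows "submodule (module_span R M S) R M" "S \<subseteq> module_span R M S"
    "\<And>H. submodule H R M \<Longrightarrow> S \<subseteq> H \<Longrightarrow> module_span R M S \<subseteq> H"
proof -
  interpret M: Module.module R M by fact
  have c: "carrier M \<in> {H. submodule H R M \<and> S \<subseteq> H}"
    using M.carrier_is_submodule assms by auto
  show "submodule (module_span R M S) R M"
    unfolding module_span_def
  proof (rule M.submoduleI)
    show "\<Inter> {H. submodule H R M \<and> S \<subseteq> H} \<subseteq> carrier M" using c by (rule Inter_lower)
    show "\<zero>\<^bsub>M\<^esub> \<in> \<Inter> {H. submodule H R M \<and> S \<subseteq> H}" using submodule_zero by fast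
  qed (simp_all add: M.submoduleE)
qed (auto simp: module_span_def)

section \<open>Direct sums of copies of one module, and free modules\<close>

definition direct_sum :: "('r, 'c) module \<Rightarrow> 't set \<Rightarrow> ('r, 't \<Rightarrow> 'c) module" where
  "direct_sum C T = \<lparr>carrier = {v. range v \<subseteq> carrier C \<and> finite {t. v t \<noteq> \<zero>\<^bsub>C\<^esub>} \<and> {t. v t \<noteq> \<zero>\<^bsub>C\<^esub>} \<subseteq> T},
     monoid.mult = undefined, one = undefined,
     ring.zero = (\<lambda>t. \<zero>\<^bsub>C\<^esub>),
     add = (\<lambda>v w t. v t \<oplus>\<^bsub>C\<^esub> w t),
     smult = (\<lambda>r v t. r \<odot>\<^bsub>C\<^esub> v t)\<rparr>"

lemma direct_sum_carrier:
  "v \<in> carrier (direct_sum C T) \<longleftrightarrow>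
    (\<forall>t. v t \<in> carrier C) \<and> finite {t. v t \<noteq> \<zero>\<^bsub>C\<^esub>} \<and> {t. v t \<noteq> \<zero>\<^bsub>C\<^esub>} \<subseteq> T"
  by (auto simp: direct_sum_def)

lemma direct_sum_ops:
  "\<zero>\<^bsub>direct_sum C T\<^esub> = (\<lambda>t. \<zero>\<^bsub>C\<^esub>)"
  "v \<oplus>\<^bsub>direct_sum C T\<^esub> w = (\<lambda>t. v t \<oplus>\<^bsub>C\<^esub> w t)"
  "r \<odot>\<^bsub>direct_sum C T\<^esub> v = (\<lambda>t. r \<odot>\<^bsub>C\<^esub> v t)"
  by (auto simp: direct_sum_def)

lemma direct_sum_add_closed:
  assumes "Module.module R C" "v \<in> carrier (direct_sum C T)" "w \<in> carrier (direct_sum C T)"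
  shows "(\<lambda>t. v t \<oplus>\<^bsub>C\<^esub> w t) \<in> carrier (direct_sum C T)"
proof -
  interpret C: Module.module R C by fact
  have "{t. v t \<oplus>\<^bsub>C\<^esub> w t \<noteq> \<zero>\<^bsub>C\<^esub>} \<subseteq> {t. v t \<noteq> \<zero>\<^bsub>C\<^esub>} \<union> {t. w t \<noteq> \<zero>\<^bsub>C\<^esub>}"
    by auto
  from finite_subset[OF this] this show ?thesis
    using assms by (auto simp: direct_sum_carrier)
qed

lemma direct_sum_smult_closed:
  assumes "Module.module R C" "r \<in> carrier R" "v \<in> carrier (direct_sum C T)"
  shows "(\<lambda>t. r \<odot>\<^bsub>C\<^esub> v t) \<in> carrier (direct_sum C T)"
proof -
  interpret C: Module.module R C by fact
  have "{t. r \<odot>\<^bsub>C\<^esub> v t \<noteq> \<zero>\<^bsub>C\<^esub>} \<subseteq> {t. v t \<noteq> \<zero>\<^bsub>C\<^esub>}"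
    using assms by auto
  from finite_subset[OF this] this show ?thesis
    using assms by (auto simp: direct_sum_carrier)
qed

lemma direct_sum_module:
  fixes R :: "'r ring" and C :: "('r, 'c) module"
  assumes "Module.module R C"
  shows "Module.module R (direct_sum C T)"
proof -
  interpret C: Module.module R C by fact
  have c: "v t \<in> carrier C" if "v \<in> carrier (direct_sum C T)" for v t
    using that by (simp add: direct_sum_carrier)
  note ac = direct_sum_add_closed[OF assms] and sc = direct_sum_smult_closed[OF assms]
  show ?thesis
  proof (rule moduleI[OF C.is_cring])
    show "abelian_group (direct_sum C T)"
    proof (rule abelian_groupI)
      fix x assume x: "x \<in> carrier (direct_sum C T)"
      \<comment> \<open>The inverse is taken to be -1 times \<open>x\<close>, so that closure under
        scalars already gives its membership.\<close>
      have "(\<lambda>t. \<ominus>\<^bsub>R\<^esub> \<one>\<^bsub>R\<^esub> \<odot>\<^bsub>C\<^esub> x t) \<oplus>\<^bsub>direct_sum C T\<^esub> x = \<zero>\<^bsub>direct_sum C T\<^esub>"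
        using c[OF x] by (simp add: direct_sum_ops C.smult_l_minus C.l_neg)
      moreover have "(\<lambda>t. \<ominus>\<^bsub>R\<^esub> \<one>\<^bsub>R\<^esub> \<odot>\<^bsub>C\<^esub> x t) \<in> carrier (direct_sum C T)"
        by (rule sc[OF _ x]) simp
      ultimately show "\<exists>y\<in>carrier (direct_sum C T). y \<oplus>\<^bsub>direct_sum C T\<^esub> x = \<zero>\<^bsub>direct_sum C T\<^esub>"
        by (rule bexI)
    qed (simp_all add: direct_sum_ops ac c C.a_ac, simp add: direct_sum_carrier)
  qed (simp_all add: direct_sum_ops sc c C.smult_l_distr C.smult_r_distr C.smult_assoc1)
qed

text \<open>The map out of a direct sum that is \<open>g t\<close> on the summand \<open>t\<close>.
  The sum is finite because \<open>v\<close> has finite support. Linear extension from a basis is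
  the case \<open>C = R\<close>.\<close>

definition sum_lift :: "('r, 'c) module \<Rightarrow> ('r, 'q) module \<Rightarrow> ('t \<Rightarrow> 'c \<Rightarrow> 'q) \<Rightarrow> ('t \<Rightarrow> 'c) \<Rightarrow> 'q" where
  "sum_lift C Q g v = (\<Oplus>\<^bsub>Q\<^esub>t\<in>{t. v t \<noteq> \<zero>\<^bsub>C\<^esub>}. g t (v t))"

context
  fixes R :: "'r ring" and C :: "('r, 'c) module" and Q :: "('r, 'q) module" and T :: "'t set" and g
  assumes C: "Module.module R C" and Q: "Module.module R Q" and g: "\<And>t. t \<in> T \<Longrightarrow> g t \<in> module_hom R C Q"
begin

interpretation C: Module.module R C by (rule C)
interpretation Q: Module.module R Q by (rule Q)

lemma sum_lift_term_closed:
  assumes "v \<in> carrier (direct_sum C T)" "t \<in> T"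
  shows "g t (v t) \<in> carrier Q"
  using assms by (intro module_hom_closed[OF g]) (simp_all add: direct_sum_carrier)

text \<open>Extra indices contribute \<open>g t\<close> of zero. Two vectors with different supports
  can thus be summed over a common index set, which is how additivity of \<open>sum_lift\<close> is
  obtained.\<close>

lemma sum_lift_superset:
  assumes v: "v \<in> carrier (direct_sum C T)" and X: "finite X" "{t. v t \<noteq> \<zero>\<^bsub>C\<^esub>} \<subseteq> X" "X \<subseteq> T"
  shows "sum_lift C Q g v = (\<Oplus>\<^bsub>Q\<^esub>t\<in>X. g t (v t))"
  unfolding sum_lift_def
proof (rule Q.add.finprod_mono_neutral_cong_left[OF X(1,2)])
  show "g t (v t) = \<zero>\<^bsub>Q\<^esub>" if "t \<in> X - {t. v t \<noteq> \<zero>\<^bsub>C\<^esub>}" for t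
  proof -
    have "t \<in> T" "v t = \<zero>\<^bsub>C\<^esub>" using that X(3) by auto
    then show "g t (v t) = \<zero>\<^bsub>Q\<^esub>" using module_hom_zero[OF C Q g] by simp
  qed
  show "(\<lambda>t. g t (v t)) \<in> X \<rightarrow> carrier Q" using sum_lift_term_closed[OF v] X(3) by (intro funcsetI) blast
qed simp

lemma sum_lift_hom: "sum_lift C Q g \<in> module_hom R (direct_sum C T) Q"
proof (rule module_homI)
  fix v assume v: "v \<in> carrier (direct_sum C T)"
  let ?V = "{t. v t \<noteq> \<zero>\<^bsub>C\<^esub>}"
  have V: "finite ?V" "?V \<subseteq> T" using v by (simp_all add: direct_sum_carrier)
  have gv: "(\<lambda>t. g t (v t)) \<in> X \<rightarrow> carrier Q" if "X \<subseteq> T" for X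
    using sum_lift_term_closed[OF v] that by (intro funcsetI) blast
  show "sum_lift C Q g v \<in> carrier Q" unfolding sum_lift_def by (rule Q.finsum_closed[OF gv[OF V(2)]])
  {
    fix w assume w: "w \<in> carrier (direct_sum C T)"
    let ?W = "{t. w t \<noteq> \<zero>\<^bsub>C\<^esub>}"
    let ?X = "?V \<union> ?W"
    have W: "finite ?W" "?W \<subseteq> T" using w by (simp_all add: direct_sum_carrier)
    have X: "finite ?X" "?X \<subseteq> T" using V W by auto
    have gw: "(\<lambda>t. g t (w t)) \<in> ?X \<rightarrow> carrier Q"
      using sum_lift_term_closed[OF w] X(2) by (intro funcsetI) blast
    have "v \<oplus>\<^bsub>direct_sum C T\<^esub> w \<in> carrier (direct_sum C T)"
      by (rule module_add_closed[OF direct_sum_module[OF C] v w])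
    moreover have "{t. (v \<oplus>\<^bsub>direct_sum C T\<^esub> w) t \<noteq> \<zero>\<^bsub>C\<^esub>} \<subseteq> ?X" by (auto simp: direct_sum_ops)
    ultimately have "sum_lift C Q g (v \<oplus>\<^bsub>direct_sum C T\<^esub> w) =
        (\<Oplus>\<^bsub>Q\<^esub>t\<in>?X. g t ((v \<oplus>\<^bsub>direct_sum C T\<^esub> w) t))"
      using X by (intro sum_lift_superset)
    also have "\<dots> = (\<Oplus>\<^bsub>Q\<^esub>t\<in>?X. g t (v t) \<oplus>\<^bsub>Q\<^esub> g t (w t))"
    proof (rule Q.finsum_cong'[OF refl])
      show "(\<lambda>t. g t (v t) \<oplus>\<^bsub>Q\<^esub> g t (w t)) \<in> ?X \<rightarrow> carrier Q"
        using gv[OF X(2)] gw by (intro funcsetI Q.a_closed) (auto dest: funcset_mem)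
      fix t assume "t \<in> ?X"
      then have t: "t \<in> T" using X(2) by blast
      show "g t ((v \<oplus>\<^bsub>direct_sum C T\<^esub> w) t) = g t (v t) \<oplus>\<^bsub>Q\<^esub> g t (w t)"
        using v w by (simp add: direct_sum_ops direct_sum_carrier module_hom_add[OF g[OF t]])
    qed
    also have "\<dots> = (\<Oplus>\<^bsub>Q\<^esub>t\<in>?X. g t (v t)) \<oplus>\<^bsub>Q\<^esub> (\<Oplus>\<^bsub>Q\<^esub>t\<in>?X. g t (w t))"
      by (rule Q.finsum_addf[OF gv[OF X(2)] gw])
    also have "(\<Oplus>\<^bsub>Q\<^esub>t\<in>?X. g t (v t)) = sum_lift C Q g v"
      by (rule sum_lift_superset[OF v X(1) _ X(2), symmetric]) simp
    also have "(\<Oplus>\<^bsub>Q\<^esub>t\<in>?X. g t (w t)) = sum_lift C Q g w"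
      by (rule sum_lift_superset[OF w X(1) _ X(2), symmetric]) simp
    finally show "sum_lift C Q g (v \<oplus>\<^bsub>direct_sum C T\<^esub> w) = sum_lift C Q g v \<oplus>\<^bsub>Q\<^esub> sum_lift C Q g w" .
  }
  fix r assume r: "r \<in> carrier R"
  have "r \<odot>\<^bsub>direct_sum C T\<^esub> v \<in> carrier (direct_sum C T)"
    using direct_sum_smult_closed[OF C r v] by (simp add: direct_sum_ops)
  moreover have "{t. (r \<odot>\<^bsub>direct_sum C T\<^esub> v) t \<noteq> \<zero>\<^bsub>C\<^esub>} \<subseteq> ?V" using r by (auto simp: direct_sum_ops)
  ultimately have "sum_lift C Q g (r \<odot>\<^bsub>direct_sum C T\<^esub> v) = (\<Oplus>\<^bsub>Q\<^esub>t\<in>?V. g t ((r \<odot>\<^bsub>direct_sum C T\<^esub> v) t))"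
    using V by (intro sum_lift_superset)
  also have "\<dots> = (\<Oplus>\<^bsub>Q\<^esub>t\<in>?V. r \<odot>\<^bsub>Q\<^esub> g t (v t))"
  proof (rule Q.finsum_cong'[OF refl])
    show "(\<lambda>t. r \<odot>\<^bsub>Q\<^esub> g t (v t)) \<in> ?V \<rightarrow> carrier Q"
      using gv[OF V(2)] r by (intro funcsetI Q.smult_closed) (auto dest: funcset_mem)
    fix t assume "t \<in> ?V"
    then have t: "t \<in> T" using V(2) by blast
    show "g t ((r \<odot>\<^bsub>direct_sum C T\<^esub> v) t) = r \<odot>\<^bsub>Q\<^esub> g t (v t)"
      using v r by (simp add: direct_sum_ops direct_sum_carrier module_hom_smult[OF g[OF t]])
  qed
  also have "\<dots> = r \<odot>\<^bsub>Q\<^esub> sum_lift C Q g v"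
    unfolding sum_lift_def by (rule Q.finsum_smult_ldistr[OF V(1) r gv[OF V(2)], symmetric])
  finally show "sum_lift C Q g (r \<odot>\<^bsub>direct_sum C T\<^esub> v) = r \<odot>\<^bsub>Q\<^esub> sum_lift C Q g v" .
qed

end

lemma free_module_carrier:
  "v \<in> carrier (free_module R S) \<longleftrightarrow>
    (\<forall>s. v s \<in> carrier R) \<and> finite {s. v s \<noteq> \<zero>\<^bsub>R\<^esub>} \<and> {s. v s \<noteq> \<zero>\<^bsub>R\<^esub>} \<subseteq> S"
  by (auto simp: free_module_def)

lemma free_module_ops:
  "\<zero>\<^bsub>free_module R S\<^esub> = (\<lambda>s. \<zero>\<^bsub>R\<^esub>)"
  "v \<oplus>\<^bsub>free_module R S\<^esub> w = (\<lambda>s. v s \<oplus>\<^bsub>R\<^esub> w s)"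
  "r \<odot>\<^bsub>free_module R S\<^esub> v = (\<lambda>s. r \<otimes>\<^bsub>R\<^esub> v s)"
  by (auto simp: free_module_def)

lemma regular_module_module:
  assumes "cring R"
  shows "Module.module R (regular_module R)"
proof -
  interpret cring R by fact
  show ?thesis
  proof (rule moduleI[OF assms])
    show "abelian_group (regular_module R)"
    proof (rule abelian_groupI)
      show "\<exists>y\<in>carrier (regular_module R). y \<oplus>\<^bsub>regular_module R\<^esub> x = \<zero>\<^bsub>regular_module R\<^esub>"
        if "x \<in> carrier (regular_module R)" for x
        using that by (intro bexI[of _ "\<ominus>\<^bsub>R\<^esub> x"]) (simp_all add: regular_module_def l_neg)
    qed (simp_all add: regular_module_def a_ac)
  qed (simp_all add: regular_module_def l_distr r_distr m_assoc)
qed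

text \<open>Free modules inherit their structure and their universal property from
  \<open>direct_sum\<close>. Coefficients in a general module are kept because
  \<open>P \<otimes> C\<close> will be a retract of a direct sum of copies of
  \<open>C\<close>.\<close>

lemma free_module_eq_direct_sum: "free_module R S = direct_sum (regular_module R) S"
  by (simp add: free_module_def direct_sum_def regular_module_def)

lemma free_module_module: "cring R \<Longrightarrow> Module.module R (free_module R S)"
  unfolding free_module_eq_direct_sum by (intro direct_sum_module regular_module_module)

lemma free_module_uminus:
  assumes "cring R" "v \<in> carrier (free_module R S)"
  shows "\<ominus>\<^bsub>free_module R S\<^esub> v = (\<lambda>s. \<ominus>\<^bsub>R\<^esub> v s)"
proof -
  interpret cring R by fact
  interpret F: Module.module R "free_module R S" using assms by (simp add: free_module_module)
  have "\<ominus>\<^bsub>free_module R S\<^esub> v = (\<ominus>\<^bsub>R\<^esub> \<one>\<^bsub>R\<^esub>) \<odot>\<^bsub>free_module R S\<^esub> v"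
    using assms F.smult_l_minus[of "\<one>\<^bsub>R\<^esub>" v] by (simp )
  then show ?thesis using assms by (auto simp: free_module_carrier free_module_ops l_minus)
qed

lemma basis_vector_closed:
  assumes "cring R" "s \<in> S"
  shows "basis_vector R s \<in> carrier (free_module R S)"
proof -
  interpret cring R by fact
  have "{t. basis_vector R s t \<noteq> \<zero>\<^bsub>R\<^esub>} \<subseteq> {s}" by (auto simp: basis_vector_def)
  from finite_subset[OF this] show ?thesis using assms by (auto simp: free_module_carrier basis_vector_def)
qed

text \<open>The support is emptied one basis element at a time. The underlying induction runs over a
  finite superset of the support, so that an index with coefficient zero can simply be
  dropped.\<close>

lemma free_module_induct [consumes 2, case_names zero step]:
  assumes "cring R" "v \<in> carrier (free_module R S)"
    and zero: "P \<zero>\<^bsub>free_module R S\<^esub>"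
    and step: "\<And>r s w. r \<in> carrier R \<Longrightarrow> s \<in> S \<Longrightarrow> w \<in> carrier (free_module R S) \<Longrightarrow> P w \<Longrightarrow>
      P (r \<odot>\<^bsub>free_module R S\<^esub> basis_vector R s \<oplus>\<^bsub>free_module R S\<^esub> w)"
  shows "P v"
proof -
  interpret cring R by fact
  have *: "finite T \<Longrightarrow> v \<in> carrier (free_module R S) \<Longrightarrow> {s. v s \<noteq> \<zero>\<^bsub>R\<^esub>} \<subseteq> T \<Longrightarrow> P v" for T v
  proof (induction T arbitrary: v rule: finite_induct)
    case empty
    then have "v = \<zero>\<^bsub>free_module R S\<^esub>" by (auto simp: free_module_ops)
    then show ?case using zero by simp
  next
    case (insert t T)
    show ?case
    proof (cases "v t = \<zero>\<^bsub>R\<^esub>")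
      case True
      then show ?thesis using insert by blast
    next
      case False
      let ?w = "v(t := \<zero>\<^bsub>R\<^esub>)"
      have sub: "{s. ?w s \<noteq> \<zero>\<^bsub>R\<^esub>} \<subseteq> {s. v s \<noteq> \<zero>\<^bsub>R\<^esub>}" by auto
      then have w: "?w \<in> carrier (free_module R S)"
        using insert.prems(1) finite_subset[OF sub] by (auto simp: free_module_carrier)
      have "P ?w" using insert.prems by (intro insert.IH w) auto
      moreover have "v t \<in> carrier R" "t \<in> S" using insert.prems False by (auto simp: free_module_carrier)
      moreover have "v t \<odot>\<^bsub>free_module R S\<^esub> basis_vector R t \<oplus>\<^bsub>free_module R S\<^esub> ?w = v"
        using insert.prems(1) by (auto simp: fun_eq_iff basis_vector_def free_module_carrier free_module_ops)
      ultimately show ?thesis using step w by metis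
    qed
  qed
  show ?thesis using *[of "{s. v s \<noteq> \<zero>\<^bsub>R\<^esub>}" v] assms(2) by (simp add: free_module_carrier)
qed

lemma free_module_hom_eq:
  assumes M: "Module.module R M"
    and f: "f \<in> module_hom R (free_module R S) M" and g: "g \<in> module_hom R (free_module R S) M"
    and eq: "\<And>s. s \<in> S \<Longrightarrow> f (basis_vector R s) = g (basis_vector R s)"
    and v: "v \<in> carrier (free_module R S)"
  shows "f v = g v"
proof -
  have R: "cring R" using M by (rule module_ring)
  interpret F: Module.module R "free_module R S" using R by (simp add: free_module_module)
  show ?thesis
    using R v
  proof (induction rule: free_module_induct)
    case zero
    then show ?case using module_hom_zero[OF _ M f] module_hom_zero[OF _ M g] F.module_axioms by simp
  next
    case (step r s w)
    have b: "basis_vector R s \<in> carrier (free_module R S)" using step R by (simp add: basis_vector_closed)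
    show ?case
      using step b
      by (simp add: module_hom_add[OF f] module_hom_add[OF g] module_hom_smult[OF f] module_hom_smult[OF g] eq
          )
  qed
qed

context
  fixes R :: "'r ring" and M :: "('r, 'm) module" and S :: "'s set" and \<phi>
  assumes M: "Module.module R M" and \<phi>: "\<And>s. s \<in> S \<Longrightarrow> \<phi> s \<in> carrier M"
begin

interpretation M: Module.module R M by (rule M)

lemma linear_extension_eq_sum_lift:
  "linear_extension R M \<phi> = sum_lift (regular_module R) M (\<lambda>s r. r \<odot>\<^bsub>M\<^esub> \<phi> s)"
  by (simp add: fun_eq_iff linear_extension_def sum_lift_def regular_module_def)

lemma scalar_multiples_hom: "s \<in> S \<Longrightarrow> (\<lambda>r. r \<odot>\<^bsub>M\<^esub> \<phi> s) \<in> module_hom R (regular_module R) M"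
  by (rule module_homI) (simp_all add: \<phi> regular_module_def M.smult_l_distr M.smult_assoc1)

lemma linear_extension_hom: "linear_extension R M \<phi> \<in> module_hom R (free_module R S) M"
  unfolding linear_extension_eq_sum_lift free_module_eq_direct_sum
  by (rule sum_lift_hom[OF regular_module_module[OF M.is_cring] M scalar_multiples_hom])

lemma linear_extension_basis:
  assumes s: "s \<in> S"
  shows "linear_extension R M \<phi> (basis_vector R s) = \<phi> s"
proof -
  have "linear_extension R M \<phi> (basis_vector R s) = (\<Oplus>\<^bsub>M\<^esub>t\<in>{s}. basis_vector R s t \<odot>\<^bsub>M\<^esub> \<phi> t)"
    unfolding linear_extension_eq_sum_lift
  proof (rule sum_lift_superset[OF regular_module_module[OF M.is_cring] M scalar_multiples_hom])
    show "basis_vector R s \<in> carrier (direct_sum (regular_module R) S)"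
      using basis_vector_closed[OF M.is_cring s] by (simp add: free_module_eq_direct_sum)
    show "{t. basis_vector R s t \<noteq> \<zero>\<^bsub>regular_module R\<^esub>} \<subseteq> {s}"
      by (auto simp: basis_vector_def regular_module_def)
  qed (simp_all add: s)
  then show ?thesis using s \<phi> by (simp add: basis_vector_def)
qed

end

text \<open>Preimages are chosen on the basis only, and linearity does the rest. The image condition
  is put on \<open>g\<close> instead of asking \<open>p\<close> to be surjective, because
  \<open>p\<close> will be a differential and \<open>g\<close> a map into its image.\<close>

lemma free_module_lift:
  assumes M: "Module.module R M" and N: "Module.module R N"
    and g: "g \<in> module_hom R (free_module R S) N" and p: "p \<in> module_hom R M N"
    and im: "\<And>x. x \<in> carrier (free_module R S) \<Longrightarrow> g x \<in> p ` carrier M"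
  shows "\<exists>f \<in> module_hom R (free_module R S) M. \<forall>x\<in>carrier (free_module R S). p (f x) = g x"
proof -
  have R: "cring R" using M by (rule module_ring)
  have "\<exists>y. y \<in> carrier M \<and> p y = g (basis_vector R s)" if s: "s \<in> S" for s
    using im[OF basis_vector_closed[OF R s]] by (auto simp: image_iff)
  then obtain \<phi> where \<phi>: "\<And>s. s \<in> S \<Longrightarrow> \<phi> s \<in> carrier M \<and> p (\<phi> s) = g (basis_vector R s)"
    by metis
  let ?f = "linear_extension R M \<phi>"
  have f: "?f \<in> module_hom R (free_module R S) M"
    by (rule linear_extension_hom[OF M]) (simp add: \<phi>)
  have pf: "(\<lambda>x. p (?f x)) \<in> module_hom R (free_module R S) N"
    by (rule module_hom_comp[OF f p])
  have "p (?f x) = g x" if x: "x \<in> carrier (free_module R S)" for x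
  proof (rule free_module_hom_eq[OF N pf g _ x])
    show "p (?f (basis_vector R s)) = g (basis_vector R s)" if s: "s \<in> S" for s
      using linear_extension_basis[OF M, of S \<phi> s] \<phi> s by simp
  qed
  then show ?thesis by (intro bexI[OF _ f] ballI)
qed

section \<open>Tensor products\<close>

definition bilinear_map ::
  "'r ring \<Rightarrow> ('r, 'a) module \<Rightarrow> ('r, 'b) module \<Rightarrow> ('r, 'm) module \<Rightarrow> ('a \<Rightarrow> 'b \<Rightarrow> 'm) \<Rightarrow> bool" where
  "bilinear_map R A B M \<beta> \<longleftrightarrow>
     (\<forall>a\<in>carrier A. \<beta> a \<in> module_hom R B M) \<and> (\<forall>b\<in>carrier B. (\<lambda>a. \<beta> a b) \<in> module_hom R A M)"

text \<open>The form of \<open>tensor_map\<close>, with an arbitrary bilinear map in place of the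
  one sending \<open>(a, b)\<close> to \<open>f a \<otimes> b\<close>; the universal property is
  thus proved once for both. The use of \<open>the_elem\<close> is justified by
  \<open>tensor_lift_coset\<close>: the linear extension is constant on each coset.\<close>

definition tensor_lift ::
  "'r ring \<Rightarrow> ('r, 'm) module \<Rightarrow> ('a \<Rightarrow> 'b \<Rightarrow> 'm) \<Rightarrow> ('a \<times> 'b \<Rightarrow> 'r) set \<Rightarrow> 'm" where
  "tensor_lift R M \<beta> X = the_elem (linear_extension R M (\<lambda>(a, b). \<beta> a b) ` X)"

lemma tensor_map_eq_lift:
  "tensor_map R A' B f = tensor_lift R (tensor_module R A' B) (\<lambda>a b. pure_tensor R A' B (f a) b)"
  by (simp add: fun_eq_iff tensor_map_def tensor_lift_def)

context
  fixes R :: "'r ring" and A :: "('r, 'a) module" and B :: "('r, 'b) module"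
  assumes A: "Module.module R A" and B: "Module.module R B"
begin

interpretation A: Module.module R A by (rule A)
interpretation B: Module.module R B by (rule B)

abbreviation (input) "TF \<equiv> free_module R (carrier A \<times> carrier B)"
abbreviation (input) "TK \<equiv> tensor_kernel R A B"
abbreviation (input) "TT \<equiv> tensor_module R A B"

lemma TF: "Module.module R TF"
  by (rule free_module_module[OF A.is_cring])

interpretation F: Module.module R TF by (rule TF)

lemma tensor_basis_closed:
  "a \<in> carrier A \<Longrightarrow> b \<in> carrier B \<Longrightarrow> basis_vector R (a, b) \<in> carrier TF"
  by (rule basis_vector_closed[OF A.is_cring]) simp

lemma tensor_relations_subset: "tensor_relations R A B \<subseteq> carrier TF"
  unfolding tensor_relations_def Let_def
  by (auto intro!: F.minus_closed F.a_closed F.smult_closed tensor_basis_closed)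

lemma tensor_kernel_submodule: "submodule TK R TF"
  unfolding tensor_kernel_def by (rule module_span_submodule(1)[OF TF tensor_relations_subset])

lemma tensor_relations_kernel: "x \<in> tensor_relations R A B \<Longrightarrow> x \<in> TK"
  unfolding tensor_kernel_def using module_span_submodule(2)[OF TF tensor_relations_subset] by blast

lemma tensor_module_module: "Module.module R TT"
  unfolding tensor_module_def by (rule module_quotient[OF TF tensor_kernel_submodule])

interpretation T: Module.module R TT by (rule tensor_module_module)

lemma tensor_coset_hom: "(\<lambda>x. TK +>\<^bsub>TF\<^esub> x) \<in> module_hom R TF TT"
  unfolding tensor_module_def by (rule coset_hom[OF TF tensor_kernel_submodule])

lemma pure_tensor_closed:
  "a \<in> carrier A \<Longrightarrow> b \<in> carrier B \<Longrightarrow> pure_tensor R A B a b \<in> carrier TT"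
  unfolding pure_tensor_def by (rule module_hom_closed[OF tensor_coset_hom tensor_basis_closed])

lemma tensor_coset_eqI:
  assumes "x \<in> carrier TF" "y \<in> carrier TF" "x \<ominus>\<^bsub>TF\<^esub> y \<in> tensor_relations R A B"
  shows "TK +>\<^bsub>TF\<^esub> x = TK +>\<^bsub>TF\<^esub> y"
  using coset_eq_iff[OF TF tensor_kernel_submodule assms(1,2)] tensor_relations_kernel[OF assms(3)] by simp

lemma pure_tensor_relation:
  assumes "a \<in> carrier A" "b \<in> carrier B" "y \<in> carrier TF"
    "basis_vector R (a, b) \<ominus>\<^bsub>TF\<^esub> y \<in> tensor_relations R A B"
  shows "pure_tensor R A B a b = TK +>\<^bsub>TF\<^esub> y"
  unfolding pure_tensor_def by (rule tensor_coset_eqI[OF tensor_basis_closed[OF assms(1,2)] assms(3,4)])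

lemma pure_tensor_add_left:
  assumes "a \<in> carrier A" "a' \<in> carrier A" "b \<in> carrier B"
  shows "pure_tensor R A B (a \<oplus>\<^bsub>A\<^esub> a') b = pure_tensor R A B a b \<oplus>\<^bsub>TT\<^esub> pure_tensor R A B a' b"
proof -
  have "pure_tensor R A B (a \<oplus>\<^bsub>A\<^esub> a') b = TK +>\<^bsub>TF\<^esub> (basis_vector R (a, b) \<oplus>\<^bsub>TF\<^esub> basis_vector R (a', b))"
  proof (rule pure_tensor_relation)
    show "basis_vector R (a \<oplus>\<^bsub>A\<^esub> a', b) \<ominus>\<^bsub>TF\<^esub> (basis_vector R (a, b) \<oplus>\<^bsub>TF\<^esub> basis_vector R (a', b))
        \<in> tensor_relations R A B"
      unfolding tensor_relations_def Let_def using assms by blast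
  qed (use assms in \<open>simp_all add: tensor_basis_closed F.a_closed\<close>)
  then show ?thesis
    using assms by (simp add: module_hom_add[OF tensor_coset_hom] tensor_basis_closed pure_tensor_def)
qed

lemma pure_tensor_add_right:
  assumes "a \<in> carrier A" "b \<in> carrier B" "b' \<in> carrier B"
  shows "pure_tensor R A B a (b \<oplus>\<^bsub>B\<^esub> b') = pure_tensor R A B a b \<oplus>\<^bsub>TT\<^esub> pure_tensor R A B a b'"
proof -
  have "pure_tensor R A B a (b \<oplus>\<^bsub>B\<^esub> b') = TK +>\<^bsub>TF\<^esub> (basis_vector R (a, b) \<oplus>\<^bsub>TF\<^esub> basis_vector R (a, b'))"
  proof (rule pure_tensor_relation)
    show "basis_vector R (a, b \<oplus>\<^bsub>B\<^esub> b') \<ominus>\<^bsub>TF\<^esub> (basis_vector R (a, b) \<oplus>\<^bsub>TF\<^esub> basis_vector R (a, b'))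
        \<in> tensor_relations R A B"
      unfolding tensor_relations_def Let_def using assms by blast
  qed (use assms in \<open>simp_all add: tensor_basis_closed F.a_closed\<close>)
  then show ?thesis
    using assms by (simp add: module_hom_add[OF tensor_coset_hom] tensor_basis_closed pure_tensor_def)
qed

lemma pure_tensor_smult_left:
  assumes "r \<in> carrier R" "a \<in> carrier A" "b \<in> carrier B"
  shows "pure_tensor R A B (r \<odot>\<^bsub>A\<^esub> a) b = r \<odot>\<^bsub>TT\<^esub> pure_tensor R A B a b"
proof -
  have "pure_tensor R A B (r \<odot>\<^bsub>A\<^esub> a) b = TK +>\<^bsub>TF\<^esub> (r \<odot>\<^bsub>TF\<^esub> basis_vector R (a, b))"
  proof (rule pure_tensor_relation)
    show "basis_vector R (r \<odot>\<^bsub>A\<^esub> a, b) \<ominus>\<^bsub>TF\<^esub> (r \<odot>\<^bsub>TF\<^esub> basis_vector R (a, b)) \<in> tensor_relations R A B"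
      unfolding tensor_relations_def Let_def using assms by blast
  qed (use assms in \<open>simp_all add: tensor_basis_closed F.smult_closed\<close>)
  then show ?thesis
    using assms by (simp add: module_hom_smult[OF tensor_coset_hom] tensor_basis_closed pure_tensor_def)
qed

lemma pure_tensor_smult_right:
  assumes "r \<in> carrier R" "a \<in> carrier A" "b \<in> carrier B"
  shows "pure_tensor R A B a (r \<odot>\<^bsub>B\<^esub> b) = r \<odot>\<^bsub>TT\<^esub> pure_tensor R A B a b"
proof -
  have "pure_tensor R A B a (r \<odot>\<^bsub>B\<^esub> b) = TK +>\<^bsub>TF\<^esub> (r \<odot>\<^bsub>TF\<^esub> basis_vector R (a, b))"
  proof (rule pure_tensor_relation)
    show "basis_vector R (a, r \<odot>\<^bsub>B\<^esub> b) \<ominus>\<^bsub>TF\<^esub> (r \<odot>\<^bsub>TF\<^esub> basis_vector R (a, b)) \<in> tensor_relations R A B"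
      unfolding tensor_relations_def Let_def using assms by blast
  qed (use assms in \<open>simp_all add: tensor_basis_closed F.smult_closed\<close>)
  then show ?thesis
    using assms by (simp add: module_hom_smult[OF tensor_coset_hom] tensor_basis_closed pure_tensor_def)
qed

lemma bilinear_pure_tensor: "bilinear_map R A B TT (pure_tensor R A B)"
  unfolding bilinear_map_def
  by (intro conjI ballI module_homI)
    (simp_all add: pure_tensor_closed pure_tensor_add_left pure_tensor_add_right
      pure_tensor_smult_left pure_tensor_smult_right)

lemma pure_tensor_zero_left:
  assumes "b \<in> carrier B"
  shows "pure_tensor R A B \<zero>\<^bsub>A\<^esub> b = \<zero>\<^bsub>TT\<^esub>"
  using module_hom_zero[OF A tensor_module_module, of "\<lambda>a. pure_tensor R A B a b"]
    bilinear_pure_tensor assms by (simp add: bilinear_map_def)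

lemma tensor_cases:
  assumes "x \<in> carrier TT"
  obtains v where "v \<in> carrier TF" "x = TK +>\<^bsub>TF\<^esub> v"
  using assms unfolding tensor_module_def quotient_module_simps by blast

text \<open>There is no case for scalar multiples or for zero: a scalar is absorbed into the first
  factor of a pure tensor, and zero is the pure tensor of zeros.\<close>

lemma tensor_induct [consumes 1, case_names pure add]:
  assumes x: "x \<in> carrier TT"
    and pure: "\<And>a b. a \<in> carrier A \<Longrightarrow> b \<in> carrier B \<Longrightarrow> P (pure_tensor R A B a b)"
    and add: "\<And>x y. x \<in> carrier TT \<Longrightarrow> y \<in> carrier TT \<Longrightarrow> P x \<Longrightarrow> P y \<Longrightarrow> P (x \<oplus>\<^bsub>TT\<^esub> y)"
  shows "P x"
proof -
  obtain v where v: "v \<in> carrier TF" "x = TK +>\<^bsub>TF\<^esub> v" using x by (rule tensor_cases)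
  have "P (TK +>\<^bsub>TF\<^esub> v)"
    using A.is_cring v(1)
  proof (induction rule: free_module_induct)
    case zero
    have "TK +>\<^bsub>TF\<^esub> \<zero>\<^bsub>TF\<^esub> = \<zero>\<^bsub>TT\<^esub>"
      by (rule module_hom_zero[OF TF tensor_module_module tensor_coset_hom])
    then show ?case
      using pure[of "\<zero>\<^bsub>A\<^esub>" "\<zero>\<^bsub>B\<^esub>"] pure_tensor_zero_left[of "\<zero>\<^bsub>B\<^esub>"] by simp
  next
    case (step r s w)
    obtain a b where ab: "s = (a, b)" "a \<in> carrier A" "b \<in> carrier B" using step(2) by auto
    have e: "basis_vector R s \<in> carrier TF" using ab tensor_basis_closed by simp
    have "TK +>\<^bsub>TF\<^esub> (r \<odot>\<^bsub>TF\<^esub> basis_vector R s \<oplus>\<^bsub>TF\<^esub> w) =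
        r \<odot>\<^bsub>TT\<^esub> pure_tensor R A B a b \<oplus>\<^bsub>TT\<^esub> (TK +>\<^bsub>TF\<^esub> w)"
      using step(1,3) ab e
      by (simp add: module_hom_add[OF tensor_coset_hom] module_hom_smult[OF tensor_coset_hom]
          pure_tensor_def)
    also have "\<dots> = pure_tensor R A B (r \<odot>\<^bsub>A\<^esub> a) b \<oplus>\<^bsub>TT\<^esub> (TK +>\<^bsub>TF\<^esub> w)"
      using step(1) ab by (simp add: pure_tensor_smult_left)
    finally have eq: "TK +>\<^bsub>TF\<^esub> (r \<odot>\<^bsub>TF\<^esub> basis_vector R s \<oplus>\<^bsub>TF\<^esub> w) =
        pure_tensor R A B (r \<odot>\<^bsub>A\<^esub> a) b \<oplus>\<^bsub>TT\<^esub> (TK +>\<^bsub>TF\<^esub> w)" .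
    show ?case
      unfolding eq using step ab
      by (intro add pure pure_tensor_closed module_hom_closed[OF tensor_coset_hom]) simp_all
  qed
  then show ?thesis using v by simp
qed

lemma tensor_hom_eq:
  assumes M: "Module.module R M" and f: "f \<in> module_hom R TT M" and g: "g \<in> module_hom R TT M"
    and eq: "\<And>a b. a \<in> carrier A \<Longrightarrow> b \<in> carrier B \<Longrightarrow>
      f (pure_tensor R A B a b) = g (pure_tensor R A B a b)"
    and x: "x \<in> carrier TT"
  shows "f x = g x"
  using x by (induction rule: tensor_induct) (simp_all add: eq module_hom_add[OF f] module_hom_add[OF g])

context
  fixes M :: "('r, 'm) module" and \<beta>
  assumes M: "Module.module R M" and \<beta>: "bilinear_map R A B M \<beta>"
begin

interpretation M: Module.module R M by (rule M)

lemma bilinear_right: "a \<in> carrier A \<Longrightarrow> \<beta> a \<in> module_hom R B M"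
  using \<beta> by (simp add: bilinear_map_def)

lemma bilinear_left: "b \<in> carrier B \<Longrightarrow> (\<lambda>a. \<beta> a b) \<in> module_hom R A M"
  using \<beta> by (simp add: bilinear_map_def)

lemma bilinear_closed: "a \<in> carrier A \<Longrightarrow> b \<in> carrier B \<Longrightarrow> \<beta> a b \<in> carrier M"
  by (rule module_hom_closed[OF bilinear_right])

abbreviation (input) "bilinear_extension \<equiv> linear_extension R M (\<lambda>(a, b). \<beta> a b)"

lemma bilinear_extension_hom: "bilinear_extension \<in> module_hom R TF M"
  by (rule linear_extension_hom[OF M]) (auto simp: bilinear_closed)

lemma bilinear_extension_basis: "a \<in> carrier A \<Longrightarrow> b \<in> carrier B \<Longrightarrow> bilinear_extension (basis_vector R (a, b)) = \<beta> a b"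
  using linear_extension_basis[OF M, of "carrier A \<times> carrier B" "\<lambda>(a, b). \<beta> a b" "(a, b)"]
  by (auto simp: bilinear_closed)

text \<open>The kernel of the extension is a submodule, and bilinearity says that it contains the
  defining relations; hence it contains their span.\<close>

lemma bilinear_extension_kernel:
  assumes "x \<in> TK"
  shows "bilinear_extension x = \<zero>\<^bsub>M\<^esub>"
proof -
  note simps = module_hom_diff[OF TF M bilinear_extension_hom] module_hom_add[OF bilinear_extension_hom] module_hom_smult[OF bilinear_extension_hom]
    bilinear_extension_basis tensor_basis_closed
    module_hom_add[OF bilinear_left] module_hom_add[OF bilinear_right]
    module_hom_smult[OF bilinear_left] module_hom_smult[OF bilinear_right]
    bilinear_closed M.minus_eq_zero_iff
  have "tensor_relations R A B \<subseteq> {x \<in> carrier TF. bilinear_extension x = \<zero>\<^bsub>M\<^esub>}"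
  proof
    fix x assume x: "x \<in> tensor_relations R A B"
    then have "bilinear_extension x = \<zero>\<^bsub>M\<^esub>"
      unfolding tensor_relations_def Let_def
      by (elim UnE CollectE exE conjE) (simp_all add: simps)
    then show "x \<in> {x \<in> carrier TF. bilinear_extension x = \<zero>\<^bsub>M\<^esub>}" using x tensor_relations_subset by auto
  qed
  then have "TK \<subseteq> {x \<in> carrier TF. bilinear_extension x = \<zero>\<^bsub>M\<^esub>}"
    unfolding tensor_kernel_def
    by (rule module_span_submodule(3)[OF TF tensor_relations_subset module_kernel_submodule[OF TF M bilinear_extension_hom]])
  then show ?thesis using assms by auto
qed

lemma tensor_lift_coset:
  assumes "v \<in> carrier TF"
  shows "tensor_lift R M \<beta> (TK +>\<^bsub>TF\<^esub> v) = bilinear_extension v"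
proof -
  have sub: "TK \<subseteq> carrier TF" using tensor_kernel_submodule by (rule F.submoduleE)
  have "bilinear_extension (k \<oplus>\<^bsub>TF\<^esub> v) = bilinear_extension v" if k: "k \<in> TK" for k
  proof -
    have "k \<in> carrier TF" using k sub by blast
    then show ?thesis
      using assms k module_hom_closed[OF bilinear_extension_hom assms]
      by (simp add: module_hom_add[OF bilinear_extension_hom] bilinear_extension_kernel)
  qed
  moreover have "TK \<noteq> {}" using submodule_zero[OF tensor_kernel_submodule] by blast
  ultimately have "bilinear_extension ` (TK +>\<^bsub>TF\<^esub> v) = {bilinear_extension v}"
    unfolding a_r_coset_def' by (auto simp: image_UN)
  then show ?thesis by (simp add: tensor_lift_def)
qed

lemma tensor_lift_hom: "tensor_lift R M \<beta> \<in> module_hom R TT M"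
proof (rule module_homI)
  fix x assume "x \<in> carrier TT"
  then obtain v where v: "v \<in> carrier TF" "x = TK +>\<^bsub>TF\<^esub> v" by (rule tensor_cases)
  show "tensor_lift R M \<beta> x \<in> carrier M"
    using v by (simp add: tensor_lift_coset module_hom_closed[OF bilinear_extension_hom])
  show "tensor_lift R M \<beta> (r \<odot>\<^bsub>TT\<^esub> x) = r \<odot>\<^bsub>M\<^esub> tensor_lift R M \<beta> x" if r: "r \<in> carrier R" for r
    using v r by (simp add: tensor_lift_coset module_hom_smult[OF bilinear_extension_hom]
        flip: module_hom_smult[OF tensor_coset_hom])
  fix y assume "y \<in> carrier TT"
  then obtain w where w: "w \<in> carrier TF" "y = TK +>\<^bsub>TF\<^esub> w" by (rule tensor_cases)
  show "tensor_lift R M \<beta> (x \<oplus>\<^bsub>TT\<^esub> y) = tensor_lift R M \<beta> x \<oplus>\<^bsub>M\<^esub> tensor_lift R M \<beta> y"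
    using v w by (simp add: tensor_lift_coset module_hom_add[OF bilinear_extension_hom]
        flip: module_hom_add[OF tensor_coset_hom])
qed

lemma tensor_lift_pure:
  "a \<in> carrier A \<Longrightarrow> b \<in> carrier B \<Longrightarrow> tensor_lift R M \<beta> (pure_tensor R A B a b) = \<beta> a b"
  unfolding pure_tensor_def by (simp add: tensor_lift_coset tensor_basis_closed bilinear_extension_basis)

end

end

section \<open>Functoriality of the tensor product in its first factor\<close>

lemma bilinear_pure_tensor_comp:
  assumes "Module.module R A'" "Module.module R B" "f \<in> module_hom R A A'"
  shows "bilinear_map R A B (tensor_module R A' B) (\<lambda>a b. pure_tensor R A' B (f a) b)"
  unfolding bilinear_map_def
  using bilinear_right[OF assms(1,2) tensor_module_module[OF assms(1,2)] bilinear_pure_tensor[OF assms(1,2)]] module_hom_closed[OF assms(3)]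
    module_hom_comp[OF assms(3) bilinear_left[OF assms(1,2) tensor_module_module[OF assms(1,2)] bilinear_pure_tensor[OF assms(1,2)]]] by simp

lemma tensor_map_hom:
  assumes "Module.module R A" "Module.module R A'" "Module.module R B" "f \<in> module_hom R A A'"
  shows "tensor_map R A' B f \<in> module_hom R (tensor_module R A B) (tensor_module R A' B)"
  unfolding tensor_map_eq_lift
  by (rule tensor_lift_hom[OF assms(1,3) tensor_module_module[OF assms(2,3)]
        bilinear_pure_tensor_comp[OF assms(2,3,4)]])

lemma tensor_map_pure:
  assumes "Module.module R A" "Module.module R A'" "Module.module R B" "f \<in> module_hom R A A'"
    and "a \<in> carrier A" "b \<in> carrier B"
  shows "tensor_map R A' B f (pure_tensor R A B a b) = pure_tensor R A' B (f a) b"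
  unfolding tensor_map_eq_lift
  by (rule tensor_lift_pure[OF assms(1,3) tensor_module_module[OF assms(2,3)]
        bilinear_pure_tensor_comp[OF assms(2,3,4)] assms(5,6)])

text \<open>Identities between composites hold on carriers only, so they cannot be rewritten inside
  \<open>tensor_map\<close> as equations between functions; this lemma is the substitute.\<close>

lemma tensor_map_cong:
  assumes A: "Module.module R A" and A': "Module.module R A'" and B: "Module.module R B"
    and f: "f \<in> module_hom R A A'" and g: "g \<in> module_hom R A A'"
    and eq: "\<And>a. a \<in> carrier A \<Longrightarrow> f a = g a"
    and x: "x \<in> carrier (tensor_module R A B)"
  shows "tensor_map R A' B f x = tensor_map R A' B g x"
proof (rule tensor_hom_eq[OF A B tensor_module_module[OF A' B] tensor_map_hom[OF A A' B f]
      tensor_map_hom[OF A A' B g] _ x])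
  fix a b assume "a \<in> carrier A" "b \<in> carrier B"
  then show "tensor_map R A' B f (pure_tensor R A B a b) = tensor_map R A' B g (pure_tensor R A B a b)"
    by (simp add: tensor_map_pure[OF A A' B f] tensor_map_pure[OF A A' B g] eq)
qed

lemma tensor_map_comp:
  assumes A: "Module.module R A" and A': "Module.module R A'" and A'': "Module.module R A''"
    and B: "Module.module R B"
    and f: "f \<in> module_hom R A A'" and g: "g \<in> module_hom R A' A''"
    and x: "x \<in> carrier (tensor_module R A B)"
  shows "tensor_map R A'' B (\<lambda>a. g (f a)) x = tensor_map R A'' B g (tensor_map R A' B f x)"
proof (rule tensor_hom_eq[OF A B tensor_module_module[OF A'' B]
      tensor_map_hom[OF A A'' B module_hom_comp[OF f g]]
      module_hom_comp[OF tensor_map_hom[OF A A' B f] tensor_map_hom[OF A' A'' B g]] _ x])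
  fix a b assume "a \<in> carrier A" "b \<in> carrier B"
  then show "tensor_map R A'' B (\<lambda>a. g (f a)) (pure_tensor R A B a b) =
      tensor_map R A'' B g (tensor_map R A' B f (pure_tensor R A B a b))"
    by (simp add: tensor_map_pure[OF A A'' B module_hom_comp[OF f g]] tensor_map_pure[OF A A' B f]
        tensor_map_pure[OF A' A'' B g] module_hom_closed[OF f])
qed

lemma tensor_map_plus:
  assumes A: "Module.module R A" and A': "Module.module R A'" and B: "Module.module R B"
    and f: "f \<in> module_hom R A A'" and g: "g \<in> module_hom R A A'"
    and x: "x \<in> carrier (tensor_module R A B)"
  shows "tensor_map R A' B (\<lambda>a. f a \<oplus>\<^bsub>A'\<^esub> g a) x =
    tensor_map R A' B f x \<oplus>\<^bsub>tensor_module R A' B\<^esub> tensor_map R A' B g x"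
proof (rule tensor_hom_eq[OF A B tensor_module_module[OF A' B]
      tensor_map_hom[OF A A' B module_hom_plus[OF A' f g]]
      module_hom_plus[OF tensor_module_module[OF A' B] tensor_map_hom[OF A A' B f] tensor_map_hom[OF A A' B g]] _ x])
  fix a b assume "a \<in> carrier A" "b \<in> carrier B"
  then show "tensor_map R A' B (\<lambda>a. f a \<oplus>\<^bsub>A'\<^esub> g a) (pure_tensor R A B a b) =
      tensor_map R A' B f (pure_tensor R A B a b) \<oplus>\<^bsub>tensor_module R A' B\<^esub>
      tensor_map R A' B g (pure_tensor R A B a b)"
    by (simp add: tensor_map_pure[OF A A' B module_hom_plus[OF A' f g]] tensor_map_pure[OF A A' B f]
        tensor_map_pure[OF A A' B g] module_hom_closed[OF f] module_hom_closed[OF g]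
        pure_tensor_add_left[OF A' B])
qed

lemma tensor_map_ident:
  assumes A: "Module.module R A" and B: "Module.module R B"
    and x: "x \<in> carrier (tensor_module R A B)"
  shows "tensor_map R A B (\<lambda>a. a) x = x"
proof (rule tensor_hom_eq[OF A B tensor_module_module[OF A B] tensor_map_hom[OF A A B module_hom_id] module_hom_id _ x])
  fix a b assume "a \<in> carrier A" "b \<in> carrier B"
  then show "tensor_map R A B (\<lambda>a. a) (pure_tensor R A B a b) = pure_tensor R A B a b"
    by (simp add: tensor_map_pure[OF A A B module_hom_id])
qed

lemma tensor_map_zero:
  assumes A: "Module.module R A" and A': "Module.module R A'" and B: "Module.module R B"
    and x: "x \<in> carrier (tensor_module R A B)"
  shows "tensor_map R A' B (\<lambda>a. \<zero>\<^bsub>A'\<^esub>) x = \<zero>\<^bsub>tensor_module R A' B\<^esub>"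
proof (rule tensor_hom_eq[OF A B tensor_module_module[OF A' B]
      tensor_map_hom[OF A A' B module_hom_const_zero[OF A']]
      module_hom_const_zero[OF tensor_module_module[OF A' B]] _ x])
  fix a b assume "a \<in> carrier A" "b \<in> carrier B"
  then show "tensor_map R A' B (\<lambda>a. \<zero>\<^bsub>A'\<^esub>) (pure_tensor R A B a b) = \<zero>\<^bsub>tensor_module R A' B\<^esub>"
    by (simp add: tensor_map_pure[OF A A' B module_hom_const_zero[OF A']] pure_tensor_zero_left[OF A' B])
qed

lemma zero_module_tensor:
  assumes A: "Module.module R A" and B: "Module.module R B" and zero: "carrier A \<subseteq> {\<zero>\<^bsub>A\<^esub>}"
    and x: "x \<in> carrier (tensor_module R A B)"
  shows "x = \<zero>\<^bsub>tensor_module R A B\<^esub>"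
proof (rule tensor_hom_eq[OF A B tensor_module_module[OF A B] module_hom_id
      module_hom_const_zero[OF tensor_module_module[OF A B]] _ x])
  fix a b assume "a \<in> carrier A" "b \<in> carrier B"
  then show "pure_tensor R A B a b = \<zero>\<^bsub>tensor_module R A B\<^esub>"
    using zero pure_tensor_zero_left[OF A B] by auto
qed

section \<open>Free resolutions and their comparison\<close>

text \<open>
  Degrees are natural numbers, with \<open>d 0\<close> the zero endomorphism of \<open>F 0\<close> in place of the map to
  \<open>F (-1) = 0\<close>; truncated subtraction makes \<open>d n : F n \<rightarrow> F (n - 1)\<close> uniform in \<open>n\<close>.
\<close>

definition resolution_cycle ::
  "'r ring \<Rightarrow> ('r, 'a) module \<Rightarrow> (nat \<Rightarrow> 's set) \<Rightarrow> (nat \<Rightarrow> ('s \<Rightarrow> 'r) \<Rightarrow> 's \<Rightarrow> 'r) \<Rightarrow>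
   (('s \<Rightarrow> 'r) \<Rightarrow> 'a) \<Rightarrow> nat \<Rightarrow> ('s \<Rightarrow> 'r) \<Rightarrow> bool" where
  "resolution_cycle R A S d e n x \<longleftrightarrow>
     d n x = \<zero>\<^bsub>free_module R (S (n - 1))\<^esub> \<and> (n = 0 \<longrightarrow> e x = \<zero>\<^bsub>A\<^esub>)"

text \<open>Exactness is a single equivalence for all degrees because
  \<open>resolution_cycle\<close> adds the augmentation in degree 0. The equation for
  \<open>d 0\<close> ranges over all functions, not only the carrier: the zero vector is the same
  function in every free module, so \<open>d 0\<close> can be read as the zero map into any of
  them.\<close>

definition resolves ::
  "'r ring \<Rightarrow> ('r, 'a) module \<Rightarrow> (nat \<Rightarrow> 's set) \<Rightarrow> (nat \<Rightarrow> ('s \<Rightarrow> 'r) \<Rightarrow> 's \<Rightarrow> 'r) \<Rightarrow>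
   (('s \<Rightarrow> 'r) \<Rightarrow> 'a) \<Rightarrow> bool" where
  "resolves R A S d e \<longleftrightarrow>
     (\<forall>n. d n \<in> module_hom R (free_module R (S n)) (free_module R (S (n - 1)))) \<and>
     (\<forall>x. d 0 x = \<zero>\<^bsub>free_module R (S 0)\<^esub>) \<and>
     e \<in> module_hom R (free_module R (S 0)) A \<and>
     e ` carrier (free_module R (S 0)) = carrier A \<and>
     (\<forall>n. \<forall>x\<in>carrier (free_module R (S n)). resolution_cycle R A S d e n x \<longleftrightarrow>
        x \<in> d (Suc n) ` carrier (free_module R (S (Suc n))))"

definition tor_exact ::
  "'r ring \<Rightarrow> ('r, 'n) module \<Rightarrow> (nat \<Rightarrow> 's set) \<Rightarrow> (nat \<Rightarrow> ('s \<Rightarrow> 'r) \<Rightarrow> 's \<Rightarrow> 'r) \<Rightarrow> nat \<Rightarrow> bool" where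
  "tor_exact R N S d n \<longleftrightarrow>
     (\<forall>x\<in>carrier (tensor_module R (free_module R (S n)) N).
        tensor_map R (free_module R (S (n - 1))) N (d n) x =
          \<zero>\<^bsub>tensor_module R (free_module R (S (n - 1))) N\<^esub> \<longrightarrow>
        (\<exists>y\<in>carrier (tensor_module R (free_module R (S (Suc n))) N).
           x = tensor_map R (free_module R (S n)) N (d (Suc n)) y))"

text \<open>Homomorphisms are compared on carriers only, so extensional functions appear only where
  this is matched with \<open>Ext\<close>. For \<open>n = 0\<close> the conclusion says that
  \<open>\<phi>\<close> is zero on the carrier, since \<open>d 0\<close> is zero.\<close>

definition ext_exact ::
  "'r ring \<Rightarrow> ('r, 'n) module \<Rightarrow> (nat \<Rightarrow> 's set) \<Rightarrow> (nat \<Rightarrow> ('s \<Rightarrow> 'r) \<Rightarrow> 's \<Rightarrow> 'r) \<Rightarrow> nat \<Rightarrow> bool" where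
  "ext_exact R N S d n \<longleftrightarrow>
     (\<forall>\<phi>\<in>module_hom R (free_module R (S n)) N.
        (\<forall>x\<in>carrier (free_module R (S (Suc n))). \<phi> (d (Suc n) x) = \<zero>\<^bsub>N\<^esub>) \<longrightarrow>
        (\<exists>\<psi>\<in>module_hom R (free_module R (S (n - 1))) N.
           \<forall>x\<in>carrier (free_module R (S n)). \<phi> x = \<psi> (d n x)))"

lemma ext_exactD:
  assumes "ext_exact R N S d n" "\<phi> \<in> module_hom R (free_module R (S n)) N"
    and "\<And>x. x \<in> carrier (free_module R (S (Suc n))) \<Longrightarrow> \<phi> (d (Suc n) x) = \<zero>\<^bsub>N\<^esub>"
  shows "\<exists>\<psi>\<in>module_hom R (free_module R (S (n - 1))) N. \<forall>x\<in>carrier (free_module R (S n)). \<phi> x = \<psi> (d n x)"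
  by (rule assms(1)[unfolded ext_exact_def, rule_format, OF assms(2)]) (rule assms(3))

lemma tor_exactD:
  assumes "tor_exact R N S d n" "x \<in> carrier (tensor_module R (free_module R (S n)) N)"
    and "tensor_map R (free_module R (S (n - 1))) N (d n) x = \<zero>\<^bsub>tensor_module R (free_module R (S (n - 1))) N\<^esub>"
  shows "\<exists>y\<in>carrier (tensor_module R (free_module R (S (Suc n))) N).
    x = tensor_map R (free_module R (S n)) N (d (Suc n)) y"
  by (rule assms(1)[unfolded tor_exact_def, rule_format, OF assms(2,3)])

lemma resolvesD:
  assumes "resolves R A S d e"
  shows "d n \<in> module_hom R (free_module R (S n)) (free_module R (S (n - 1)))"
    and "d (Suc n) \<in> module_hom R (free_module R (S (Suc n))) (free_module R (S n))"
    and "d 0 x = \<zero>\<^bsub>free_module R (S 0)\<^esub>"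
    and "e \<in> module_hom R (free_module R (S 0)) A"
    and "e ` carrier (free_module R (S 0)) = carrier A"
    and "x \<in> carrier (free_module R (S n)) \<Longrightarrow> resolution_cycle R A S d e n x \<longleftrightarrow>
        x \<in> d (Suc n) ` carrier (free_module R (S (Suc n)))"
  using assms unfolding resolves_def by (blast, (metis diff_Suc_1), blast+)

lemma resolves_dd:
  assumes "resolves R A S d e" "x \<in> carrier (free_module R (S (Suc n)))"
  shows "resolution_cycle R A S d e n (d (Suc n) x)"
    and "d n (d (Suc n) x) = \<zero>\<^bsub>free_module R (S (n - 1))\<^esub>"
proof -
  show "resolution_cycle R A S d e n (d (Suc n) x)"
    using resolvesD(6)[OF assms(1) module_hom_closed[OF resolvesD(2)[OF assms(1)] assms(2)]] assms(2)
    by blast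
  then show "d n (d (Suc n) x) = \<zero>\<^bsub>free_module R (S (n - 1))\<^esub>"
    by (simp add: resolution_cycle_def)
qed

text \<open>Cycles are boundaries, and maps out of free modules lift along the differential onto the
  boundaries. Comparison maps and homotopies are both built by iterating this step.\<close>

lemma resolution_lift_step:
  assumes R: "cring R" and B: "resolves R B T c q"
    and g: "g \<in> module_hom R (free_module R X) (free_module R (T n))"
    and cyc: "\<And>x. x \<in> carrier (free_module R X) \<Longrightarrow> resolution_cycle R B T c q n (g x)"
  shows "\<exists>f\<in>module_hom R (free_module R X) (free_module R (T (Suc n))).
    \<forall>x\<in>carrier (free_module R X). c (Suc n) (f x) = g x"
proof (rule free_module_lift[OF free_module_module[OF R] free_module_module[OF R] g resolvesD(2)[OF B]])
  fix x assume x: "x \<in> carrier (free_module R X)"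
  show "g x \<in> c (Suc n) ` carrier (free_module R (T (Suc n)))"
    using resolvesD(6)[OF B module_hom_closed[OF g x]] cyc[OF x] by simp
qed

lemma resolution_lift:
  assumes A: "Module.module R A" and B: "Module.module R B"
    and u: "u \<in> module_hom R A B" and rA: "resolves R A S d e" and rB: "resolves R B T c q"
  obtains f where "\<And>n. f n \<in> module_hom R (free_module R (S n)) (free_module R (T n))"
    and "\<And>x. x \<in> carrier (free_module R (S 0)) \<Longrightarrow> q (f 0 x) = u (e x)"
    and "\<And>n x. x \<in> carrier (free_module R (S n)) \<Longrightarrow> c n (f n x) = f (n - 1) (d n x)"
proof -
  have R: "cring R" using A by (rule module_ring)
  note F = free_module_module[OF R]
  \<comment> \<open>The invariant carried along the recursion is that cycles go to cycles; this is
    what makes the next lifting problem solvable. In degree 0 it includes the augmentation and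
    follows from \<open>q (g x) = u (e x)\<close>. The chain map equation is the relation
    \<open>?Q\<close> between consecutive choices.\<close>
  let ?P = "\<lambda>n g. g \<in> module_hom R (free_module R (S n)) (free_module R (T n)) \<and>
    (\<forall>x\<in>carrier (free_module R (S n)).
      resolution_cycle R A S d e n x \<longrightarrow> resolution_cycle R B T c q n (g x)) \<and>
    (n = 0 \<longrightarrow> (\<forall>x\<in>carrier (free_module R (S 0)). q (g x) = u (e x)))"
  let ?Q = "\<lambda>n g g'. \<forall>x\<in>carrier (free_module R (S (Suc n))). c (Suc n) (g' x) = g (d (Suc n) x)"
  have "\<exists>f. \<forall>n. ?P n (f n) \<and> ?Q n (f n) (f (Suc n))"
  proof (rule dependent_nat_choice)
    have "(\<lambda>x. u (e x)) \<in> module_hom R (free_module R (S 0)) B"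
      by (rule module_hom_comp[OF resolvesD(4)[OF rA] u])
    moreover have "u (e x) \<in> q ` carrier (free_module R (T 0))" if "x \<in> carrier (free_module R (S 0))" for x
      using resolvesD(5)[OF rB] module_hom_closed[OF u module_hom_closed[OF resolvesD(4)[OF rA] that]] by simp
    ultimately obtain g where g: "g \<in> module_hom R (free_module R (S 0)) (free_module R (T 0))"
      "\<And>x. x \<in> carrier (free_module R (S 0)) \<Longrightarrow> q (g x) = u (e x)"
      using free_module_lift[OF F B _ resolvesD(4)[OF rB]] by metis
    then have "?P 0 g"
      using resolvesD(3)[OF rB] module_hom_zero[OF A B u] by (auto simp: resolution_cycle_def)
    then show "\<exists>g. ?P 0 g" by blast
  next
    fix g n assume g: "?P n g"
    then have gh: "g \<in> module_hom R (free_module R (S n)) (free_module R (T n))" by simp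
    have d: "d (Suc n) x \<in> carrier (free_module R (S n))" if "x \<in> carrier (free_module R (S (Suc n)))" for x
      by (rule module_hom_closed[OF resolvesD(2)[OF rA] that])
    have "\<exists>f\<in>module_hom R (free_module R (S (Suc n))) (free_module R (T (Suc n))).
        \<forall>x\<in>carrier (free_module R (S (Suc n))). c (Suc n) (f x) = g (d (Suc n) x)"
      by (rule resolution_lift_step[OF R rB module_hom_comp[OF resolvesD(2)[OF rA] gh]])
        (use g d resolves_dd(1)[OF rA] in simp)
    then obtain f where f: "f \<in> module_hom R (free_module R (S (Suc n))) (free_module R (T (Suc n)))"
      "\<And>x. x \<in> carrier (free_module R (S (Suc n))) \<Longrightarrow> c (Suc n) (f x) = g (d (Suc n) x)" by auto
    then have "?P (Suc n) f \<and> ?Q n g f"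
      using module_hom_zero[OF F F gh] by (auto simp: resolution_cycle_def)
    then show "\<exists>f. ?P (Suc n) f \<and> ?Q n g f" by (rule exI[of _ f])
  qed
  then obtain f where PQ: "\<forall>n. ?P n (f n) \<and> ?Q n (f n) (f (Suc n))" by (rule exE)
  have f: "?P n (f n)" "?Q n (f n) (f (Suc n))" for n using spec[OF PQ, of n] by (rule conjunct1, rule conjunct2)
  show thesis
  proof (rule that[of f])
    show h: "f n \<in> module_hom R (free_module R (S n)) (free_module R (T n))" for n using f(1)[of n] by simp
    show "q (f 0 x) = u (e x)" if "x \<in> carrier (free_module R (S 0))" for x using f(1)[of 0] that by simp
    show "c n (f n x) = f (n - 1) (d n x)" if "x \<in> carrier (free_module R (S n))" for n x
    proof (cases n)
      case 0
      then show ?thesis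
        using module_hom_zero[OF F F h[of 0]] by (simp add: resolvesD(3)[OF rA] resolvesD(3)[OF rB])
    next
      case (Suc m)
      then show ?thesis using f(2)[of m] that by simp
    qed
  qed
qed

text \<open>A chain map lying over the zero map is null-homotopic. The next component of the
  homotopy is a lift of \<phi> minus the part already accounted for, which is a cycle.\<close>

lemma resolution_homotopy:
  assumes A: "Module.module R A" and rA: "resolves R A S d e" and rB: "resolves R B T c q"
    and \<phi>: "\<And>n. \<phi> n \<in> module_hom R (free_module R (S n)) (free_module R (T n))"
    and q\<phi>: "\<And>x. x \<in> carrier (free_module R (S 0)) \<Longrightarrow> q (\<phi> 0 x) = \<zero>\<^bsub>B\<^esub>"
    and chain: "\<And>n x. x \<in> carrier (free_module R (S n)) \<Longrightarrow> c n (\<phi> n x) = \<phi> (n - 1) (d n x)"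
  obtains h k where "\<And>n. h n \<in> module_hom R (free_module R (S n)) (free_module R (T (Suc n)))"
    and "\<And>n. k n \<in> module_hom R (free_module R (S (n - 1))) (free_module R (T n))"
    and "\<And>n x. x \<in> carrier (free_module R (S n)) \<Longrightarrow>
      \<phi> n x = c (Suc n) (h n x) \<oplus>\<^bsub>free_module R (T n)\<^esub> k n (d n x)"
proof -
  have R: "cring R" using A by (rule module_ring)
  note F = free_module_module[OF R]
  note G = module_group[OF F]
  \<comment> \<open>Only the values of \<open>h\<close> on the kernel of \<open>d n\<close> matter
    for the next step, since \<open>h\<close> is then applied to boundaries. In degree 0 the kernel
    is everything.\<close>
  let ?P = "\<lambda>n h. h \<in> module_hom R (free_module R (S n)) (free_module R (T (Suc n))) \<and>
    (\<forall>x\<in>carrier (free_module R (S n)). d n x = \<zero>\<^bsub>free_module R (S (n - 1))\<^esub> \<longrightarrow> c (Suc n) (h x) = \<phi> n x)"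
  let ?Q = "\<lambda>n h h'. \<forall>x\<in>carrier (free_module R (S (Suc n))).
    \<phi> (Suc n) x = c (Suc (Suc n)) (h' x) \<oplus>\<^bsub>free_module R (T (Suc n))\<^esub> h (d (Suc n) x)"
  have "\<exists>h. \<forall>n. ?P n (h n) \<and> ?Q n (h n) (h (Suc n))"
  proof (rule dependent_nat_choice)
    have "\<exists>f\<in>module_hom R (free_module R (S 0)) (free_module R (T (Suc 0))).
        \<forall>x\<in>carrier (free_module R (S 0)). c (Suc 0) (f x) = \<phi> 0 x"
      by (rule resolution_lift_step[OF R rB \<phi>]) (simp add: resolution_cycle_def q\<phi> resolvesD(3)[OF rB])
    then show "\<exists>h. ?P 0 h" by auto
  next
    fix h n assume P: "?P n h"
    then have h: "h \<in> module_hom R (free_module R (S n)) (free_module R (T (Suc n)))" by simp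
    note dh = resolvesD(2)[OF rA, of n]
    have d: "d (Suc n) x \<in> carrier (free_module R (S n))" if "x \<in> carrier (free_module R (S (Suc n)))" for x
      by (rule module_hom_closed[OF dh that])
    let ?g = "\<lambda>x. \<phi> (Suc n) x \<ominus>\<^bsub>free_module R (T (Suc n))\<^esub> h (d (Suc n) x)"
    have g: "?g \<in> module_hom R (free_module R (S (Suc n))) (free_module R (T (Suc n)))"
      by (rule module_hom_minus[OF F \<phi> module_hom_comp[OF dh h]])
    have "\<exists>f\<in>module_hom R (free_module R (S (Suc n))) (free_module R (T (Suc (Suc n)))).
        \<forall>x\<in>carrier (free_module R (S (Suc n))). c (Suc (Suc n)) (f x) = ?g x"
    proof (rule resolution_lift_step[OF R rB g])
      fix x assume x: "x \<in> carrier (free_module R (S (Suc n)))"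
      have "c (Suc n) (?g x) = c (Suc n) (\<phi> (Suc n) x) \<ominus>\<^bsub>free_module R (T n)\<^esub> c (Suc n) (h (d (Suc n) x))"
        by (rule module_hom_diff[OF F F resolvesD(2)[OF rB] module_hom_closed[OF \<phi> x]
              module_hom_closed[OF h d[OF x]]])
      also have "c (Suc n) (\<phi> (Suc n) x) = \<phi> n (d (Suc n) x)" using chain[OF x] by simp
      also have "c (Suc n) (h (d (Suc n) x)) = \<phi> n (d (Suc n) x)"
        using P d[OF x] resolves_dd(2)[OF rA x] by blast
      finally show "resolution_cycle R B T c q (Suc n) (?g x)"
        using abelian_group.minus_eq_zero_iff[OF G module_hom_closed[OF \<phi> d[OF x]] module_hom_closed[OF \<phi> d[OF x]]]
        by (simp add: resolution_cycle_def)
    qed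
    then obtain f where f: "f \<in> module_hom R (free_module R (S (Suc n))) (free_module R (T (Suc (Suc n))))"
      and cf: "\<And>x. x \<in> carrier (free_module R (S (Suc n))) \<Longrightarrow> c (Suc (Suc n)) (f x) = ?g x" by blast
    have Q: "?Q n h f"
    proof
      fix x assume x: "x \<in> carrier (free_module R (S (Suc n)))"
      show "\<phi> (Suc n) x = c (Suc (Suc n)) (f x) \<oplus>\<^bsub>free_module R (T (Suc n))\<^esub> h (d (Suc n) x)"
        using abelian_group.minus_eq_iff[OF G module_hom_closed[OF \<phi> x] module_hom_closed[OF h d[OF x]]
            module_hom_closed[OF g x]]
        by (simp add: cf[OF x])
    qed
    have "?P (Suc n) f"
    proof (intro conjI f ballI impI)
      fix x assume x: "x \<in> carrier (free_module R (S (Suc n)))"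
        and z: "d (Suc n) x = \<zero>\<^bsub>free_module R (S (Suc n - 1))\<^esub>"
      have "h (d (Suc n) x) = \<zero>\<^bsub>free_module R (T (Suc n))\<^esub>" using z module_hom_zero[OF F F h] by simp
      moreover have "c (Suc (Suc n)) (f x) \<oplus>\<^bsub>free_module R (T (Suc n))\<^esub> \<zero>\<^bsub>free_module R (T (Suc n))\<^esub>
          = c (Suc (Suc n)) (f x)"
        by (rule module_r_zero[OF F], rule module_hom_closed[OF resolvesD(2)[OF rB] module_hom_closed[OF f x]])
      ultimately show "c (Suc (Suc n)) (f x) = \<phi> (Suc n) x"
        using bspec[OF Q x] by simp
    qed
    then have "?P (Suc n) f \<and> ?Q n h f" using Q by (rule conjI)
    then show "\<exists>f. ?P (Suc n) f \<and> ?Q n h f" by (rule exI[of _ f])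
  qed
  then obtain h where PQ: "\<forall>n. ?P n (h n) \<and> ?Q n (h n) (h (Suc n))" by (rule exE)
  have h: "?P n (h n)" "?Q n (h n) (h (Suc n))" for n using spec[OF PQ, of n] by (rule conjunct1, rule conjunct2)
  have hh: "h n \<in> module_hom R (free_module R (S n)) (free_module R (T (Suc n)))" for n using h(1)[of n] by simp
  \<comment> \<open>\<open>k n\<close> is \<open>h (n - 1)\<close> except in degree 0, where
    truncated subtraction would give \<open>h 0\<close>, a map into degree 1 instead of 0.\<close>
  define k where "k n = (case n of 0 \<Rightarrow> (\<lambda>x. \<zero>\<^bsub>free_module R (T 0)\<^esub>) | Suc m \<Rightarrow> h m)" for n
  show thesis
  proof (rule that[of h k])
    show "h n \<in> module_hom R (free_module R (S n)) (free_module R (T (Suc n)))" for n by (rule hh)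
    show "k n \<in> module_hom R (free_module R (S (n - 1))) (free_module R (T n))" for n
      using hh module_hom_const_zero[OF F] by (cases n) (simp_all add: k_def)
    show "\<phi> n x = c (Suc n) (h n x) \<oplus>\<^bsub>free_module R (T n)\<^esub> k n (d n x)"
      if x: "x \<in> carrier (free_module R (S n))" for n x
    proof (cases n)
      case 0
      have "c (Suc n) (h n x) = \<phi> n x" using h(1)[of n] x 0 resolvesD(3)[OF rA] by simp
      then show ?thesis
        using 0 module_r_zero[OF F module_hom_closed[OF \<phi> x]]
        by (simp add: k_def)
    next
      case (Suc m)
      then show ?thesis using h(2)[of m] x by (simp add: k_def)
    qed
  qed
qed

text \<open>
  Covers independence of the resolution, invariance under isomorphism and the inheritance of
  vanishing by direct summands.
\<close>

lemma resolution_retract: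
  assumes A: "Module.module R A" and B: "Module.module R B"
    and u: "u \<in> module_hom R A B" and w: "w \<in> module_hom R B A"
    and wu: "\<And>a. a \<in> carrier A \<Longrightarrow> w (u a) = a"
    and rA: "resolves R A S d e" and rB: "resolves R B T c q"
  obtains f g h k where
    "\<And>n. f n \<in> module_hom R (free_module R (S n)) (free_module R (T n))"
    "\<And>n. g n \<in> module_hom R (free_module R (T n)) (free_module R (S n))"
    "\<And>n x. x \<in> carrier (free_module R (S n)) \<Longrightarrow> c n (f n x) = f (n - 1) (d n x)"
    "\<And>n x. x \<in> carrier (free_module R (T n)) \<Longrightarrow> d n (g n x) = g (n - 1) (c n x)"
    "\<And>n. h n \<in> module_hom R (free_module R (S n)) (free_module R (S (Suc n)))"
    "\<And>n. k n \<in> module_hom R (free_module R (S (n - 1))) (free_module R (S n))"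
    "\<And>n x. x \<in> carrier (free_module R (S n)) \<Longrightarrow>
      x = (d (Suc n) (h n x) \<oplus>\<^bsub>free_module R (S n)\<^esub> k n (d n x)) \<oplus>\<^bsub>free_module R (S n)\<^esub> g n (f n x)"
proof -
  have R: "cring R" using A by (rule module_ring)
  note F = free_module_module[OF R]
  note G = module_group[OF F]
  obtain f where f: "\<And>n. f n \<in> module_hom R (free_module R (S n)) (free_module R (T n))"
    "\<And>x. x \<in> carrier (free_module R (S 0)) \<Longrightarrow> q (f 0 x) = u (e x)"
    "\<And>n x. x \<in> carrier (free_module R (S n)) \<Longrightarrow> c n (f n x) = f (n - 1) (d n x)"
    using resolution_lift[OF A B u rA rB] by blast
  obtain g where g: "\<And>n. g n \<in> module_hom R (free_module R (T n)) (free_module R (S n))"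
    "\<And>x. x \<in> carrier (free_module R (T 0)) \<Longrightarrow> e (g 0 x) = w (q x)"
    "\<And>n x. x \<in> carrier (free_module R (T n)) \<Longrightarrow> d n (g n x) = g (n - 1) (c n x)"
    using resolution_lift[OF B A w rB rA] by blast
  note gf = module_hom_comp[OF f(1) g(1)]
  \<comment> \<open>The chain map \<open>g f\<close> covers \<open>w u\<close>, which is the
    identity of \<open>A\<close>. Hence the identity minus \<open>g f\<close> covers zero and is
    null-homotopic.\<close>
  let ?\<phi> = "\<lambda>n x. x \<ominus>\<^bsub>free_module R (S n)\<^esub> g n (f n x)"
  have \<phi>: "?\<phi> n \<in> module_hom R (free_module R (S n)) (free_module R (S n))" for n
    by (rule module_hom_minus[OF F module_hom_id gf])
  have e\<phi>: "e (?\<phi> 0 x) = \<zero>\<^bsub>A\<^esub>" if x: "x \<in> carrier (free_module R (S 0))" for x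
    using module_hom_diff[OF F A resolvesD(4)[OF rA] x module_hom_closed[OF gf x]]
      module_hom_closed[OF resolvesD(4)[OF rA] x] module_hom_closed[OF f(1) x]
      abelian_group.minus_eq_zero_iff[OF module_group[OF A]]
    by (simp add: g(2) f(2)[OF x] wu)
  have chain: "d n (?\<phi> n x) = ?\<phi> (n - 1) (d n x)" if x: "x \<in> carrier (free_module R (S n))" for n x
    using module_hom_diff[OF F F resolvesD(1)[OF rA] x module_hom_closed[OF gf x]]
      module_hom_closed[OF f(1) x]
    by (simp add: g(3) f(3)[OF x])
  obtain h k where hk: "\<And>n. h n \<in> module_hom R (free_module R (S n)) (free_module R (S (Suc n)))"
    "\<And>n. k n \<in> module_hom R (free_module R (S (n - 1))) (free_module R (S n))"
    "\<And>n x. x \<in> carrier (free_module R (S n)) \<Longrightarrow>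
      ?\<phi> n x = d (Suc n) (h n x) \<oplus>\<^bsub>free_module R (S n)\<^esub> k n (d n x)"
    using resolution_homotopy[OF A rA rA, of ?\<phi>, OF \<phi> e\<phi> chain] by blast
  have eq: "x = (d (Suc n) (h n x) \<oplus>\<^bsub>free_module R (S n)\<^esub> k n (d n x)) \<oplus>\<^bsub>free_module R (S n)\<^esub> g n (f n x)"
    if x: "x \<in> carrier (free_module R (S n))" for n x
  proof -
    have "?\<phi> n x \<in> carrier (free_module R (S n))" by (rule module_hom_closed[OF \<phi> x])
    then show ?thesis
      using abelian_group.minus_eq_iff[OF G x module_hom_closed[OF gf x], of "?\<phi> n x"] hk(3)[OF x] by simp
  qed
  show thesis by (rule that[OF f(1) g(1) f(3) g(3) hk(1,2) eq])
qed

text \<open>A cocycle \<alpha> is evaluated on the decomposition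
  \<open>x = d h x + k d x + g f x\<close>. The first term contributes nothing and the second
  factors through \<open>d n\<close>. So does the third: \<alpha> composed with \<open>g\<close> is
  a cocycle on the resolution of \<open>B\<close>, hence of the form \<psi> after
  \<open>c n\<close>, and \<open>c n f = f d n\<close>.\<close>

lemma ext_exact_retract:
  assumes A: "Module.module R A" and B: "Module.module R B" and N: "Module.module R N"
    and u: "u \<in> module_hom R A B" and w: "w \<in> module_hom R B A"
    and wu: "\<And>a. a \<in> carrier A \<Longrightarrow> w (u a) = a"
    and rA: "resolves R A S d e" and rB: "resolves R B T c q"
    and ex: "ext_exact R N T c n"
  shows "ext_exact R N S d n"
  unfolding ext_exact_def
proof (intro ballI impI)
  have R: "cring R" using A by (rule module_ring)
  note F = free_module_module[OF R]
  interpret N: Module.module R N by fact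
  obtain f g h k where
    f: "\<And>n. f n \<in> module_hom R (free_module R (S n)) (free_module R (T n))" and
    g: "\<And>n. g n \<in> module_hom R (free_module R (T n)) (free_module R (S n))" and
    cf: "\<And>n x. x \<in> carrier (free_module R (S n)) \<Longrightarrow> c n (f n x) = f (n - 1) (d n x)" and
    dg: "\<And>n x. x \<in> carrier (free_module R (T n)) \<Longrightarrow> d n (g n x) = g (n - 1) (c n x)" and
    h: "\<And>n. h n \<in> module_hom R (free_module R (S n)) (free_module R (S (Suc n)))" and
    k: "\<And>n. k n \<in> module_hom R (free_module R (S (n - 1))) (free_module R (S n))" and
    eq: "\<And>n x. x \<in> carrier (free_module R (S n)) \<Longrightarrow>
      x = (d (Suc n) (h n x) \<oplus>\<^bsub>free_module R (S n)\<^esub> k n (d n x)) \<oplus>\<^bsub>free_module R (S n)\<^esub> g n (f n x)"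
    using resolution_retract[OF A B u w wu rA rB] by blast
  fix \<alpha> assume \<alpha>: "\<alpha> \<in> module_hom R (free_module R (S n)) N"
    and \<alpha>d: "\<forall>x\<in>carrier (free_module R (S (Suc n))). \<alpha> (d (Suc n) x) = \<zero>\<^bsub>N\<^esub>"
  have "\<exists>\<psi>\<in>module_hom R (free_module R (T (n - 1))) N. \<forall>x\<in>carrier (free_module R (T n)). \<alpha> (g n x) = \<psi> (c n x)"
  proof (rule ext_exactD[OF ex module_hom_comp[OF g \<alpha>]])
    fix y assume y: "y \<in> carrier (free_module R (T (Suc n)))"
    show "\<alpha> (g n (c (Suc n) y)) = \<zero>\<^bsub>N\<^esub>"
      using dg[OF y] bspec[OF \<alpha>d module_hom_closed[OF g y]] by simp
  qed
  then obtain \<psi> where \<psi>: "\<psi> \<in> module_hom R (free_module R (T (n - 1))) N"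
    "\<And>x. x \<in> carrier (free_module R (T n)) \<Longrightarrow> \<alpha> (g n x) = \<psi> (c n x)"
    by auto
  let ?\<chi> = "\<lambda>x. \<alpha> (k n x) \<oplus>\<^bsub>N\<^esub> \<psi> (f (n - 1) x)"
  have \<chi>: "?\<chi> \<in> module_hom R (free_module R (S (n - 1))) N"
    by (rule module_hom_plus[OF N module_hom_comp[OF k \<alpha>] module_hom_comp[OF f \<psi>(1)]])
  have "\<alpha> x = ?\<chi> (d n x)" if x: "x \<in> carrier (free_module R (S n))" for x
  proof -
    note dx = module_hom_closed[OF resolvesD(1)[OF rA] x]
    note c1 = module_hom_closed[OF resolvesD(2)[OF rA] module_hom_closed[OF h x]]
    note c2 = module_hom_closed[OF k dx]
    note c3 = module_hom_closed[OF g module_hom_closed[OF f x]]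
    have "\<alpha> x = \<alpha> ((d (Suc n) (h n x) \<oplus>\<^bsub>free_module R (S n)\<^esub> k n (d n x))
        \<oplus>\<^bsub>free_module R (S n)\<^esub> g n (f n x))"
      using eq[OF x] by simp
    also have "\<dots> = (\<alpha> (d (Suc n) (h n x)) \<oplus>\<^bsub>N\<^esub> \<alpha> (k n (d n x))) \<oplus>\<^bsub>N\<^esub> \<alpha> (g n (f n x))"
      using module_hom_add[OF \<alpha> _ c3] module_hom_add[OF \<alpha> c1 c2]
        module_add_closed[OF F c1 c2] by simp
    also have "\<dots> = \<alpha> (k n (d n x)) \<oplus>\<^bsub>N\<^esub> \<psi> (f (n - 1) (d n x))"
      using \<alpha>d module_hom_closed[OF h x] module_hom_closed[OF \<alpha> c2] \<psi>(2)[OF module_hom_closed[OF f x]] cf[OF x]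
      by simp
    finally show ?thesis .
  qed
  then show "\<exists>\<psi>\<in>module_hom R (free_module R (S (n - 1))) N. \<forall>x\<in>carrier (free_module R (S n)). \<alpha> x = \<psi> (d n x)"
    by (intro bexI[OF _ \<chi>] ballI)
qed

text \<open>The decomposition \<open>x = d h x + k d x + g f x\<close> persists after tensoring. For
  a cycle the middle term is zero, and \<open>f x\<close> is a cycle on the side of
  \<open>B\<close>, hence the boundary of some \<open>y\<close>. So \<open>x\<close> is the boundary
  of \<open>h x + g y\<close>. The long chain of equations only moves this through
  \<open>tensor_map\<close>.\<close>

lemma tor_exact_retract:
  assumes A: "Module.module R A" and B: "Module.module R B" and N: "Module.module R N"
    and u: "u \<in> module_hom R A B" and w: "w \<in> module_hom R B A"
    and wu: "\<And>a. a \<in> carrier A \<Longrightarrow> w (u a) = a"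
    and rA: "resolves R A S d e" and rB: "resolves R B T c q"
    and ex: "tor_exact R N T c n"
  shows "tor_exact R N S d n"
  unfolding tor_exact_def
proof (intro ballI impI)
  have R: "cring R" using A by (rule module_ring)
  note F = free_module_module[OF R]
  obtain f g h k where
    f: "\<And>n. f n \<in> module_hom R (free_module R (S n)) (free_module R (T n))" and
    g: "\<And>n. g n \<in> module_hom R (free_module R (T n)) (free_module R (S n))" and
    cf: "\<And>n x. x \<in> carrier (free_module R (S n)) \<Longrightarrow> c n (f n x) = f (n - 1) (d n x)" and
    dg: "\<And>n x. x \<in> carrier (free_module R (T n)) \<Longrightarrow> d n (g n x) = g (n - 1) (c n x)" and
    h: "\<And>n. h n \<in> module_hom R (free_module R (S n)) (free_module R (S (Suc n)))" and
    k: "\<And>n. k n \<in> module_hom R (free_module R (S (n - 1))) (free_module R (S n))" and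
    eq: "\<And>n x. x \<in> carrier (free_module R (S n)) \<Longrightarrow>
      x = (d (Suc n) (h n x) \<oplus>\<^bsub>free_module R (S n)\<^esub> k n (d n x)) \<oplus>\<^bsub>free_module R (S n)\<^esub> g n (f n x)"
    using resolution_retract[OF A B u w wu rA rB] by blast
  let ?t = "\<lambda>X. tensor_map R (free_module R X) N"
  let ?T = "\<lambda>X. tensor_module R (free_module R X) N"
  note comp = tensor_map_comp[OF F F F N]
  note hom = tensor_map_hom[OF F F N]
  note T = tensor_module_module[OF F N]
  note c = resolvesD(1,2)[OF rB] note d = resolvesD(1,2)[OF rA]
  fix x assume x: "x \<in> carrier (?T (S n))" and dx: "?t (S (n - 1)) (d n) x = \<zero>\<^bsub>?T (S (n - 1))\<^esub>"
  let ?m = "n - 1"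
  note fx = module_hom_closed[OF hom[OF f[of n]] x]
  have "?t (T ?m) (c n) (?t (T n) (f n) x) = ?t (T ?m) (\<lambda>x. c n (f n x)) x"
    by (rule comp[OF f[of n] c(1)[of n] x, symmetric])
  also have "\<dots> = ?t (T ?m) (\<lambda>x. f ?m (d n x)) x"
    by (rule tensor_map_cong[OF F F N module_hom_comp[OF f[of n] c(1)[of n]] module_hom_comp[OF d(1)[of n] f[of ?m]] _ x])
      (rule cf)
  also have "\<dots> = ?t (T ?m) (f ?m) (?t (S ?m) (d n) x)"
    by (rule comp[OF d(1)[of n] f[of ?m] x])
  also have "\<dots> = \<zero>\<^bsub>?T (T ?m)\<^esub>"
    unfolding dx by (rule module_hom_zero[OF T T hom[OF f[of ?m]]])
  finally have "\<exists>y\<in>carrier (?T (T (Suc n))). ?t (T n) (f n) x = ?t (T n) (c (Suc n)) y"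
    by (rule tor_exactD[OF ex fx])
  then obtain y where y: "y \<in> carrier (?T (T (Suc n)))" "?t (T n) (f n) x = ?t (T n) (c (Suc n)) y"
    by (rule bexE)
  let ?y = "?t (S (Suc n)) (h n) x \<oplus>\<^bsub>?T (S (Suc n))\<^esub> ?t (S (Suc n)) (g (Suc n)) y"
  note gf = module_hom_comp[OF f[of n] g[of n]] note dh = module_hom_comp[OF h[of n] d(2)[of n]]
  note kd = module_hom_comp[OF d(1)[of n] k[of n]]
  note dhkd = module_hom_plus[OF F dh kd]
  note hx = module_hom_closed[OF hom[OF h[of n]] x] note gy = module_hom_closed[OF hom[OF g[of "Suc n"]] y(1)]
  have "x = ?t (S n) (\<lambda>x. x) x"
    by (rule tensor_map_ident[OF F N x, symmetric])
  also have "\<dots> = ?t (S n) (\<lambda>x. (d (Suc n) (h n x) \<oplus>\<^bsub>free_module R (S n)\<^esub> k n (d n x))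
      \<oplus>\<^bsub>free_module R (S n)\<^esub> g n (f n x)) x"
    by (rule tensor_map_cong[OF F F N module_hom_id module_hom_plus[OF F dhkd gf] _ x]) (rule eq)
  also have "\<dots> = ?t (S n) (\<lambda>x. d (Suc n) (h n x) \<oplus>\<^bsub>free_module R (S n)\<^esub> k n (d n x)) x
      \<oplus>\<^bsub>?T (S n)\<^esub> ?t (S n) (\<lambda>x. g n (f n x)) x"
    by (rule tensor_map_plus[OF F F N dhkd gf x])
  also have "?t (S n) (\<lambda>x. d (Suc n) (h n x) \<oplus>\<^bsub>free_module R (S n)\<^esub> k n (d n x)) x =
      ?t (S n) (\<lambda>x. d (Suc n) (h n x)) x \<oplus>\<^bsub>?T (S n)\<^esub> ?t (S n) (\<lambda>x. k n (d n x)) x"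
    by (rule tensor_map_plus[OF F F N dh kd x])
  also have "?t (S n) (\<lambda>x. k n (d n x)) x = ?t (S n) (k n) (?t (S ?m) (d n) x)"
    by (rule comp[OF d(1)[of n] k[of n] x])
  also have "\<dots> = \<zero>\<^bsub>?T (S n)\<^esub>"
    unfolding dx by (rule module_hom_zero[OF T T hom[OF k[of n]]])
  also have "?t (S n) (\<lambda>x. d (Suc n) (h n x)) x = ?t (S n) (d (Suc n)) (?t (S (Suc n)) (h n) x)"
    by (rule comp[OF h[of n] d(2)[of n] x])
  also have "?t (S n) (d (Suc n)) (?t (S (Suc n)) (h n) x) \<oplus>\<^bsub>?T (S n)\<^esub> \<zero>\<^bsub>?T (S n)\<^esub>
      = ?t (S n) (d (Suc n)) (?t (S (Suc n)) (h n) x)"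
    by (rule module_r_zero[OF T module_hom_closed[OF hom[OF d(2)[of n]] hx]])
  also have "?t (S n) (\<lambda>x. g n (f n x)) x = ?t (S n) (g n) (?t (T n) (f n) x)"
    by (rule comp[OF f[of n] g[of n] x])
  also have "\<dots> = ?t (S n) (\<lambda>x. g n (c (Suc n) x)) y"
    unfolding y(2) by (rule comp[OF c(2)[of n] g[of n] y(1), symmetric])
  also have "\<dots> = ?t (S n) (\<lambda>x. d (Suc n) (g (Suc n) x)) y"
  proof (rule tensor_map_cong[OF F F N module_hom_comp[OF c(2)[of n] g[of n]] module_hom_comp[OF g[of "Suc n"] d(2)[of n]] _ y(1)])
    fix a assume "a \<in> carrier (free_module R (T (Suc n)))"
    then show "g n (c (Suc n) a) = d (Suc n) (g (Suc n) a)" using dg[of a "Suc n"] by simp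
  qed
  also have "\<dots> = ?t (S n) (d (Suc n)) (?t (S (Suc n)) (g (Suc n)) y)"
    by (rule comp[OF g[of "Suc n"] d(2)[of n] y(1)])
  also have "?t (S n) (d (Suc n)) (?t (S (Suc n)) (h n) x) \<oplus>\<^bsub>?T (S n)\<^esub>
      ?t (S n) (d (Suc n)) (?t (S (Suc n)) (g (Suc n)) y) = ?t (S n) (d (Suc n)) ?y"
    by (rule module_hom_add[OF hom[OF d(2)[of n]] hx gy, symmetric])
  finally have "x = ?t (S n) (d (Suc n)) ?y" .
  moreover have "?y \<in> carrier (?T (S (Suc n)))"
    by (rule module_add_closed[OF T hx gy])
  ultimately show "\<exists>y\<in>carrier (?T (S (Suc n))). x = ?t (S n) (d (Suc n)) y"
    by (rule bexI[of _ ?y])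
qed

section \<open>Tor and Ext by free resolutions\<close>

lemma combination_simps:
  "combination R [] = \<zero>\<^bsub>free_module R S\<^esub>"
  "combination R ((r, s) # xs) =
    r \<odot>\<^bsub>free_module R S\<^esub> basis_vector R s \<oplus>\<^bsub>free_module R S\<^esub> combination R xs"
  by (simp_all add: combination_def free_module_ops)

lemma combination_closed:
  assumes "cring R" "set xs \<subseteq> carrier R \<times> S"
  shows "combination R xs \<in> carrier (free_module R S)"
proof -
  interpret F: Module.module R "free_module R S" using assms(1) by (rule free_module_module)
  show ?thesis
    using assms(2)
  proof (induction xs)
    case Nil
    then show ?case by (simp add: combination_simps(1)[of R S])
  next
    case (Cons x xs)
    obtain r s where x: "x = (r, s)" by (rule prod.exhaust)
    then show ?case
      using Cons by (simp add: combination_simps(2)[of R r s xs S] basis_vector_closed[OF assms(1)])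
  qed
qed

text \<open>Every vector is the value of a list. This is why a basis indexed by lists reaches every
  cycle of the standard resolution.\<close>

lemma combination_surj:
  assumes "cring R" "v \<in> carrier (free_module R S)"
  shows "\<exists>xs. set xs \<subseteq> carrier R \<times> S \<and> combination R xs = v"
  using assms
proof (induction rule: free_module_induct)
  case zero
  show ?case by (rule exI[of _ "[]"]) (simp add: combination_simps(1)[of R S])
next
  case (step r s w)
  then obtain xs where "set xs \<subseteq> carrier R \<times> S" "combination R xs = w" by (elim exE conjE)
  then show ?case
    using step(1,2) by (intro exI[of _ "(r, s) # xs"]) (simp add: combination_simps(2)[of R r s xs S])
qed

lemma free_module_mono: "S \<subseteq> T \<Longrightarrow> v \<in> carrier (free_module R S) \<Longrightarrow> v \<in> carrier (free_module R T)"
  by (auto simp: free_module_carrier)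

lemma free_module_empty: "v \<in> carrier (free_module R {}) \<Longrightarrow> v = \<zero>\<^bsub>free_module R S\<^esub>"
  by (auto simp: free_module_carrier free_module_ops)

text \<open>The boundary map takes its sums in the free module on the whole type. If it sends the
  basis \<open>S\<close> into the free module on \<open>T\<close>, then by induction all of its
  values lie there; this gives one function its many codomains.\<close>

lemma resolution_boundary_hom:
  assumes R: "cring R" and S: "\<And>s. s \<in> S \<Longrightarrow> syzygy_boundary R s \<in> carrier (free_module R T)"
  shows "resolution_boundary R \<in> module_hom R (free_module R S) (free_module R T)"
    and "s \<in> S \<Longrightarrow> resolution_boundary R (basis_vector R s) = syzygy_boundary R s"
proof -
  note F = free_module_module[OF R]
  interpret T: Module.module R "free_module R T" by (rule F)
  have U: "syzygy_boundary R s \<in> carrier (free_module R UNIV)" if "s \<in> S" for s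
    by (rule free_module_mono[OF _ S[OF that]]) simp
  have h: "resolution_boundary R \<in> module_hom R (free_module R S) (free_module R UNIV)"
    unfolding resolution_boundary_def by (rule linear_extension_hom[OF F U])
  show b: "resolution_boundary R (basis_vector R s) = syzygy_boundary R s" if "s \<in> S" for s
    unfolding resolution_boundary_def by (rule linear_extension_basis[OF F U that])
  show "resolution_boundary R \<in> module_hom R (free_module R S) (free_module R T)"
  proof (rule module_homI)
    fix x y assume x: "x \<in> carrier (free_module R S)" and y: "y \<in> carrier (free_module R S)"
    show "resolution_boundary R (x \<oplus>\<^bsub>free_module R S\<^esub> y) =
        resolution_boundary R x \<oplus>\<^bsub>free_module R T\<^esub> resolution_boundary R y"
      using module_hom_add[OF h x y] by (simp add: free_module_ops)
  next
    fix r x assume r: "r \<in> carrier R" and x: "x \<in> carrier (free_module R S)"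
    show "resolution_boundary R (r \<odot>\<^bsub>free_module R S\<^esub> x) = r \<odot>\<^bsub>free_module R T\<^esub> resolution_boundary R x"
      using module_hom_smult[OF h r x] by (simp add: free_module_ops)
  next
    fix x assume "x \<in> carrier (free_module R S)"
    with R show "resolution_boundary R x \<in> carrier (free_module R T)"
    proof (induction rule: free_module_induct)
      case zero
      have "resolution_boundary R \<zero>\<^bsub>free_module R S\<^esub> = \<zero>\<^bsub>free_module R T\<^esub>"
        using module_hom_zero[OF F F h] by (simp add: free_module_ops)
      then show ?case using T.zero_closed by simp
    next
      case (step r s w)
      have e: "basis_vector R s \<in> carrier (free_module R S)" by (rule basis_vector_closed[OF R step(2)])
      have re: "r \<odot>\<^bsub>free_module R S\<^esub> basis_vector R s \<in> carrier (free_module R S)"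
        using e step(1) F by (intro module.smult_closed)
      have "resolution_boundary R (r \<odot>\<^bsub>free_module R S\<^esub> basis_vector R s \<oplus>\<^bsub>free_module R S\<^esub> w) =
          r \<odot>\<^bsub>free_module R T\<^esub> syzygy_boundary R s \<oplus>\<^bsub>free_module R T\<^esub> resolution_boundary R w"
        using module_hom_add[OF h re step(3)] module_hom_smult[OF h step(1) e] b[OF step(2)]
        by (simp add: free_module_ops)
      also have "\<dots> \<in> carrier (free_module R T)"
        using step(1,4) S[OF step(2)] by (intro T.a_closed T.smult_closed)
      finally show ?case .
    qed
  qed
qed

text \<open>On the carrier of \<open>F 0\<close> the map \<open>resolution_boundary\<close> is
  already zero, but \<open>resolves\<close> asks for \<open>d 0\<close> to be zero on every
  function, so degree 0 is set separately.\<close>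

definition standard_differential :: "'r ring \<Rightarrow> nat \<Rightarrow> (('r, 'a) syzygy \<Rightarrow> 'r) \<Rightarrow> ('r, 'a) syzygy \<Rightarrow> 'r" where
  "standard_differential R n = (if n = 0 then (\<lambda>x. \<zero>\<^bsub>free_module R UNIV\<^esub>) else resolution_boundary R)"

context
  fixes R :: "'r ring" and A :: "('r, 'a) module"
  assumes A: "Module.module R A"
begin

interpretation A: Module.module R A by (rule A)

abbreviation (input) "FR \<equiv> free_resolution R A"

lemma free_resolution_module: "Module.module R (FR i)"
  unfolding free_resolution_def by (rule free_module_module[OF A.is_cring])

lemma free_resolution_int: "FR (int n) = free_module R (resolution_basis R A n)"
  by (simp add: free_resolution_def)

lemma free_resolution_neg: "i < 0 \<Longrightarrow> x \<in> carrier (FR i) \<Longrightarrow> x = \<zero>\<^bsub>free_module R S\<^esub>"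
  using free_module_empty by (auto simp: free_resolution_def)

lemma syzygy_boundary_Suc:
  "s \<in> resolution_basis R A (Suc n) \<Longrightarrow>
    syzygy_boundary R s \<in> carrier (free_module R (resolution_basis R A n))"
  using combination_closed[OF A.is_cring] by auto

lemma syzygy_boundary_0:
  assumes "s \<in> resolution_basis R A 0"
  shows "syzygy_boundary R s \<in> carrier (free_module R T)"
proof -
  have "syzygy_boundary R s = \<zero>\<^bsub>free_module R T\<^esub>" using assms by (auto simp: free_module_ops)
  then show ?thesis
    using free_module_module[OF A.is_cring, of T]
    by (simp add: module_def abelian_group_def abelian_monoid.zero_closed)
qed

lemma resolution_boundary_Suc:
  "resolution_boundary R \<in> module_hom R (free_module R (resolution_basis R A (Suc n)))
    (free_module R (resolution_basis R A n))"
  "s \<in> resolution_basis R A (Suc n) \<Longrightarrow> resolution_boundary R (basis_vector R s) = syzygy_boundary R s"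
  by (rule resolution_boundary_hom[OF A.is_cring syzygy_boundary_Suc]; assumption)+

lemma resolution_boundary_0:
  "resolution_boundary R \<in> module_hom R (free_module R (resolution_basis R A 0)) (free_module R T)"
  by (rule resolution_boundary_hom(1)[OF A.is_cring syzygy_boundary_0])

lemma free_resolution_boundary:
  "resolution_boundary R \<in> module_hom R (FR i) (FR (i - 1))"
proof -
  show ?thesis
  proof (cases "i < 0")
    case True
    then have F: "free_resolution R A i = free_module R {}" "free_resolution R A (i - 1) = free_module R {}"
      by (simp_all add: free_resolution_def)
    show ?thesis unfolding F by (rule resolution_boundary_hom(1)[OF A.is_cring]) simp
  next
    case False
    define n where "n = nat i"
    have i: "i = int n" using False by (simp add: n_def)
    show ?thesis
    proof (cases n)
      case 0
      then show ?thesis using resolution_boundary_0 i by (simp add: free_resolution_def)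
    next
      case (Suc m)
      then show ?thesis using resolution_boundary_Suc(1)[of m] i by (simp add: free_resolution_def nat_add_distrib)
    qed
  qed
qed

lemma resolution_augmentation:
  "resolution_augmentation R A \<in> module_hom R (free_module R (resolution_basis R A 0)) A"
  "m \<in> carrier A \<Longrightarrow> resolution_augmentation R A (basis_vector R (Gen m)) = m"
proof -
  have c: "(case s of Gen m \<Rightarrow> m | Syz xs \<Rightarrow> \<zero>\<^bsub>A\<^esub>) \<in> carrier A"
    if "s \<in> resolution_basis R A 0" for s :: "('r, 'a) syzygy"
    using that by auto
  show "resolution_augmentation R A \<in> module_hom R (free_module R (resolution_basis R A 0)) A"
    unfolding resolution_augmentation_def by (rule linear_extension_hom[OF A c])
  show "resolution_augmentation R A (basis_vector R (Gen m)) = m" if "m \<in> carrier A"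
    unfolding resolution_augmentation_def
    using linear_extension_basis[OF A, where S = "resolution_basis R A 0" and s = "Gen m"
        and \<phi> = "\<lambda>s. case s of Gen m \<Rightarrow> m | Syz _ \<Rightarrow> \<zero>\<^bsub>A\<^esub>"] c that by simp
qed

lemma resolution_boundary_boundary:
  assumes x: "x \<in> carrier (free_module R (resolution_basis R A (Suc (Suc n))))"
  shows "resolution_boundary R (resolution_boundary R x) = \<zero>\<^bsub>free_module R S\<^esub>"
proof -
  note F = free_module_module[OF A.is_cring]
  have "resolution_boundary R (resolution_boundary R x) = \<zero>\<^bsub>free_module R (resolution_basis R A n)\<^esub>"
  proof (rule free_module_hom_eq[OF F module_hom_comp[OF resolution_boundary_Suc(1) resolution_boundary_Suc(1)]
        module_hom_const_zero[OF F] _ x])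
    fix s assume s: "s \<in> resolution_basis R A (Suc (Suc n))"
    then show "resolution_boundary R (resolution_boundary R (basis_vector R s)) =
        \<zero>\<^bsub>free_module R (resolution_basis R A n)\<^esub>"
      using resolution_boundary_Suc(2)[OF s] by (auto simp: free_module_ops)
  qed
  then show ?thesis by (simp add: free_module_ops)
qed

lemma resolution_augmentation_boundary:
  assumes x: "x \<in> carrier (free_module R (resolution_basis R A (Suc 0)))"
  shows "resolution_augmentation R A (resolution_boundary R x) = \<zero>\<^bsub>A\<^esub>"
proof (rule free_module_hom_eq[OF A module_hom_comp[OF resolution_boundary_Suc(1) resolution_augmentation(1)]
      module_hom_const_zero[OF A] _ x])
  fix s assume s: "s \<in> resolution_basis R A (Suc 0)"
  then show "resolution_augmentation R A (resolution_boundary R (basis_vector R s)) = \<zero>\<^bsub>A\<^esub>"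
    using resolution_boundary_Suc(2)[OF s] by auto
qed

lemma free_resolution_boundary_boundary:
  assumes x: "x \<in> carrier (FR i)"
  shows "resolution_boundary R (resolution_boundary R x) = \<zero>\<^bsub>free_module R S\<^esub>"
proof -
  have 2: "resolution_boundary R (resolution_boundary R x) \<in> carrier (FR (i - 1 - 1))"
    by (rule module_hom_closed[OF free_resolution_boundary module_hom_closed[OF free_resolution_boundary x]])
  \<comment> \<open>For \<open>i < 2\<close> the double boundary lies in \<open>F (i - 2)\<close>,
    which is zero; otherwise the statement is the one for natural degrees.\<close>
  show ?thesis
  proof (cases "i < 2")
    case True
    then show ?thesis using 2 by (intro free_resolution_neg[of "i - 1 - 1"]) auto
  next
    case False
    define n where "n = nat (i - 2)"
    have "i = int (Suc (Suc n))" using False by (simp add: n_def)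
    then show ?thesis using resolution_boundary_boundary[of x n] x free_resolution_int[of "Suc (Suc n)"] by simp
  qed
qed

lemma free_resolution_chain_complex: "chain_complex R FR (\<lambda>_. resolution_boundary R)"
  unfolding chain_complex_def
proof (intro allI conjI ballI)
  show "Module.module R (FR i)" for i by (rule free_resolution_module)
  show "resolution_boundary R \<in> module_hom R (FR i) (FR (i - 1))" for i by (rule free_resolution_boundary)
  show "resolution_boundary R (resolution_boundary R x) = \<zero>\<^bsub>FR (i - 1 - 1)\<^esub>" if "x \<in> carrier (FR i)" for i x
    unfolding free_resolution_def by (rule free_resolution_boundary_boundary[OF that])
qed

lemma standard_resolution:
  "resolves R A (resolution_basis R A) (standard_differential R) (resolution_augmentation R A)"
  unfolding resolves_def
proof (intro conjI allI ballI)
  note F = free_module_module[OF A.is_cring]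
  let ?B = "resolution_basis R A"
  show "standard_differential R n \<in> module_hom R (free_module R (?B n)) (free_module R (?B (n - 1)))" for n
  proof (cases n)
    case 0
    have "(\<lambda>x. \<zero>\<^bsub>free_module R (?B 0)\<^esub>) \<in> module_hom R (free_module R (?B 0)) (free_module R (?B 0))"
      by (rule module_hom_const_zero[OF F])
    then show ?thesis by (simp add: 0 standard_differential_def free_module_ops)
  next
    case (Suc m)
    then show ?thesis using resolution_boundary_Suc(1)[of m] by (simp add: standard_differential_def)
  qed
  show "standard_differential R 0 x = \<zero>\<^bsub>free_module R (?B 0)\<^esub>" for x
    by (simp add: standard_differential_def free_module_ops)
  show "resolution_augmentation R A \<in> module_hom R (free_module R (?B 0)) A"
    by (rule resolution_augmentation(1))
  show "resolution_augmentation R A ` carrier (free_module R (?B 0)) = carrier A"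
  proof (intro equalityI subsetI)
    show "x \<in> carrier A" if "x \<in> resolution_augmentation R A ` carrier (free_module R (?B 0))" for x
      using that module_hom_closed[OF resolution_augmentation(1)] by auto
    show "x \<in> resolution_augmentation R A ` carrier (free_module R (?B 0))" if x: "x \<in> carrier A" for x
      by (rule image_eqI[of x "resolution_augmentation R A" "basis_vector R (Gen x)"])
        (simp_all add: resolution_augmentation(2) basis_vector_closed[OF A.is_cring] x)
  qed
  fix n x assume x: "x \<in> carrier (free_module R (?B n))"
  let ?c = "resolution_cycle R A ?B (standard_differential R) (resolution_augmentation R A) n x"
  have c: "?c \<longleftrightarrow> (if n = 0 then resolution_augmentation R A x = \<zero>\<^bsub>A\<^esub>
      else resolution_boundary R x = (\<lambda>s. \<zero>\<^bsub>R\<^esub>))"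
    by (simp add: resolution_cycle_def standard_differential_def free_module_ops)
  show "?c \<longleftrightarrow> x \<in> standard_differential R (Suc n) ` carrier (free_module R (?B (Suc n)))"
  proof
    assume ?c
    obtain xs where xs: "set xs \<subseteq> carrier R \<times> ?B n" "combination R xs = x"
      using combination_surj[OF A.is_cring x] by (elim exE conjE)
    have s: "Syz xs \<in> ?B (Suc n)" using xs \<open>?c\<close> c by simp
    have "x = standard_differential R (Suc n) (basis_vector R (Syz xs))"
      using resolution_boundary_Suc(2)[OF s] xs by (simp add: standard_differential_def)
    then show "x \<in> standard_differential R (Suc n) ` carrier (free_module R (?B (Suc n)))"
      using basis_vector_closed[OF A.is_cring s] by (rule image_eqI)
  next
    assume "x \<in> standard_differential R (Suc n) ` carrier (free_module R (?B (Suc n)))"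
    then obtain y where y: "y \<in> carrier (free_module R (?B (Suc n)))" "x = resolution_boundary R y"
      by (auto simp: standard_differential_def)
    show ?c
    proof (cases n)
      case 0
      then show ?thesis using c y resolution_augmentation_boundary by simp
    next
      case (Suc m)
      then show ?thesis using c y resolution_boundary_boundary[of y m] by (simp add: free_module_ops)
    qed
  qed
qed

end

section \<open>Homology of a chain complex\<close>

lemma zero_module_subquotient_iff:
  fixes R :: "'r ring" and M :: "('r, 'm) module"
  assumes M: "Module.module R M" and K: "submodule K R M" and H: "submodule H R M" and HK: "H \<subseteq> K"
  shows "zero_module (quotient_module (M\<lparr>carrier := K\<rparr>) H) \<longleftrightarrow> K \<subseteq> H"
proof -
  have MK: "Module.module R (M\<lparr>carrier := K\<rparr>)" by (rule submodule.submodule_is_module[OF K M])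
  have "Module.module R (M\<lparr>carrier := H\<rparr>)" by (rule submodule.submodule_is_module[OF H M])
  then have "submodule H R (M\<lparr>carrier := K\<rparr>)"
    using HK by (intro module.module_incl_imp_submodule[OF MK]) simp_all
  then show ?thesis using zero_module_quotient_iff[OF MK] by simp
qed

lemma chain_complexD:
  assumes "chain_complex R X d"
  shows "Module.module R (X i)" "d i \<in> module_hom R (X i) (X (i - 1))"
    "d (i + 1) \<in> module_hom R (X (i + 1)) (X i)"
    "x \<in> carrier (X i) \<Longrightarrow> d (i - 1) (d i x) = \<zero>\<^bsub>X (i - 1 - 1)\<^esub>"
    "x \<in> carrier (X (i + 1)) \<Longrightarrow> d i (d (i + 1) x) = \<zero>\<^bsub>X (i - 1)\<^esub>"
proof -
  have *: "Module.module R (X i) \<and> d i \<in> module_hom R (X i) (X (i - 1)) \<and>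
      (\<forall>x\<in>carrier (X i). d (i - 1) (d i x) = \<zero>\<^bsub>X (i - 1 - 1)\<^esub>)" for i
    using assms by (simp add: chain_complex_def)
  show "Module.module R (X i)" "d i \<in> module_hom R (X i) (X (i - 1))"
    "x \<in> carrier (X i) \<Longrightarrow> d (i - 1) (d i x) = \<zero>\<^bsub>X (i - 1 - 1)\<^esub>"
    using *[of i] by simp_all
  show "d (i + 1) \<in> module_hom R (X (i + 1)) (X i)"
    "x \<in> carrier (X (i + 1)) \<Longrightarrow> d i (d (i + 1) x) = \<zero>\<^bsub>X (i - 1)\<^esub>"
    using *[of "i + 1"] by simp_all
qed

context
  fixes R :: "'r ring" and X :: "int \<Rightarrow> ('r, 'x) module" and d
  assumes ch: "chain_complex R X d"
begin

abbreviation (input) "cycles i \<equiv> {x \<in> carrier (X i). d i x = \<zero>\<^bsub>X (i - 1)\<^esub>}"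
abbreviation (input) "boundaries i \<equiv> d (i + 1) ` carrier (X (i + 1))"

lemma cycles_submodule: "submodule (cycles i) R (X i)"
  by (rule module_kernel_submodule[OF chain_complexD(1,1,2)[OF ch]])

lemma boundaries_submodule: "submodule (boundaries i) R (X i)"
  by (rule module_image_submodule[OF chain_complexD(1,1,3)[OF ch]])

lemma boundaries_subset_cycles: "boundaries i \<subseteq> cycles i"
  using module_hom_closed[OF chain_complexD(3)[OF ch]] chain_complexD(5)[OF ch] by auto

lemma boundaries_submodule_cycles: "submodule (boundaries i) R ((X i)\<lparr>carrier := cycles i\<rparr>)"
proof (rule module.module_incl_imp_submodule)
  show "Module.module R ((X i)\<lparr>carrier := cycles i\<rparr>)"
    by (rule submodule.submodule_is_module[OF cycles_submodule chain_complexD(1)[OF ch]])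
  show "boundaries i \<subseteq> carrier ((X i)\<lparr>carrier := cycles i\<rparr>)"
    using boundaries_subset_cycles by simp
  show "Module.module R ((X i)\<lparr>carrier := cycles i, carrier := boundaries i\<rparr>)"
    using submodule.submodule_is_module[OF boundaries_submodule chain_complexD(1)[OF ch]] by simp
qed

lemma homology_module: "Module.module R (homology X d i)"
  unfolding homology_def a_kernel_def'
  by (rule module_quotient[OF submodule.submodule_is_module[OF cycles_submodule chain_complexD(1)[OF ch]]
        boundaries_submodule_cycles])

lemma homology_zero_iff:
  "zero_module (homology X d i) \<longleftrightarrow>
    (\<forall>x\<in>carrier (X i). d i x = \<zero>\<^bsub>X (i - 1)\<^esub> \<longrightarrow> x \<in> boundaries i)"
proof -
  have "zero_module (homology X d i) \<longleftrightarrow> cycles i \<subseteq> boundaries i"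
    unfolding homology_def a_kernel_def'
    by (rule zero_module_subquotient_iff[OF chain_complexD(1)[OF ch] cycles_submodule boundaries_submodule
          boundaries_subset_cycles])
  then show ?thesis by auto
qed

end

lemma chain_complex_tensor:
  assumes ch: "chain_complex R P d" and C: "Module.module R C"
  shows "chain_complex R (tensor_complex R P C) (tensor_differential R P d C)"
proof -
  note P = chain_complexD(1)[OF ch] and d = chain_complexD(2)[OF ch] and dd = chain_complexD(4)[OF ch]
  show ?thesis
    unfolding chain_complex_def tensor_complex_def tensor_differential_def
  proof (intro allI conjI ballI)
    fix i
    show "Module.module R (tensor_module R (P i) C)" by (rule tensor_module_module[OF P C])
    show "tensor_map R (P (i - 1)) C (d i) \<in> module_hom R (tensor_module R (P i) C) (tensor_module R (P (i - 1)) C)"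
      by (rule tensor_map_hom[OF P P C d])
    fix x assume x: "x \<in> carrier (tensor_module R (P i) C)"
    have "tensor_map R (P (i - 1 - 1)) C (d (i - 1)) (tensor_map R (P (i - 1)) C (d i) x) =
        tensor_map R (P (i - 1 - 1)) C (\<lambda>a. d (i - 1) (d i a)) x"
      by (rule tensor_map_comp[OF P P P C d d x, symmetric])
    also have "\<dots> = tensor_map R (P (i - 1 - 1)) C (\<lambda>a. \<zero>\<^bsub>P (i - 1 - 1)\<^esub>) x"
      by (rule tensor_map_cong[OF P P C module_hom_comp[OF d d] module_hom_const_zero[OF P] _ x]) (rule dd)
    also have "\<dots> = \<zero>\<^bsub>tensor_module R (P (i - 1 - 1)) C\<^esub>" by (rule tensor_map_zero[OF P P C x])
    finally show "tensor_map R (P (i - 1 - 1)) C (d (i - 1)) (tensor_map R (P (i - 1)) C (d i) x) =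
        \<zero>\<^bsub>tensor_module R (P (i - 1 - 1)) C\<^esub>" .
  qed
qed

section \<open>Modules of homomorphisms\<close>

lemma Hom_module_carrier:
  "f \<in> carrier (Hom_module R M N) \<longleftrightarrow> f \<in> module_hom R M N \<and> f \<in> extensional (carrier M)"
  by (simp add: Hom_module_def)

lemma module_hom_cong:
  assumes "Module.module R M" "f \<in> module_hom R M N" "\<And>x. x \<in> carrier M \<Longrightarrow> g x = f x"
  shows "g \<in> module_hom R M N"
proof -
  interpret M: Module.module R M by fact
  show ?thesis
    using assms(2,3) by (intro module_homI)
      (simp_all add: module_hom_closed module_hom_add[OF assms(2)] module_hom_smult[OF assms(2)])
qed

lemma Hom_module_restrict:
  assumes "Module.module R M" "f \<in> module_hom R M N"
  shows "restrict f (carrier M) \<in> carrier (Hom_module R M N)"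
  using module_hom_cong[OF assms, of "restrict f (carrier M)"] by (simp add: Hom_module_carrier)

lemma Hom_module_module:
  assumes M: "Module.module R M" and N: "Module.module R N"
  shows "Module.module R (Hom_module R M N)"
proof -
  interpret M: Module.module R M by (rule M)
  interpret N: Module.module R N by (rule N)
  have c: "f x \<in> carrier N" if "f \<in> carrier (Hom_module R M N)" "x \<in> carrier M" for f x
    by (rule module_hom_closed[of f R M N]) (use that in \<open>simp_all add: Hom_module_carrier\<close>)
  have add: "f \<oplus>\<^bsub>Hom_module R M N\<^esub> g = (\<lambda>x\<in>carrier M. f x \<oplus>\<^bsub>N\<^esub> g x)" for f g
    by (simp add: Hom_module_def)
  have smult: "r \<odot>\<^bsub>Hom_module R M N\<^esub> f = (\<lambda>x\<in>carrier M. r \<odot>\<^bsub>N\<^esub> f x)" for r f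
    by (simp add: Hom_module_def)
  have zero: "\<zero>\<^bsub>Hom_module R M N\<^esub> = (\<lambda>x\<in>carrier M. \<zero>\<^bsub>N\<^esub>)"
    by (simp add: Hom_module_def)
  have zc: "\<zero>\<^bsub>Hom_module R M N\<^esub> \<in> carrier (Hom_module R M N)"
    unfolding zero by (rule Hom_module_restrict[OF M module_hom_const_zero[OF N]])
  have ac: "f \<oplus>\<^bsub>Hom_module R M N\<^esub> g \<in> carrier (Hom_module R M N)"
    if "f \<in> carrier (Hom_module R M N)" "g \<in> carrier (Hom_module R M N)" for f g
    unfolding add using that
    by (intro Hom_module_restrict[OF M module_hom_plus[OF N]]) (simp_all add: Hom_module_carrier)
  have sc: "r \<odot>\<^bsub>Hom_module R M N\<^esub> f \<in> carrier (Hom_module R M N)"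
    if r: "r \<in> carrier R" and f: "f \<in> carrier (Hom_module R M N)" for r f
    unfolding smult
  proof (rule Hom_module_restrict[OF M module_homI])
    have h: "f \<in> module_hom R M N" using f by (simp add: Hom_module_carrier)
    show "r \<odot>\<^bsub>N\<^esub> f x \<in> carrier N" if "x \<in> carrier M" for x using r c[OF f that] by simp
    show "r \<odot>\<^bsub>N\<^esub> f (x \<oplus>\<^bsub>M\<^esub> y) = r \<odot>\<^bsub>N\<^esub> f x \<oplus>\<^bsub>N\<^esub> r \<odot>\<^bsub>N\<^esub> f y"
      if "x \<in> carrier M" "y \<in> carrier M" for x y
      using that r c[OF f] by (simp add: module_hom_add[OF h] N.smult_r_distr)
    show "r \<odot>\<^bsub>N\<^esub> f (q \<odot>\<^bsub>M\<^esub> x) = q \<odot>\<^bsub>N\<^esub> (r \<odot>\<^bsub>N\<^esub> f x)"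
      if "q \<in> carrier R" "x \<in> carrier M" for q x
      using that r c[OF f] by (simp add: module_hom_smult[OF h] M.m_comm flip: N.smult_assoc1)
  qed
  have eqI: "f = g" if "f \<in> carrier (Hom_module R M N)" "g \<in> carrier (Hom_module R M N)"
    "\<And>x. x \<in> carrier M \<Longrightarrow> f x = g x" for f g
    using that by (auto simp: Hom_module_carrier intro: extensionalityI)
  show ?thesis
  proof (rule moduleI[OF M.is_cring])
    show "abelian_group (Hom_module R M N)"
    proof (rule abelian_groupI)
      fix f assume f: "f \<in> carrier (Hom_module R M N)"
      show "\<zero>\<^bsub>Hom_module R M N\<^esub> \<oplus>\<^bsub>Hom_module R M N\<^esub> f = f"
        by (rule eqI[OF ac[OF zc f] f]) (simp add: add zero c[OF f])
      have m: "\<ominus>\<^bsub>R\<^esub> \<one>\<^bsub>R\<^esub> \<odot>\<^bsub>Hom_module R M N\<^esub> f \<in> carrier (Hom_module R M N)"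
        using f by (intro sc) auto
      have "\<ominus>\<^bsub>R\<^esub> \<one>\<^bsub>R\<^esub> \<odot>\<^bsub>Hom_module R M N\<^esub> f \<oplus>\<^bsub>Hom_module R M N\<^esub> f = \<zero>\<^bsub>Hom_module R M N\<^esub>"
        by (rule eqI[OF ac[OF m f] zc]) (simp add: add smult zero c[OF f] N.smult_l_minus N.l_neg)
      then show "\<exists>g\<in>carrier (Hom_module R M N). g \<oplus>\<^bsub>Hom_module R M N\<^esub> f = \<zero>\<^bsub>Hom_module R M N\<^esub>"
        by (rule bexI[OF _ m])
      fix g assume g: "g \<in> carrier (Hom_module R M N)"
      show "f \<oplus>\<^bsub>Hom_module R M N\<^esub> g = g \<oplus>\<^bsub>Hom_module R M N\<^esub> f"
        by (rule eqI[OF ac[OF f g] ac[OF g f]]) (simp add: add c[OF f] c[OF g] N.a_comm)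
      fix h assume h: "h \<in> carrier (Hom_module R M N)"
      show "f \<oplus>\<^bsub>Hom_module R M N\<^esub> g \<oplus>\<^bsub>Hom_module R M N\<^esub> h =
          f \<oplus>\<^bsub>Hom_module R M N\<^esub> (g \<oplus>\<^bsub>Hom_module R M N\<^esub> h)"
        by (rule eqI[OF ac[OF ac[OF f g] h] ac[OF f ac[OF g h]]])
          (simp add: add c[OF f] c[OF g] c[OF h] N.a_assoc)
    qed (simp_all add: zc ac)
  next
    fix r f assume r: "r \<in> carrier R" and f: "f \<in> carrier (Hom_module R M N)"
    show "r \<odot>\<^bsub>Hom_module R M N\<^esub> f \<in> carrier (Hom_module R M N)" by (rule sc[OF r f])
    fix q assume q: "q \<in> carrier R"
    show "(r \<oplus>\<^bsub>R\<^esub> q) \<odot>\<^bsub>Hom_module R M N\<^esub> f =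
        r \<odot>\<^bsub>Hom_module R M N\<^esub> f \<oplus>\<^bsub>Hom_module R M N\<^esub> q \<odot>\<^bsub>Hom_module R M N\<^esub> f"
      by (rule eqI[OF sc ac[OF sc sc]]) (use r q f in \<open>simp_all add: add smult c N.smult_l_distr\<close>)
    show "(r \<otimes>\<^bsub>R\<^esub> q) \<odot>\<^bsub>Hom_module R M N\<^esub> f = r \<odot>\<^bsub>Hom_module R M N\<^esub> (q \<odot>\<^bsub>Hom_module R M N\<^esub> f)"
      by (rule eqI[OF sc sc[OF _ sc]]) (use r q f in \<open>simp_all add: smult c N.smult_assoc1\<close>)
  next
    fix r f g assume r: "r \<in> carrier R" and f: "f \<in> carrier (Hom_module R M N)"
      and g: "g \<in> carrier (Hom_module R M N)"
    show "r \<odot>\<^bsub>Hom_module R M N\<^esub> (f \<oplus>\<^bsub>Hom_module R M N\<^esub> g) =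
        r \<odot>\<^bsub>Hom_module R M N\<^esub> f \<oplus>\<^bsub>Hom_module R M N\<^esub> r \<odot>\<^bsub>Hom_module R M N\<^esub> g"
      by (rule eqI[OF sc[OF r ac[OF f g]] ac[OF sc[OF r f] sc[OF r g]]])
        (use r in \<open>simp add: add smult c[OF f] c[OF g] N.smult_r_distr\<close>)
  next
    fix f assume f: "f \<in> carrier (Hom_module R M N)"
    show "\<one>\<^bsub>R\<^esub> \<odot>\<^bsub>Hom_module R M N\<^esub> f = f"
      by (rule eqI[OF sc[OF M.one_closed f] f]) (simp add: smult c[OF f])
  qed
qed

section \<open>Vanishing of Tor and Ext as exactness of the standard resolution\<close>

context
  fixes R :: "'r ring" and A :: "('r, 'a) module" and N :: "('r, 'n) module"
  assumes A: "Module.module R A" and N: "Module.module R N"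
begin

interpretation A: Module.module R A by (rule A)
interpretation N: Module.module R N by (rule N)

lemma Tor_zero_iff:
  "zero_module (Tor R A N i) \<longleftrightarrow>
    (\<forall>x\<in>carrier (tensor_module R (free_resolution R A i) N).
       tensor_map R (free_resolution R A (i - 1)) N (resolution_boundary R) x =
         \<zero>\<^bsub>tensor_module R (free_resolution R A (i - 1)) N\<^esub> \<longrightarrow>
       (\<exists>y\<in>carrier (tensor_module R (free_resolution R A (i + 1)) N).
          x = tensor_map R (free_resolution R A i) N (resolution_boundary R) y))"
  using homology_zero_iff[OF chain_complex_tensor[OF free_resolution_chain_complex[OF A] N], of i]
  by (simp add: Tor_def tensor_complex_def tensor_differential_def image_iff)

lemma Tor_neg: "i < 0 \<Longrightarrow> zero_module (Tor R A N i)"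
proof -
  note F = free_resolution_module[OF A]
  assume i: "i < 0"
  have b': "resolution_boundary R \<in> module_hom R (free_resolution R A (i + 1)) (free_resolution R A i)"
    using free_resolution_boundary[OF A, of "i + 1"] by simp
  have c: "carrier (free_resolution R A i) \<subseteq> {\<zero>\<^bsub>free_resolution R A i\<^esub>}"
    using free_resolution_neg[OF A i] by (auto simp: free_resolution_def)
  show ?thesis
    unfolding Tor_zero_iff
  proof (intro ballI impI)
    fix x assume "x \<in> carrier (tensor_module R (free_resolution R A i) N)"
    then have "x = \<zero>\<^bsub>tensor_module R (free_resolution R A i) N\<^esub>" by (rule zero_module_tensor[OF F N c])
    moreover have "tensor_map R (free_resolution R A i) N (resolution_boundary R)
        \<zero>\<^bsub>tensor_module R (free_resolution R A (i + 1)) N\<^esub> = \<zero>\<^bsub>tensor_module R (free_resolution R A i) N\<^esub>"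
      by (rule module_hom_zero[OF tensor_module_module[OF F N] tensor_module_module[OF F N] tensor_map_hom[OF F F N b']])
    moreover have "\<zero>\<^bsub>tensor_module R (free_resolution R A (i + 1)) N\<^esub> \<in>
        carrier (tensor_module R (free_resolution R A (i + 1)) N)"
      using tensor_module_module[OF F N] by (simp add: module_def abelian_group_def abelian_monoid.zero_closed)
    ultimately show "\<exists>y\<in>carrier (tensor_module R (free_resolution R A (i + 1)) N).
        x = tensor_map R (free_resolution R A i) N (resolution_boundary R) y" by auto
  qed
qed

text \<open>The two sides differ only in degree 0: \<open>Tor\<close> uses the map to
  \<open>F (-1) = 0\<close>, \<open>tor_exact\<close> the zero endomorphism of \<open>F 0\<close>.
  After tensoring, every element is a cycle for either of them.\<close>

lemma Tor_standard:
  "zero_module (Tor R A N (int n)) \<longleftrightarrow> tor_exact R N (resolution_basis R A) (standard_differential R) n"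
proof -
  note F = free_resolution_module[OF A]
  have s: "standard_differential R (Suc n) = (resolution_boundary R :: (('r, 'a) syzygy \<Rightarrow> 'r) \<Rightarrow> _)" by (simp add: standard_differential_def)
  have i: "free_resolution R A (int n + 1) = free_module R (resolution_basis R A (Suc n))"
    using free_resolution_int[OF A, of "Suc n"] by (simp add: add.commute)
  show ?thesis
  proof (cases n)
    case 0
    have c: "carrier (free_resolution R A (-1)) \<subseteq> {\<zero>\<^bsub>free_resolution R A (-1)\<^esub>}"
      using free_resolution_neg[OF A, of "-1"] by (auto simp: free_resolution_def)
    have F0: "Module.module R (free_module R (resolution_basis R A 0))" by (rule free_module_module[OF A.is_cring])
    have b: "resolution_boundary R \<in> module_hom R (free_module R (resolution_basis R A 0)) (free_resolution R A (-1))"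
      using free_resolution_boundary[OF A, of 0] free_resolution_int[OF A, of 0] by simp
    have 1: "tensor_map R (free_resolution R A (-1)) N (resolution_boundary R) x =
        \<zero>\<^bsub>tensor_module R (free_resolution R A (-1)) N\<^esub>"
      if x: "x \<in> carrier (tensor_module R (free_module R (resolution_basis R A 0)) N)" for x
      by (rule zero_module_tensor[OF F N c module_hom_closed[OF tensor_map_hom[OF F0 F N b] x]])
    have 2: "tensor_map R (free_module R (resolution_basis R A 0)) N (standard_differential R 0) x =
        \<zero>\<^bsub>tensor_module R (free_module R (resolution_basis R A 0)) N\<^esub>"
      if x: "x \<in> carrier (tensor_module R (free_module R (resolution_basis R A 0)) N)" for x
      using tensor_map_zero[OF F0 F0 N x] by (simp add: standard_differential_def free_module_ops)
    show ?thesis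
      unfolding Tor_zero_iff tor_exact_def i s free_resolution_int[OF A]
      using 0 1 2 by (simp del: resolution_basis.simps)
  next
    case (Suc m)
    have "free_resolution R A (int n - 1) = free_module R (resolution_basis R A m)"
      using Suc free_resolution_int[OF A, of m] by simp
    moreover have "standard_differential R n = (resolution_boundary R :: (('r, 'a) syzygy \<Rightarrow> 'r) \<Rightarrow> _)" using Suc by (simp add: standard_differential_def)
    ultimately show ?thesis
      unfolding Tor_zero_iff tor_exact_def i s free_resolution_int[OF A] using Suc
      by (simp del: resolution_basis.simps)
  qed
qed

text \<open>The elements of \<open>Hom_module\<close> are extensional functions, whereas the
  right-hand side ranges over all homomorphisms. Restriction to the carrier translates between them
  without changing any value that matters.\<close>

lemma Ext_zero_iff:
  "zero_module (Ext R A N i) \<longleftrightarrow>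
    (\<forall>\<phi>\<in>module_hom R (free_resolution R A i) N.
       (\<forall>x\<in>carrier (free_resolution R A (i + 1)). \<phi> (resolution_boundary R x) = \<zero>\<^bsub>N\<^esub>) \<longrightarrow>
       (\<exists>\<psi>\<in>module_hom R (free_resolution R A (i - 1)) N.
          \<forall>x\<in>carrier (free_resolution R A i). \<phi> x = \<psi> (resolution_boundary R x)))"
proof -
  let ?F = "free_resolution R A"
  let ?H = "\<lambda>j. Hom_module R (?F j) N"
  let ?D = "Ext_differential R A"
  note F = free_resolution_module[OF A]
  note H = Hom_module_module[OF F N]
  have b: "resolution_boundary R \<in> module_hom R (?F (j + 1)) (?F j)" for j
    using free_resolution_boundary[OF A, of "j + 1"] by simp
  have zero: "\<zero>\<^bsub>?H j\<^esub> = (\<lambda>x\<in>carrier (?F j). \<zero>\<^bsub>N\<^esub>)" for j by (simp add: Hom_module_def)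
  have D: "?D j \<phi> = (\<lambda>x\<in>carrier (?F (j + 1)). \<phi> (resolution_boundary R x))" for j \<phi>
    by (simp add: Ext_differential_def compose_def)
  have Dh: "?D j \<in> module_hom R (?H j) (?H (j + 1))" for j
  proof (rule module_homI)
    fix \<phi> assume "\<phi> \<in> carrier (?H j)"
    then show "?D j \<phi> \<in> carrier (?H (j + 1))"
      unfolding D by (intro Hom_module_restrict[OF F module_hom_comp[OF b]]) (simp add: Hom_module_carrier)
  qed (use module_hom_closed[OF b] in \<open>auto simp: D Hom_module_def\<close>)
  have Dh': "?D (i - 1) \<in> module_hom R (?H (i - 1)) (?H i)" using Dh[of "i - 1"] by simp
  have DD: "?D i (?D (i - 1) \<phi>) = \<zero>\<^bsub>?H (i + 1)\<^esub>" if \<phi>: "\<phi> \<in> carrier (?H (i - 1))" for \<phi>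
  proof -
    have "\<phi> \<zero>\<^bsub>?F (i - 1)\<^esub> = \<zero>\<^bsub>N\<^esub>" using \<phi> by (intro module_hom_zero[OF F N]) (simp add: Hom_module_carrier)
    moreover have "resolution_boundary R (resolution_boundary R x) = \<zero>\<^bsub>?F (i - 1)\<^esub>"
      if "x \<in> carrier (?F (i + 1))" for x
      unfolding free_resolution_def by (rule free_resolution_boundary_boundary[OF A that])
    ultimately show ?thesis
      unfolding zero D using module_hom_closed[OF b[of i]] by (intro restrict_ext) simp
  qed
  have "zero_module (Ext R A N i) \<longleftrightarrow>
      {\<phi> \<in> carrier (?H i). ?D i \<phi> = \<zero>\<^bsub>?H (i + 1)\<^esub>} \<subseteq> ?D (i - 1) ` carrier (?H (i - 1))"
    unfolding Ext_def Let_def a_kernel_def'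
    using module_hom_closed[OF Dh'] DD
    by (intro zero_module_subquotient_iff[OF H] module_kernel_submodule[OF H H Dh]
        module_image_submodule[OF H H Dh']) auto
  also have "\<dots> \<longleftrightarrow> (\<forall>\<phi>\<in>module_hom R (?F i) N.
       (\<forall>x\<in>carrier (?F (i + 1)). \<phi> (resolution_boundary R x) = \<zero>\<^bsub>N\<^esub>) \<longrightarrow>
       (\<exists>\<psi>\<in>module_hom R (?F (i - 1)) N. \<forall>x\<in>carrier (?F i). \<phi> x = \<psi> (resolution_boundary R x)))"
    (is "?L \<longleftrightarrow> ?R")
  proof
    assume L: ?L
    show ?R
    proof (intro ballI impI)
      fix \<phi> assume \<phi>: "\<phi> \<in> module_hom R (?F i) N"
        and z: "\<forall>x\<in>carrier (?F (i + 1)). \<phi> (resolution_boundary R x) = \<zero>\<^bsub>N\<^esub>"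
      let ?\<phi> = "restrict \<phi> (carrier (?F i))"
      have "?\<phi> \<in> carrier (?H i)" by (rule Hom_module_restrict[OF F \<phi>])
      moreover have "?D i ?\<phi> = \<zero>\<^bsub>?H (i + 1)\<^esub>"
        unfolding zero D using z module_hom_closed[OF b[of i]] by (intro restrict_ext) simp
      ultimately have "?\<phi> \<in> ?D (i - 1) ` carrier (?H (i - 1))" using L by (intro subsetD[OF L]) simp
      then obtain \<psi> where \<psi>: "\<psi> \<in> carrier (?H (i - 1))" "?\<phi> = ?D (i - 1) \<psi>" by (rule imageE)
      show "\<exists>\<psi>\<in>module_hom R (?F (i - 1)) N. \<forall>x\<in>carrier (?F i). \<phi> x = \<psi> (resolution_boundary R x)"
      proof (rule bexI[of _ \<psi>], rule ballI)
        show "\<psi> \<in> module_hom R (?F (i - 1)) N" using \<psi>(1) by (simp add: Hom_module_carrier)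
        fix x assume x: "x \<in> carrier (?F i)"
        show "\<phi> x = \<psi> (resolution_boundary R x)" using fun_cong[OF \<psi>(2), of x] x by (simp add: D)
      qed
    qed
  next
    assume R': ?R
    show ?L
    proof (rule subsetI, elim CollectE conjE)
      fix \<phi> assume \<phi>: "\<phi> \<in> carrier (?H i)" and z: "?D i \<phi> = \<zero>\<^bsub>?H (i + 1)\<^esub>"
      have h: "\<phi> \<in> module_hom R (?F i) N" using \<phi> by (simp add: Hom_module_carrier)
      have "\<forall>x\<in>carrier (?F (i + 1)). \<phi> (resolution_boundary R x) = \<zero>\<^bsub>N\<^esub>"
      proof
        fix x assume "x \<in> carrier (?F (i + 1))"
        then show "\<phi> (resolution_boundary R x) = \<zero>\<^bsub>N\<^esub>" using fun_cong[OF z, of x] by (simp add: D zero)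
      qed
      then obtain \<psi> where \<psi>: "\<psi> \<in> module_hom R (?F (i - 1)) N"
        "\<forall>x\<in>carrier (?F i). \<phi> x = \<psi> (resolution_boundary R x)" using bspec[OF R' h] by auto
      have "\<phi> = ?D (i - 1) (restrict \<psi> (carrier (?F (i - 1))))"
      proof (rule extensionalityI[of _ "carrier (?F i)"])
        show "\<phi> \<in> extensional (carrier (?F i))" using \<phi> by (simp add: Hom_module_carrier)
        show "?D (i - 1) (restrict \<psi> (carrier (?F (i - 1)))) \<in> extensional (carrier (?F i))" by (simp add: D)
        fix x assume x: "x \<in> carrier (?F i)"
        show "\<phi> x = ?D (i - 1) (restrict \<psi> (carrier (?F (i - 1)))) x"
          using x \<psi>(2) module_hom_closed[OF b[of "i - 1"]] by (simp add: D)
      qed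
      then show "\<phi> \<in> ?D (i - 1) ` carrier (?H (i - 1))"
        by (rule image_eqI[of \<phi> "?D (i - 1)"]) (rule Hom_module_restrict[OF F \<psi>(1)])
    qed
  qed
  finally show ?thesis .
qed

lemma Ext_neg: "i < 0 \<Longrightarrow> zero_module (Ext R A N i)"
  unfolding Ext_zero_iff
proof (intro ballI impI)
  note F = free_resolution_module[OF A]
  assume i: "i < 0"
  fix \<phi> assume \<phi>: "\<phi> \<in> module_hom R (free_resolution R A i) N"
  have "\<forall>x\<in>carrier (free_resolution R A i). \<phi> x = \<zero>\<^bsub>N\<^esub>"
  proof
    fix x assume "x \<in> carrier (free_resolution R A i)"
    then have "x = \<zero>\<^bsub>free_resolution R A i\<^esub>"
      using free_resolution_neg[OF A i, of x] by (simp add: free_resolution_def)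
    then show "\<phi> x = \<zero>\<^bsub>N\<^esub>" using module_hom_zero[OF F N \<phi>] by simp
  qed
  then show "\<exists>\<psi>\<in>module_hom R (free_resolution R A (i - 1)) N.
      \<forall>x\<in>carrier (free_resolution R A i). \<phi> x = \<psi> (resolution_boundary R x)"
    by (intro bexI[OF _ module_hom_const_zero[OF N]])
qed

text \<open>In degree 0 a coboundary comes from \<open>F (-1) = 0\<close> on one side and through
  the zero endomorphism of \<open>F 0\<close> on the other; both conditions say that \<phi> is zero
  on the carrier.\<close>

lemma Ext_standard:
  "zero_module (Ext R A N (int n)) \<longleftrightarrow> ext_exact R N (resolution_basis R A) (standard_differential R) n"
proof -
  note F = free_resolution_module[OF A]
  have s: "standard_differential R (Suc n) = (resolution_boundary R :: (('r, 'a) syzygy \<Rightarrow> 'r) \<Rightarrow> _)" by (simp add: standard_differential_def)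
  have i: "free_resolution R A (int n + 1) = free_module R (resolution_basis R A (Suc n))"
    using free_resolution_int[OF A, of "Suc n"] by (simp add: add.commute)
  show ?thesis
  proof (cases n)
    case 0
    let ?F0 = "free_module R (resolution_basis R A 0)"
    have F0: "Module.module R ?F0" by (rule free_module_module[OF A.is_cring])
    have b: "resolution_boundary R \<in> module_hom R ?F0 (free_resolution R A (-1))"
      using free_resolution_boundary[OF A, of 0] free_resolution_int[OF A, of 0] by simp
    have bz: "resolution_boundary R x = \<zero>\<^bsub>free_resolution R A (-1)\<^esub>" if "x \<in> carrier ?F0" for x
      using free_resolution_neg[OF A _ module_hom_closed[OF b that]] by (simp add: free_resolution_def)
    have "(\<exists>\<psi>\<in>module_hom R (free_resolution R A (-1)) N. \<forall>x\<in>carrier ?F0. \<phi> x = \<psi> (resolution_boundary R x)) \<longleftrightarrow>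
        (\<forall>x\<in>carrier ?F0. \<phi> x = \<zero>\<^bsub>N\<^esub>)" (is "?L \<longleftrightarrow> ?R") for \<phi>
    proof
      assume ?L
      then obtain \<psi> where \<psi>: "\<psi> \<in> module_hom R (free_resolution R A (-1)) N"
        "\<forall>x\<in>carrier ?F0. \<phi> x = \<psi> (resolution_boundary R x)" by (rule bexE)
      show ?R using \<psi>(2) bz module_hom_zero[OF F N \<psi>(1)] by simp
    next
      assume ?R
      then show ?L by (intro bexI[OF _ module_hom_const_zero[OF N]])
    qed
    moreover have "(\<exists>\<psi>\<in>module_hom R ?F0 N. \<forall>x\<in>carrier ?F0. \<phi> x = \<psi> (standard_differential R 0 x)) \<longleftrightarrow>
        (\<forall>x\<in>carrier ?F0. \<phi> x = \<zero>\<^bsub>N\<^esub>)" (is "?L \<longleftrightarrow> ?R") for \<phi>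
    proof
      assume ?L
      then obtain \<psi> where \<psi>: "\<psi> \<in> module_hom R ?F0 N"
        "\<forall>x\<in>carrier ?F0. \<phi> x = \<psi> (standard_differential R 0 x)" by (rule bexE)
      have "standard_differential R 0 x = \<zero>\<^bsub>?F0\<^esub>" for x :: "('r, 'a) syzygy \<Rightarrow> 'r"
        by (simp add: standard_differential_def free_module_ops)
      then show ?R using \<psi>(2) module_hom_zero[OF F0 N \<psi>(1)] by simp
    next
      assume ?R
      then show ?L by (intro bexI[OF _ module_hom_const_zero[OF N]])
    qed
    ultimately show ?thesis
      unfolding Ext_zero_iff ext_exact_def i s free_resolution_int[OF A] using 0
      by (simp del: resolution_basis.simps)
  next
    case (Suc m)
    have "free_resolution R A (int n - 1) = free_module R (resolution_basis R A m)"
      using Suc free_resolution_int[OF A, of m] by simp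
    moreover have "standard_differential R n = (resolution_boundary R :: (('r, 'a) syzygy \<Rightarrow> 'r) \<Rightarrow> _)" using Suc by (simp add: standard_differential_def)
    ultimately show ?thesis
      unfolding Ext_zero_iff ext_exact_def i s free_resolution_int[OF A] using Suc
      by (simp del: resolution_basis.simps)
  qed
qed

end

text \<open>The flag selects Tor or Ext, so that the dimension shifting argument is carried out once.\<close>

definition vanishes :: "bool \<Rightarrow> 'r ring \<Rightarrow> ('r, 'a) module \<Rightarrow> ('r, 'n) module \<Rightarrow> int \<Rightarrow> bool" where
  "vanishes b R A N i = (if b then zero_module (Tor R A N i) else zero_module (Ext R A N i))"

definition functor_exact ::
  "bool \<Rightarrow> 'r ring \<Rightarrow> ('r, 'n) module \<Rightarrow> (nat \<Rightarrow> 's set) \<Rightarrow> (nat \<Rightarrow> ('s \<Rightarrow> 'r) \<Rightarrow> 's \<Rightarrow> 'r) \<Rightarrow> nat \<Rightarrow> bool" where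
  "functor_exact b R N S d n = (if b then tor_exact R N S d n else ext_exact R N S d n)"

lemma functor_exact_retract:
  assumes A: "Module.module R A" and B: "Module.module R B" and N: "Module.module R N"
    and u: "u \<in> module_hom R A B" and w: "w \<in> module_hom R B A"
    and wu: "\<And>a. a \<in> carrier A \<Longrightarrow> w (u a) = a"
    and rA: "resolves R A S d e" and rB: "resolves R B T c q"
    and ex: "functor_exact b R N T c n"
  shows "functor_exact b R N S d n"
  using tor_exact_retract[OF A B N u w wu rA rB] ext_exact_retract[OF A B N u w wu rA rB] ex
  by (auto simp: functor_exact_def)

lemma vanishes_neg:
  "Module.module R A \<Longrightarrow> Module.module R N \<Longrightarrow> i < 0 \<Longrightarrow> vanishes b R A N i"
  by (simp add: vanishes_def Tor_neg Ext_neg)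

text \<open>Any two resolutions of \<open>A\<close> are compared by retracting along the identity in
  both directions. From here on vanishing may be tested on a resolution with a basis of any
  type.\<close>

lemma vanishes_iff:
  assumes A: "Module.module R A" and N: "Module.module R N" and rA: "resolves R A S d e"
  shows "vanishes b R A N (int n) \<longleftrightarrow> functor_exact b R N S d n"
proof -
  have "vanishes b R A N (int n) \<longleftrightarrow> functor_exact b R N (resolution_basis R A) (standard_differential R) n"
    by (simp add: vanishes_def functor_exact_def Tor_standard[OF A N] Ext_standard[OF A N])
  moreover note st = standard_resolution[OF A]
  ultimately show ?thesis
    using functor_exact_retract[OF A A N module_hom_id module_hom_id _ st rA]
      functor_exact_retract[OF A A N module_hom_id module_hom_id _ rA st] by blast
qed

lemma vanishes_retract:
  assumes A: "Module.module R A" and B: "Module.module R B" and N: "Module.module R N"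
    and u: "u \<in> module_hom R A B" and w: "w \<in> module_hom R B A"
    and wu: "\<And>a. a \<in> carrier A \<Longrightarrow> w (u a) = a"
    and ex: "vanishes b R B N i"
  shows "vanishes b R A N i"
proof (cases "i < 0")
  case False
  then obtain n where n: "i = int n" by (metis nonneg_int_cases not_less)
  show ?thesis
    using functor_exact_retract[OF A B N u w wu standard_resolution[OF A] standard_resolution[OF B]] ex
    unfolding n vanishes_iff[OF A N standard_resolution[OF A]] vanishes_iff[OF B N standard_resolution[OF B]]
    by blast
qed (rule vanishes_neg[OF A N])

section \<open>Mapping cones\<close>

text \<open>A direct sum given by inclusions, projections and equations. Such data is preserved by
  tensoring with \<open>N\<close>, which a concrete module of pairs would not be.\<close>

locale biproduct =
  fixes R :: "'r ring" and G :: "('r, 'g) module" and F :: "('r, 'f) module" and Q :: "('r, 'q) module"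
    and i1 :: "'g \<Rightarrow> 'q" and i2 :: "'f \<Rightarrow> 'q" and p1 :: "'q \<Rightarrow> 'g" and p2 :: "'q \<Rightarrow> 'f"
  assumes G: "Module.module R G" and F: "Module.module R F" and Q: "Module.module R Q"
    and i1: "i1 \<in> module_hom R G Q" and i2: "i2 \<in> module_hom R F Q"
    and p1: "p1 \<in> module_hom R Q G" and p2: "p2 \<in> module_hom R Q F"
    and p1_i1: "y \<in> carrier G \<Longrightarrow> p1 (i1 y) = y"
    and p2_i1: "y \<in> carrier G \<Longrightarrow> p2 (i1 y) = \<zero>\<^bsub>F\<^esub>"
    and p1_i2: "x \<in> carrier F \<Longrightarrow> p1 (i2 x) = \<zero>\<^bsub>G\<^esub>"
    and p2_i2: "x \<in> carrier F \<Longrightarrow> p2 (i2 x) = x"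
    and sum: "w \<in> carrier Q \<Longrightarrow> i1 (p1 w) \<oplus>\<^bsub>Q\<^esub> i2 (p2 w) = w"
begin

lemma pair:
  assumes y: "y \<in> carrier G" and x: "x \<in> carrier F"
  shows "i1 y \<oplus>\<^bsub>Q\<^esub> i2 x \<in> carrier Q" "p1 (i1 y \<oplus>\<^bsub>Q\<^esub> i2 x) = y" "p2 (i1 y \<oplus>\<^bsub>Q\<^esub> i2 x) = x"
proof -
  interpret G: Module.module R G by (rule G)
  interpret F: Module.module R F by (rule F)
  note c = module_hom_closed[OF i1 y] module_hom_closed[OF i2 x]
  show "i1 y \<oplus>\<^bsub>Q\<^esub> i2 x \<in> carrier Q" by (rule module_add_closed[OF Q c])
  show "p1 (i1 y \<oplus>\<^bsub>Q\<^esub> i2 x) = y"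
    using x y by (simp add: module_hom_add[OF p1 c] p1_i1 p1_i2)
  show "p2 (i1 y \<oplus>\<^bsub>Q\<^esub> i2 x) = x"
    using x y by (simp add: module_hom_add[OF p2 c] p2_i1 p2_i2)
qed

lemma eqI:
  assumes "w \<in> carrier Q" "w' \<in> carrier Q" "p1 w = p1 w'" "p2 w = p2 w'"
  shows "w = w'"
proof -
  have "w = i1 (p1 w) \<oplus>\<^bsub>Q\<^esub> i2 (p2 w)" by (rule sum[OF assms(1), symmetric])
  also have "\<dots> = i1 (p1 w') \<oplus>\<^bsub>Q\<^esub> i2 (p2 w')" by (simp only: assms(3,4))
  also have "\<dots> = w'" by (rule sum[OF assms(2)])
  finally show ?thesis .
qed

end

text \<open>One differential of a mapping cone: in coordinates,
  \<open>D (y, x) = (c y + f x, - d x)\<close>. The modules are arbitrary, so that the same chase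
  applies to free modules and to their tensor products with \<open>N\<close>.\<close>

locale cone_step =
  B1: biproduct R G1 F1 Q1 i1 i2 p1 p2 + B0: biproduct R G0 F0 Q0 j1 j2 q1 q2
  for R :: "'r ring" and G1 :: "('r, 'g1) module" and F1 :: "('r, 'f1) module" and Q1 :: "('r, 'q1) module"
    and i1 i2 p1 p2 and G0 :: "('r, 'g0) module" and F0 :: "('r, 'f0) module" and Q0 :: "('r, 'q0) module"
    and j1 j2 q1 q2 +
  fixes c :: "'g1 \<Rightarrow> 'g0" and f :: "'f1 \<Rightarrow> 'g0" and d :: "'f1 \<Rightarrow> 'f0" and D :: "'q1 \<Rightarrow> 'q0"
  assumes c: "c \<in> module_hom R G1 G0" and f: "f \<in> module_hom R F1 G0"
    and d: "d \<in> module_hom R F1 F0" and D: "D \<in> module_hom R Q1 Q0"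
    and q1_D: "w \<in> carrier Q1 \<Longrightarrow> q1 (D w) = c (p1 w) \<oplus>\<^bsub>G0\<^esub> f (p2 w)"
    and q2_D: "w \<in> carrier Q1 \<Longrightarrow> q2 (D w) = \<ominus>\<^bsub>F0\<^esub> d (p2 w)"
begin

lemma D_eq_zero_iff:
  assumes w: "w \<in> carrier Q1"
  shows "D w = \<zero>\<^bsub>Q0\<^esub> \<longleftrightarrow> c (p1 w) \<oplus>\<^bsub>G0\<^esub> f (p2 w) = \<zero>\<^bsub>G0\<^esub> \<and> d (p2 w) = \<zero>\<^bsub>F0\<^esub>"
proof -
  interpret F0: Module.module R F0 by (rule B0.F)
  interpret Q0: Module.module R Q0 by (rule B0.Q)
  have dc: "d (p2 w) \<in> carrier F0" by (rule module_hom_closed[OF d module_hom_closed[OF B1.p2 w]])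
  have z: "q1 \<zero>\<^bsub>Q0\<^esub> = \<zero>\<^bsub>G0\<^esub>" "q2 \<zero>\<^bsub>Q0\<^esub> = \<zero>\<^bsub>F0\<^esub>"
    by (rule module_hom_zero[OF B0.Q B0.G B0.p1], rule module_hom_zero[OF B0.Q B0.F B0.p2])
  have "D w = \<zero>\<^bsub>Q0\<^esub> \<longleftrightarrow> q1 (D w) = q1 \<zero>\<^bsub>Q0\<^esub> \<and> q2 (D w) = q2 \<zero>\<^bsub>Q0\<^esub>"
    by (intro iffI conjI; (elim conjE)?) (simp, simp, rule B0.eqI[OF module_hom_closed[OF D w] Q0.zero_closed])
  moreover have "\<ominus>\<^bsub>F0\<^esub> d (p2 w) = \<zero>\<^bsub>F0\<^esub> \<longleftrightarrow> d (p2 w) = \<zero>\<^bsub>F0\<^esub>"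
    using F0.minus_minus[OF dc] F0.a_inv_zero by metis
  ultimately show ?thesis by (simp add: z q1_D[OF w] q2_D[OF w])
qed

text \<open>For Ext a cocycle is restricted to the two summands of the cone, so the values of
  \<open>D\<close> on each summand are required; the chase for Tor works with the
  projections.\<close>

lemma D_i1:
  assumes y: "y \<in> carrier G1"
  shows "D (i1 y) = j1 (c y)"
proof (rule B0.eqI)
  interpret G0: Module.module R G0 by (rule B0.G)
  interpret F0: Module.module R F0 by (rule B0.F)
  have cy: "c y \<in> carrier G0" by (rule module_hom_closed[OF c y])
  have iy: "i1 y \<in> carrier Q1" by (rule module_hom_closed[OF B1.i1 y])
  show "D (i1 y) \<in> carrier Q0" by (rule module_hom_closed[OF D iy])
  show "j1 (c y) \<in> carrier Q0" by (rule module_hom_closed[OF B0.i1 cy])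
  show "q1 (D (i1 y)) = q1 (j1 (c y))"
    using cy module_hom_zero[OF B1.F B0.G f] by (simp add: q1_D[OF iy] B1.p1_i1[OF y] B1.p2_i1[OF y] B0.p1_i1)
  show "q2 (D (i1 y)) = q2 (j1 (c y))"
    using cy module_hom_zero[OF B1.F B0.F d] by (simp add: q2_D[OF iy] B1.p2_i1[OF y] B0.p2_i1)
qed

lemma D_i2:
  assumes x: "x \<in> carrier F1"
  shows "D (i2 x) = j1 (f x) \<oplus>\<^bsub>Q0\<^esub> j2 (\<ominus>\<^bsub>F0\<^esub> d x)"
proof -
  interpret G0: Module.module R G0 by (rule B0.G)
  interpret F0: Module.module R F0 by (rule B0.F)
  have fx: "f x \<in> carrier G0" by (rule module_hom_closed[OF f x])
  have dx: "\<ominus>\<^bsub>F0\<^esub> d x \<in> carrier F0" using module_hom_closed[OF d x] by simp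
  have ix: "i2 x \<in> carrier Q1" by (rule module_hom_closed[OF B1.i2 x])
  show ?thesis
  proof (rule B0.eqI[OF module_hom_closed[OF D ix] B0.pair(1)[OF fx dx]])
    show "q1 (D (i2 x)) = q1 (j1 (f x) \<oplus>\<^bsub>Q0\<^esub> j2 (\<ominus>\<^bsub>F0\<^esub> d x))"
      using fx module_hom_zero[OF B1.G B0.G c]
      by (simp add: q1_D[OF ix] B1.p1_i2[OF x] B1.p2_i2[OF x] B0.pair(2)[OF fx dx])
    show "q2 (D (i2 x)) = q2 (j1 (f x) \<oplus>\<^bsub>Q0\<^esub> j2 (\<ominus>\<^bsub>F0\<^esub> d x))"
      by (simp add: q2_D[OF ix] B1.p2_i2[OF x] B0.pair(3)[OF fx dx])
  qed
qed

end

text \<open>Three consecutive degrees of a cone, linked by the chain map square. Exactness and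
  vanishing of double differentials are left to the individual lemmas, since they are available in
  different situations.\<close>

locale two_cone_steps =
  S1: cone_step R G2 F2 Q2 k1 k2 r1 r2 G1 F1 Q1 i1 i2 p1 p2 c' f' d' D' +
  S0: cone_step R G1 F1 Q1 i1 i2 p1 p2 G0 F0 Q0 j1 j2 q1 q2 c f d D
  for R :: "'r ring"
    and G2 :: "('r, 'g2) module" and F2 :: "('r, 'f2) module" and Q2 :: "('r, 'q2) module"
    and k1 k2 r1 r2
    and G1 :: "('r, 'g1) module" and F1 :: "('r, 'f1) module" and Q1 :: "('r, 'q1) module"
    and i1 i2 p1 p2
    and G0 :: "('r, 'g0) module" and F0 :: "('r, 'f0) module" and Q0 :: "('r, 'q0) module"
    and j1 j2 q1 q2 c' f' d' D' c f d D +
  assumes comm: "x \<in> carrier F2 \<Longrightarrow> c (f' x) = f (d' x)"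
begin

text \<open>Let \<open>z = (y, x)\<close> be a cycle. Then \<open>x = d' x'\<close>, and
  \<open>y + f' x'\<close> is killed by \<open>c\<close>, so it equals \<open>c' y'\<close>; hence
  \<open>z = D' (y', - x')\<close>. The equation \<open>c y + f x = 0\<close> among the premises of
  \<open>exF\<close> is there for degree 0, where \<open>x\<close> is a boundary only if its
  augmentation is zero as well, and this has to be deduced from that equation.\<close>

lemma cone_exact:
  assumes exF: "\<And>x y. x \<in> carrier F1 \<Longrightarrow> y \<in> carrier G1 \<Longrightarrow> d x = \<zero>\<^bsub>F0\<^esub> \<Longrightarrow>
      c y \<oplus>\<^bsub>G0\<^esub> f x = \<zero>\<^bsub>G0\<^esub> \<Longrightarrow> \<exists>x'\<in>carrier F2. x = d' x'"
    and exG: "\<And>y. y \<in> carrier G1 \<Longrightarrow> c y = \<zero>\<^bsub>G0\<^esub> \<Longrightarrow> \<exists>y'\<in>carrier G2. y = c' y'"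
    and z: "z \<in> carrier Q1" "D z = \<zero>\<^bsub>Q0\<^esub>"
  shows "\<exists>w\<in>carrier Q2. z = D' w"
proof -
  interpret G1: Module.module R G1 by (rule S1.B0.G)
  interpret F1: Module.module R F1 by (rule S1.B0.F)
  interpret F2: Module.module R F2 by (rule S1.B1.F)
  let ?y = "p1 z" and ?x = "p2 z"
  have y: "?y \<in> carrier G1" by (rule module_hom_closed[OF S1.B0.p1 z(1)])
  have x: "?x \<in> carrier F1" by (rule module_hom_closed[OF S1.B0.p2 z(1)])
  have cyc: "c ?y \<oplus>\<^bsub>G0\<^esub> f ?x = \<zero>\<^bsub>G0\<^esub>" "d ?x = \<zero>\<^bsub>F0\<^esub>"
    using z S0.D_eq_zero_iff by auto
  obtain x' where x': "x' \<in> carrier F2" "?x = d' x'" using exF[OF x y cyc(2,1)] by (rule bexE)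
  have fx': "f' x' \<in> carrier G1" by (rule module_hom_closed[OF S1.f x'(1)])
  have "c (?y \<oplus>\<^bsub>G1\<^esub> f' x') = \<zero>\<^bsub>G0\<^esub>"
    using cyc(1) by (simp add: module_hom_add[OF S0.c y fx'] comm[OF x'(1)] flip: x'(2))
  then obtain y' where y': "y' \<in> carrier G2" "?y \<oplus>\<^bsub>G1\<^esub> f' x' = c' y'"
    using exG[OF G1.a_closed[OF y fx']] by auto
  have nx': "\<ominus>\<^bsub>F2\<^esub> x' \<in> carrier F2" using x' by simp
  note w = S1.B1.pair[OF y'(1) nx']
  have "z = D' (k1 y' \<oplus>\<^bsub>Q2\<^esub> k2 (\<ominus>\<^bsub>F2\<^esub> x'))"
  proof (rule S1.B0.eqI[OF z(1) module_hom_closed[OF S1.D w(1)]])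
    show "p1 z = p1 (D' (k1 y' \<oplus>\<^bsub>Q2\<^esub> k2 (\<ominus>\<^bsub>F2\<^esub> x')))"
      using y fx' by (simp add: S1.q1_D[OF w(1)] w(2,3) module_hom_neg[OF S1.B1.F S1.B0.G S1.f x'(1)]
          G1.a_assoc G1.r_neg flip: y'(2))
    show "p2 z = p2 (D' (k1 y' \<oplus>\<^bsub>Q2\<^esub> k2 (\<ominus>\<^bsub>F2\<^esub> x')))"
      using x by (simp add: S1.q2_D[OF w(1)] w(2,3) module_hom_neg[OF S1.B1.F S1.B0.F S1.d x'(1)] flip: x'(2))
  qed
  then show ?thesis using w(1) by (rule bexI)
qed

lemma cone_boundary:
  assumes DD: "\<And>z. z \<in> carrier G2 \<Longrightarrow> c (c' z) = \<zero>\<^bsub>G0\<^esub>" "\<And>z. z \<in> carrier F2 \<Longrightarrow> d (d' z) = \<zero>\<^bsub>F0\<^esub>"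
    and w: "w \<in> carrier Q2"
  shows "D (D' w) = \<zero>\<^bsub>Q0\<^esub>"
proof -
  interpret G0: Module.module R G0 by (rule S0.B0.G)
  interpret F0: Module.module R F0 by (rule S0.B0.F)
  have y: "r1 w \<in> carrier G2" by (rule module_hom_closed[OF S1.B1.p1 w])
  have x: "r2 w \<in> carrier F2" by (rule module_hom_closed[OF S1.B1.p2 w])
  have cy: "c' (r1 w) \<in> carrier G1" by (rule module_hom_closed[OF S1.c y])
  have fx: "f' (r2 w) \<in> carrier G1" by (rule module_hom_closed[OF S1.f x])
  have dx: "d' (r2 w) \<in> carrier F1" by (rule module_hom_closed[OF S1.d x])
  have fdx: "f (d' (r2 w)) \<in> carrier G0" by (rule module_hom_closed[OF S0.f dx])
  have "c (p1 (D' w)) \<oplus>\<^bsub>G0\<^esub> f (p2 (D' w)) = \<zero>\<^bsub>G0\<^esub>"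
    using fdx by (simp add: S1.q1_D[OF w] S1.q2_D[OF w] module_hom_add[OF S0.c cy fx]
        module_hom_neg[OF S1.B0.F S0.B0.G S0.f dx] comm[OF x] DD(1)[OF y] G0.r_neg)
  moreover have "d (p2 (D' w)) = \<zero>\<^bsub>F0\<^esub>"
    by (simp add: S1.q2_D[OF w] module_hom_neg[OF S1.B0.F S0.B0.F S0.d dx] DD(2)[OF x])
  ultimately show ?thesis using S0.D_eq_zero_iff[OF module_hom_closed[OF S1.D w]] by simp
qed

text \<open>If \<open>d x = 0\<close> and \<open>f x = c y\<close>, then \<open>(y, - x)\<close> is
  a cycle of the cone. It is a boundary, and the second component of an element that it bounds
  exhibits \<open>x\<close> as a boundary. This takes the place of a connecting
  homomorphism.\<close>

lemma source_exact:
  assumes exQ: "\<And>z. z \<in> carrier Q1 \<Longrightarrow> D z = \<zero>\<^bsub>Q0\<^esub> \<Longrightarrow> \<exists>w\<in>carrier Q2. z = D' w"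
    and x: "x \<in> carrier F1" "d x = \<zero>\<^bsub>F0\<^esub>" and y: "y \<in> carrier G1" "f x = c y"
  shows "\<exists>x'\<in>carrier F2. x = d' x'"
proof -
  interpret G0: Module.module R G0 by (rule S0.B0.G)
  interpret F0: Module.module R F0 by (rule S0.B0.F)
  interpret F1: Module.module R F1 by (rule S1.B0.F)
  have nx: "\<ominus>\<^bsub>F1\<^esub> x \<in> carrier F1" using x by simp
  have cy: "c y \<in> carrier G0" by (rule module_hom_closed[OF S0.c y(1)])
  note z = S1.B0.pair[OF y(1) nx]
  have "D (i1 y \<oplus>\<^bsub>Q1\<^esub> i2 (\<ominus>\<^bsub>F1\<^esub> x)) = \<zero>\<^bsub>Q0\<^esub>"
    using cy by (simp add: S0.D_eq_zero_iff[OF z(1)] z(2,3) module_hom_neg[OF S1.B0.F S0.B0.G S0.f x(1)]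
        module_hom_neg[OF S1.B0.F S0.B0.F S0.d x(1)] x(2) y(2) G0.r_neg)
  then obtain w where w: "w \<in> carrier Q2" "i1 y \<oplus>\<^bsub>Q1\<^esub> i2 (\<ominus>\<^bsub>F1\<^esub> x) = D' w"
    using exQ[OF z(1)] by auto
  have r: "r2 w \<in> carrier F2" by (rule module_hom_closed[OF S1.B1.p2 w(1)])
  have "\<ominus>\<^bsub>F1\<^esub> x = \<ominus>\<^bsub>F1\<^esub> d' (r2 w)" using z(3) S1.q2_D[OF w(1)] w(2) by simp
  then have "x = d' (r2 w)" using F1.minus_minus x(1) module_hom_closed[OF S1.d r] by metis
  then show ?thesis using r by (rule bexI)
qed

end

section \<open>Cones after tensoring\<close>

lemma biproduct_tensor:
  assumes "biproduct R G F Q i1 i2 p1 p2" and N: "Module.module R N"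
  shows "biproduct R (tensor_module R G N) (tensor_module R F N) (tensor_module R Q N)
    (tensor_map R Q N i1) (tensor_map R Q N i2) (tensor_map R G N p1) (tensor_map R F N p2)"
proof -
  interpret biproduct R G F Q i1 i2 p1 p2 by fact
  show ?thesis
  proof (rule biproduct.intro)
    show "Module.module R (tensor_module R G N)" by (rule tensor_module_module[OF G N])
    show "Module.module R (tensor_module R F N)" by (rule tensor_module_module[OF F N])
    show "Module.module R (tensor_module R Q N)" by (rule tensor_module_module[OF Q N])
    show "tensor_map R Q N i1 \<in> module_hom R (tensor_module R G N) (tensor_module R Q N)"
      by (rule tensor_map_hom[OF G Q N i1])
    show "tensor_map R Q N i2 \<in> module_hom R (tensor_module R F N) (tensor_module R Q N)"
      by (rule tensor_map_hom[OF F Q N i2])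
    show "tensor_map R G N p1 \<in> module_hom R (tensor_module R Q N) (tensor_module R G N)"
      by (rule tensor_map_hom[OF Q G N p1])
    show "tensor_map R F N p2 \<in> module_hom R (tensor_module R Q N) (tensor_module R F N)"
      by (rule tensor_map_hom[OF Q F N p2])
  next
    fix y assume y: "y \<in> carrier (tensor_module R G N)"
    have "tensor_map R G N p1 (tensor_map R Q N i1 y) = tensor_map R G N (\<lambda>a. a) y"
      unfolding tensor_map_comp[OF G Q G N i1 p1 y, symmetric]
      by (rule tensor_map_cong[OF G G N module_hom_comp[OF i1 p1] module_hom_id _ y]) (rule p1_i1)
    then show "tensor_map R G N p1 (tensor_map R Q N i1 y) = y" by (simp add: tensor_map_ident[OF G N y])
    have "tensor_map R F N p2 (tensor_map R Q N i1 y) = tensor_map R F N (\<lambda>a. \<zero>\<^bsub>F\<^esub>) y"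
      unfolding tensor_map_comp[OF G Q F N i1 p2 y, symmetric]
      by (rule tensor_map_cong[OF G F N module_hom_comp[OF i1 p2] module_hom_const_zero[OF F] _ y]) (rule p2_i1)
    then show "tensor_map R F N p2 (tensor_map R Q N i1 y) = \<zero>\<^bsub>tensor_module R F N\<^esub>"
      by (simp add: tensor_map_zero[OF G F N y])
  next
    fix x assume x: "x \<in> carrier (tensor_module R F N)"
    have "tensor_map R F N p2 (tensor_map R Q N i2 x) = tensor_map R F N (\<lambda>a. a) x"
      unfolding tensor_map_comp[OF F Q F N i2 p2 x, symmetric]
      by (rule tensor_map_cong[OF F F N module_hom_comp[OF i2 p2] module_hom_id _ x]) (rule p2_i2)
    then show "tensor_map R F N p2 (tensor_map R Q N i2 x) = x" by (simp add: tensor_map_ident[OF F N x])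
    have "tensor_map R G N p1 (tensor_map R Q N i2 x) = tensor_map R G N (\<lambda>a. \<zero>\<^bsub>G\<^esub>) x"
      unfolding tensor_map_comp[OF F Q G N i2 p1 x, symmetric]
      by (rule tensor_map_cong[OF F G N module_hom_comp[OF i2 p1] module_hom_const_zero[OF G] _ x]) (rule p1_i2)
    then show "tensor_map R G N p1 (tensor_map R Q N i2 x) = \<zero>\<^bsub>tensor_module R G N\<^esub>"
      by (simp add: tensor_map_zero[OF F G N x])
  next
    fix w assume w: "w \<in> carrier (tensor_module R Q N)"
    note h1 = module_hom_comp[OF p1 i1] and h2 = module_hom_comp[OF p2 i2]
    have "tensor_map R Q N i1 (tensor_map R G N p1 w) \<oplus>\<^bsub>tensor_module R Q N\<^esub>
        tensor_map R Q N i2 (tensor_map R F N p2 w) =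
        tensor_map R Q N (\<lambda>a. i1 (p1 a) \<oplus>\<^bsub>Q\<^esub> i2 (p2 a)) w"
      unfolding tensor_map_comp[OF Q G Q N p1 i1 w, symmetric] tensor_map_comp[OF Q F Q N p2 i2 w, symmetric]
      by (rule tensor_map_plus[OF Q Q N h1 h2 w, symmetric])
    also have "\<dots> = tensor_map R Q N (\<lambda>a. a) w"
      by (rule tensor_map_cong[OF Q Q N module_hom_plus[OF Q h1 h2] module_hom_id _ w]) (rule sum)
    also have "\<dots> = w" by (rule tensor_map_ident[OF Q N w])
    finally show "tensor_map R Q N i1 (tensor_map R G N p1 w) \<oplus>\<^bsub>tensor_module R Q N\<^esub>
        tensor_map R Q N i2 (tensor_map R F N p2 w) = w" .
  qed
qed

lemma tensor_map_uminus:
  assumes A: "Module.module R A" and A': "Module.module R A'" and B: "Module.module R B"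
    and f: "f \<in> module_hom R A A'" and x: "x \<in> carrier (tensor_module R A B)"
  shows "tensor_map R A' B (\<lambda>a. \<ominus>\<^bsub>A'\<^esub> f a) x = \<ominus>\<^bsub>tensor_module R A' B\<^esub> tensor_map R A' B f x"
proof -
  note n = module_hom_uminus[OF A' f]
  interpret A': Module.module R A' by (rule A')
  interpret T: Module.module R "tensor_module R A' B" by (rule tensor_module_module[OF A' B])
  have "tensor_map R A' B (\<lambda>a. \<ominus>\<^bsub>A'\<^esub> f a) x \<oplus>\<^bsub>tensor_module R A' B\<^esub> tensor_map R A' B f x =
      tensor_map R A' B (\<lambda>a. \<ominus>\<^bsub>A'\<^esub> f a \<oplus>\<^bsub>A'\<^esub> f a) x"
    by (rule tensor_map_plus[OF A A' B n f x, symmetric])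
  also have "\<dots> = tensor_map R A' B (\<lambda>a. \<zero>\<^bsub>A'\<^esub>) x"
    by (rule tensor_map_cong[OF A A' B module_hom_plus[OF A' n f] module_hom_const_zero[OF A'] _ x])
      (simp add: A'.l_neg module_hom_closed[OF f])
  also have "\<dots> = \<zero>\<^bsub>tensor_module R A' B\<^esub>" by (rule tensor_map_zero[OF A A' B x])
  finally show ?thesis
    using T.minus_equality module_hom_closed[OF tensor_map_hom[OF A A' B n] x]
      module_hom_closed[OF tensor_map_hom[OF A A' B f] x] by simp
qed

lemma cone_step_tensor:
  assumes "cone_step R G1 F1 Q1 i1 i2 p1 p2 G0 F0 Q0 j1 j2 q1 q2 c f d D" and N: "Module.module R N"
  shows "cone_step R (tensor_module R G1 N) (tensor_module R F1 N) (tensor_module R Q1 N)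
    (tensor_map R Q1 N i1) (tensor_map R Q1 N i2) (tensor_map R G1 N p1) (tensor_map R F1 N p2)
    (tensor_module R G0 N) (tensor_module R F0 N) (tensor_module R Q0 N)
    (tensor_map R Q0 N j1) (tensor_map R Q0 N j2) (tensor_map R G0 N q1) (tensor_map R F0 N q2)
    (tensor_map R G0 N c) (tensor_map R G0 N f) (tensor_map R F0 N d) (tensor_map R Q0 N D)"
proof -
  interpret cone_step R G1 F1 Q1 i1 i2 p1 p2 G0 F0 Q0 j1 j2 q1 q2 c f d D by fact
  show ?thesis
  proof (intro cone_step.intro cone_step_axioms.intro)
    show "biproduct R (tensor_module R G1 N) (tensor_module R F1 N) (tensor_module R Q1 N)
        (tensor_map R Q1 N i1) (tensor_map R Q1 N i2) (tensor_map R G1 N p1) (tensor_map R F1 N p2)"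
      by (rule biproduct_tensor[OF B1.biproduct_axioms N])
    show "biproduct R (tensor_module R G0 N) (tensor_module R F0 N) (tensor_module R Q0 N)
        (tensor_map R Q0 N j1) (tensor_map R Q0 N j2) (tensor_map R G0 N q1) (tensor_map R F0 N q2)"
      by (rule biproduct_tensor[OF B0.biproduct_axioms N])
    show "tensor_map R G0 N c \<in> module_hom R (tensor_module R G1 N) (tensor_module R G0 N)"
      by (rule tensor_map_hom[OF B1.G B0.G N c])
    show "tensor_map R G0 N f \<in> module_hom R (tensor_module R F1 N) (tensor_module R G0 N)"
      by (rule tensor_map_hom[OF B1.F B0.G N f])
    show "tensor_map R F0 N d \<in> module_hom R (tensor_module R F1 N) (tensor_module R F0 N)"
      by (rule tensor_map_hom[OF B1.F B0.F N d])
    show "tensor_map R Q0 N D \<in> module_hom R (tensor_module R Q1 N) (tensor_module R Q0 N)"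
      by (rule tensor_map_hom[OF B1.Q B0.Q N D])
    fix w assume w: "w \<in> carrier (tensor_module R Q1 N)"
    note cp = module_hom_comp[OF B1.p1 c] and fp = module_hom_comp[OF B1.p2 f] and dp = module_hom_comp[OF B1.p2 d]
    have "tensor_map R G0 N q1 (tensor_map R Q0 N D w) = tensor_map R G0 N (\<lambda>a. q1 (D a)) w"
      by (rule tensor_map_comp[OF B1.Q B0.Q B0.G N D B0.p1 w, symmetric])
    also have "\<dots> = tensor_map R G0 N (\<lambda>a. c (p1 a) \<oplus>\<^bsub>G0\<^esub> f (p2 a)) w"
      by (rule tensor_map_cong[OF B1.Q B0.G N module_hom_comp[OF D B0.p1] module_hom_plus[OF B0.G cp fp] _ w]) (rule q1_D)
    also have "\<dots> = tensor_map R G0 N (\<lambda>a. c (p1 a)) w \<oplus>\<^bsub>tensor_module R G0 N\<^esub> tensor_map R G0 N (\<lambda>a. f (p2 a)) w"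
      by (rule tensor_map_plus[OF B1.Q B0.G N cp fp w])
    also have "tensor_map R G0 N (\<lambda>a. c (p1 a)) w = tensor_map R G0 N c (tensor_map R G1 N p1 w)"
      by (rule tensor_map_comp[OF B1.Q B1.G B0.G N B1.p1 c w])
    also have "tensor_map R G0 N (\<lambda>a. f (p2 a)) w = tensor_map R G0 N f (tensor_map R F1 N p2 w)"
      by (rule tensor_map_comp[OF B1.Q B1.F B0.G N B1.p2 f w])
    finally show "tensor_map R G0 N q1 (tensor_map R Q0 N D w) =
        tensor_map R G0 N c (tensor_map R G1 N p1 w) \<oplus>\<^bsub>tensor_module R G0 N\<^esub>
        tensor_map R G0 N f (tensor_map R F1 N p2 w)" .
    have "tensor_map R F0 N q2 (tensor_map R Q0 N D w) = tensor_map R F0 N (\<lambda>a. q2 (D a)) w"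
      by (rule tensor_map_comp[OF B1.Q B0.Q B0.F N D B0.p2 w, symmetric])
    also have "\<dots> = tensor_map R F0 N (\<lambda>a. \<ominus>\<^bsub>F0\<^esub> d (p2 a)) w"
      by (rule tensor_map_cong[OF B1.Q B0.F N module_hom_comp[OF D B0.p2] module_hom_uminus[OF B0.F dp] _ w]) (rule q2_D)
    also have "\<dots> = \<ominus>\<^bsub>tensor_module R F0 N\<^esub> tensor_map R F0 N (\<lambda>a. d (p2 a)) w"
      by (rule tensor_map_uminus[OF B1.Q B0.F N dp w])
    also have "tensor_map R F0 N (\<lambda>a. d (p2 a)) w = tensor_map R F0 N d (tensor_map R F1 N p2 w)"
      by (rule tensor_map_comp[OF B1.Q B1.F B0.F N B1.p2 d w])
    finally show "tensor_map R F0 N q2 (tensor_map R Q0 N D w) =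
        \<ominus>\<^bsub>tensor_module R F0 N\<^esub> tensor_map R F0 N d (tensor_map R F1 N p2 w)" .
  qed
qed

text \<open>Everything in the locale that links the maps is an equation between composites and sums
  of homomorphisms, and \<open>tensor_map\<close> is additive and functorial. The chases for cones
  therefore apply verbatim to tensored cones.\<close>

lemma two_cone_steps_tensor:
  assumes "two_cone_steps R G2 F2 Q2 k1 k2 r1 r2 G1 F1 Q1 i1 i2 p1 p2 G0 F0 Q0 j1 j2 q1 q2 c' f' d' D' c f d D"
    and N: "Module.module R N"
  shows "two_cone_steps R (tensor_module R G2 N) (tensor_module R F2 N) (tensor_module R Q2 N)
    (tensor_map R Q2 N k1) (tensor_map R Q2 N k2) (tensor_map R G2 N r1) (tensor_map R F2 N r2)
    (tensor_module R G1 N) (tensor_module R F1 N) (tensor_module R Q1 N)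
    (tensor_map R Q1 N i1) (tensor_map R Q1 N i2) (tensor_map R G1 N p1) (tensor_map R F1 N p2)
    (tensor_module R G0 N) (tensor_module R F0 N) (tensor_module R Q0 N)
    (tensor_map R Q0 N j1) (tensor_map R Q0 N j2) (tensor_map R G0 N q1) (tensor_map R F0 N q2)
    (tensor_map R G1 N c') (tensor_map R G1 N f') (tensor_map R F1 N d') (tensor_map R Q1 N D')
    (tensor_map R G0 N c) (tensor_map R G0 N f) (tensor_map R F0 N d) (tensor_map R Q0 N D)"
proof -
  interpret two_cone_steps R G2 F2 Q2 k1 k2 r1 r2 G1 F1 Q1 i1 i2 p1 p2 G0 F0 Q0 j1 j2 q1 q2 c' f' d' D' c f d D
    by fact
  show ?thesis
  proof (intro two_cone_steps.intro two_cone_steps_axioms.intro)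
    show "cone_step R (tensor_module R G2 N) (tensor_module R F2 N) (tensor_module R Q2 N)
      (tensor_map R Q2 N k1) (tensor_map R Q2 N k2) (tensor_map R G2 N r1) (tensor_map R F2 N r2)
      (tensor_module R G1 N) (tensor_module R F1 N) (tensor_module R Q1 N)
      (tensor_map R Q1 N i1) (tensor_map R Q1 N i2) (tensor_map R G1 N p1) (tensor_map R F1 N p2)
      (tensor_map R G1 N c') (tensor_map R G1 N f') (tensor_map R F1 N d') (tensor_map R Q1 N D')"
      by (rule cone_step_tensor[OF S1.cone_step_axioms N])
    show "cone_step R (tensor_module R G1 N) (tensor_module R F1 N) (tensor_module R Q1 N)
      (tensor_map R Q1 N i1) (tensor_map R Q1 N i2) (tensor_map R G1 N p1) (tensor_map R F1 N p2)
      (tensor_module R G0 N) (tensor_module R F0 N) (tensor_module R Q0 N)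
      (tensor_map R Q0 N j1) (tensor_map R Q0 N j2) (tensor_map R G0 N q1) (tensor_map R F0 N q2)
      (tensor_map R G0 N c) (tensor_map R G0 N f) (tensor_map R F0 N d) (tensor_map R Q0 N D)"
      by (rule cone_step_tensor[OF S0.cone_step_axioms N])
    fix x assume x: "x \<in> carrier (tensor_module R F2 N)"
    show "tensor_map R G0 N c (tensor_map R G1 N f' x) = tensor_map R G0 N f (tensor_map R F1 N d' x)"
      unfolding tensor_map_comp[OF S1.B1.F S1.B0.G S0.B0.G N S1.f S0.c x, symmetric]
        tensor_map_comp[OF S1.B1.F S1.B0.F S0.B0.G N S1.d S0.f x, symmetric]
      by (rule tensor_map_cong[OF S1.B1.F S0.B0.G N module_hom_comp[OF S1.f S0.c] module_hom_comp[OF S1.d S0.f] _ x])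
        (rule comm)
  qed
qed

section \<open>The cone of a map between free resolutions\<close>

definition free_inl :: "'r ring \<Rightarrow> ('t \<Rightarrow> 'r) \<Rightarrow> 't + 's \<Rightarrow> 'r" where
  "free_inl R v = case_sum v (\<lambda>_. \<zero>\<^bsub>R\<^esub>)"

definition free_inr :: "'r ring \<Rightarrow> ('s \<Rightarrow> 'r) \<Rightarrow> 't + 's \<Rightarrow> 'r" where
  "free_inr R v = case_sum (\<lambda>_. \<zero>\<^bsub>R\<^esub>) v"

definition free_outl :: "('t + 's \<Rightarrow> 'r) \<Rightarrow> 't \<Rightarrow> 'r" where
  "free_outl w = (\<lambda>t. w (Inl t))"

definition free_outr :: "('t + 's \<Rightarrow> 'r) \<Rightarrow> 's \<Rightarrow> 'r" where
  "free_outr w = (\<lambda>s. w (Inr s))"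

lemma free_biproduct:
  fixes T :: "'t set" and S :: "'s set"
  assumes R: "cring R"
  shows "biproduct R (free_module R T) (free_module R S) (free_module R (Inl ` T \<union> Inr ` S))
    (free_inl R) (free_inr R) free_outl free_outr"
proof -
  interpret R: cring R by fact
  let ?Q = "free_module R (Inl ` T \<union> Inr ` S)"
  note F = free_module_module[OF R]
  have inl: "free_inl R v \<in> carrier ?Q" if v: "v \<in> carrier (free_module R T)" for v
  proof -
    have sub: "{x :: 't + 's. free_inl R v x \<noteq> \<zero>\<^bsub>R\<^esub>} \<subseteq> Inl ` {t. v t \<noteq> \<zero>\<^bsub>R\<^esub>}"
    proof
      fix x assume "x \<in> {x :: 't + 's. free_inl R v x \<noteq> \<zero>\<^bsub>R\<^esub>}"
      then show "x \<in> Inl ` {t. v t \<noteq> \<zero>\<^bsub>R\<^esub>}" by (cases x) (auto simp: free_inl_def)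
    qed
    moreover have "finite {x :: 't + 's. free_inl R v x \<noteq> \<zero>\<^bsub>R\<^esub>}"
      using v by (intro finite_subset[OF sub]) (simp add: free_module_carrier)
    moreover have "free_inl R v x \<in> carrier R" for x :: "'t + 's"
      using v by (simp add: free_module_carrier free_inl_def split: sum.splits)
    moreover have "Inl ` {t. v t \<noteq> \<zero>\<^bsub>R\<^esub>} \<subseteq> Inl ` T \<union> Inr ` S" using v by (auto simp: free_module_carrier)
    ultimately show ?thesis using subset_trans[OF sub] by (simp add: free_module_carrier)
  qed
  have inr: "free_inr R v \<in> carrier ?Q" if v: "v \<in> carrier (free_module R S)" for v
  proof -
    have sub: "{x :: 't + 's. free_inr R v x \<noteq> \<zero>\<^bsub>R\<^esub>} \<subseteq> Inr ` {t. v t \<noteq> \<zero>\<^bsub>R\<^esub>}"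
    proof
      fix x assume "x \<in> {x :: 't + 's. free_inr R v x \<noteq> \<zero>\<^bsub>R\<^esub>}"
      then show "x \<in> Inr ` {t. v t \<noteq> \<zero>\<^bsub>R\<^esub>}" by (cases x) (auto simp: free_inr_def)
    qed
    moreover have "finite {x :: 't + 's. free_inr R v x \<noteq> \<zero>\<^bsub>R\<^esub>}"
      using v by (intro finite_subset[OF sub]) (simp add: free_module_carrier)
    moreover have "free_inr R v x \<in> carrier R" for x :: "'t + 's"
      using v by (simp add: free_module_carrier free_inr_def split: sum.splits)
    moreover have "Inr ` {t. v t \<noteq> \<zero>\<^bsub>R\<^esub>} \<subseteq> Inl ` T \<union> Inr ` S" using v by (auto simp: free_module_carrier)
    ultimately show ?thesis using subset_trans[OF sub] by (simp add: free_module_carrier)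
  qed
  have outl: "free_outl w \<in> carrier (free_module R T)" if w: "w \<in> carrier ?Q" for w
  proof -
    have "{t. free_outl w t \<noteq> \<zero>\<^bsub>R\<^esub>} = Inl -` {x. w x \<noteq> \<zero>\<^bsub>R\<^esub>}" by (auto simp: free_outl_def)
    moreover have "finite (Inl -` {x. w x \<noteq> \<zero>\<^bsub>R\<^esub>})"
      using w by (intro finite_vimageI) (simp_all add: free_module_carrier)
    ultimately have "finite {t. free_outl w t \<noteq> \<zero>\<^bsub>R\<^esub>}" by simp
    then show ?thesis using w by (auto simp: free_module_carrier free_outl_def)
  qed
  have outr: "free_outr w \<in> carrier (free_module R S)" if w: "w \<in> carrier ?Q" for w
  proof -
    have "{t. free_outr w t \<noteq> \<zero>\<^bsub>R\<^esub>} = Inr -` {x. w x \<noteq> \<zero>\<^bsub>R\<^esub>}" by (auto simp: free_outr_def)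
    moreover have "finite (Inr -` {x. w x \<noteq> \<zero>\<^bsub>R\<^esub>})"
      using w by (intro finite_vimageI) (simp_all add: free_module_carrier)
    ultimately have "finite {t. free_outr w t \<noteq> \<zero>\<^bsub>R\<^esub>}" by simp
    then show ?thesis using w by (auto simp: free_module_carrier free_outr_def)
  qed
  show ?thesis
  proof (rule biproduct.intro)
    show "free_inl R \<in> module_hom R (free_module R T) ?Q"
      by (rule module_homI[OF inl]) (auto simp: free_inl_def free_module_ops fun_eq_iff split: sum.splits)
    show "free_inr R \<in> module_hom R (free_module R S) ?Q"
      by (rule module_homI[OF inr]) (auto simp: free_inr_def free_module_ops fun_eq_iff split: sum.splits)
    show "free_outl \<in> module_hom R ?Q (free_module R T)"
      by (rule module_homI[OF outl]) (simp_all add: free_outl_def free_module_ops)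
    show "free_outr \<in> module_hom R ?Q (free_module R S)"
      by (rule module_homI[OF outr]) (simp_all add: free_outr_def free_module_ops)
    fix w assume "w \<in> carrier ?Q"
    then show "free_inl R (free_outl w) \<oplus>\<^bsub>?Q\<^esub> free_inr R (free_outr w) = w"
      by (auto simp: free_module_ops free_module_carrier free_inl_def free_inr_def free_outl_def free_outr_def
          fun_eq_iff split: sum.splits)
  qed (simp_all add: F free_inl_def free_inr_def free_outl_def free_outr_def free_module_ops)
qed

text \<open>The shift has nothing in degree 0; the truncated \<open>S (n - 1)\<close> would repeat
  \<open>S 0\<close> there and spoil the cone.\<close>

definition cone_shift :: "(nat \<Rightarrow> 's set) \<Rightarrow> nat \<Rightarrow> 's set" where
  "cone_shift S n = (case n of 0 \<Rightarrow> {} | Suc m \<Rightarrow> S m)"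

definition cone_basis :: "(nat \<Rightarrow> 't set) \<Rightarrow> (nat \<Rightarrow> 's set) \<Rightarrow> nat \<Rightarrow> ('t + 's) set" where
  "cone_basis T S n = Inl ` T n \<union> Inr ` cone_shift S n"

text \<open>In coordinates, \<open>D (y, x) = (c y + f x, - d x)\<close>, with \<open>x\<close> one
  degree below \<open>y\<close>. Sums are formed in the free module on the whole type because
  addition does not depend on the chosen basis, so no basis appears among the arguments.\<close>

definition cone_differential ::
  "'r ring \<Rightarrow> (nat \<Rightarrow> ('t \<Rightarrow> 'r) \<Rightarrow> 't \<Rightarrow> 'r) \<Rightarrow> (nat \<Rightarrow> ('s \<Rightarrow> 'r) \<Rightarrow> 't \<Rightarrow> 'r) \<Rightarrow>
   (nat \<Rightarrow> ('s \<Rightarrow> 'r) \<Rightarrow> 's \<Rightarrow> 'r) \<Rightarrow> nat \<Rightarrow> ('t + 's \<Rightarrow> 'r) \<Rightarrow> 't + 's \<Rightarrow> 'r" where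
  "cone_differential R c f d n w = (case n of 0 \<Rightarrow> \<zero>\<^bsub>free_module R UNIV\<^esub> | Suc m \<Rightarrow>
     free_inl R (c (Suc m) (free_outl w) \<oplus>\<^bsub>free_module R UNIV\<^esub> f m (free_outr w)) \<oplus>\<^bsub>free_module R UNIV\<^esub>
     free_inr R (\<lambda>s. \<ominus>\<^bsub>R\<^esub> d m (free_outr w) s))"

locale resolution_cone =
  fixes R :: "'r ring" and A :: "('r, 'a) module" and B :: "('r, 'b) module" and u :: "'a \<Rightarrow> 'b"
    and S :: "nat \<Rightarrow> 's set" and d e and T :: "nat \<Rightarrow> 't set" and c q and f
  assumes A: "Module.module R A" and B: "Module.module R B" and u: "u \<in> module_hom R A B"
    and rA: "resolves R A S d e" and rB: "resolves R B T c q"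
    and f: "\<And>n. f n \<in> module_hom R (free_module R (S n)) (free_module R (T n))"
    and qf: "\<And>x. x \<in> carrier (free_module R (S 0)) \<Longrightarrow> q (f 0 x) = u (e x)"
    and cf: "\<And>n x. x \<in> carrier (free_module R (S n)) \<Longrightarrow> c n (f n x) = f (n - 1) (d n x)"
begin

lemma R: "cring R"
  using A by (rule module_ring)

lemmas Free = free_module_module[OF R]

abbreviation (input) "Q \<equiv> cone_basis T S"
abbreviation (input) "D \<equiv> cone_differential R c f d"
abbreviation (input) "FS n \<equiv> free_module R (S n)"
abbreviation (input) "FT n \<equiv> free_module R (T n)"
abbreviation (input) "FZ n \<equiv> free_module R (cone_shift S n)"
abbreviation (input) "FQ n \<equiv> free_module R (Q n)"

text \<open>Only degree 0 is at stake, where the target is the zero module instead of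
  \<open>F 0\<close>; the zero map \<open>d 0\<close> fits both.\<close>

lemma shift_differential: "d n \<in> module_hom R (FS n) (FZ n)"
proof (cases n)
  case 0
  have "\<zero>\<^bsub>FS 0\<^esub> = \<zero>\<^bsub>free_module R {}\<^esub>" by (simp add: free_module_ops)
  then show ?thesis
    using module_hom_cong[OF Free module_hom_const_zero[OF Free], where g = "d 0"] resolvesD(3)[OF rA] 0
    by (simp add: cone_shift_def)
next
  case (Suc m)
  then show ?thesis using resolvesD(2)[OF rA, of m] by (simp add: cone_shift_def)
qed

lemma cone_basis_Suc: "Q (Suc n) = Inl ` T (Suc n) \<union> Inr ` S n"
  by (simp add: cone_basis_def cone_shift_def)

lemma biproduct_Suc:
  "biproduct R (FT (Suc n)) (FS n) (FQ (Suc n))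
    (free_inl R) (free_inr R) free_outl free_outr"
  unfolding cone_basis_Suc by (rule free_biproduct[OF R])

lemma biproduct_shift:
  "biproduct R (FT n) (FZ n) (FQ n)
    (free_inl R) (free_inr R) free_outl free_outr"
  unfolding cone_basis_def by (rule free_biproduct[OF R])

lemma cone_step:
  "cone_step R (FT (Suc n)) (FS n) (FQ (Suc n))
    (free_inl R) (free_inr R) free_outl free_outr
    (FT n) (FZ n) (FQ n)
    (free_inl R) (free_inr R) free_outl free_outr (c (Suc n)) (f n) (d n) (D (Suc n))"
proof -
  interpret B1: biproduct R "FT (Suc n)" "FS n" "FQ (Suc n)"
    "free_inl R" "free_inr R" free_outl free_outr by (rule biproduct_Suc)
  interpret B0: biproduct R "FT n" "FZ n" "FQ n"
    "free_inl R" "free_inr R" free_outl free_outr by (rule biproduct_shift)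
  let ?G = "FT n" and ?F = "FZ n"
  let ?g = "\<lambda>w. c (Suc n) (free_outl w) \<oplus>\<^bsub>?G\<^esub> f n (free_outr w)"
  let ?h = "\<lambda>w. \<ominus>\<^bsub>?F\<^esub> d n (free_outr w)"
  have g: "?g \<in> module_hom R (FQ (Suc n)) ?G"
    by (rule module_hom_plus[OF Free module_hom_comp[OF B1.p1 resolvesD(2)[OF rB]] module_hom_comp[OF B1.p2 f]])
  have h: "?h \<in> module_hom R (FQ (Suc n)) ?F"
    by (rule module_hom_uminus[OF Free module_hom_comp[OF B1.p2 shift_differential]])
  have D: "D (Suc n) w = free_inl R (?g w) \<oplus>\<^bsub>FQ n\<^esub> free_inr R (?h w)"
    if w: "w \<in> carrier (FQ (Suc n))" for w
    using free_module_uminus[OF R module_hom_closed[OF shift_differential module_hom_closed[OF B1.p2 w]]]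
    by (simp add: cone_differential_def free_module_ops)
  show ?thesis
  proof (intro cone_step.intro cone_step_axioms.intro)
    show "D (Suc n) \<in> module_hom R (FQ (Suc n)) (FQ n)"
      by (rule module_hom_cong[OF Free module_hom_plus[OF Free module_hom_comp[OF g B0.i1] module_hom_comp[OF h B0.i2]]])
        (rule D)
    fix w assume w: "w \<in> carrier (FQ (Suc n))"
    show "free_outl (D (Suc n) w) = ?g w"
      unfolding D[OF w] by (rule B0.pair(2)[OF module_hom_closed[OF g w] module_hom_closed[OF h w]])
    show "free_outr (D (Suc n) w) = ?h w"
      unfolding D[OF w] by (rule B0.pair(3)[OF module_hom_closed[OF g w] module_hom_closed[OF h w]])
  qed (rule biproduct_Suc biproduct_shift resolvesD(2)[OF rB] f shift_differential)+
qed

lemma two_cone_steps: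
  "two_cone_steps R
    (FT (Suc (Suc n))) (FS (Suc n)) (FQ (Suc (Suc n)))
    (free_inl R) (free_inr R) free_outl free_outr
    (FT (Suc n)) (FS n) (FQ (Suc n))
    (free_inl R) (free_inr R) free_outl free_outr
    (FT n) (FZ n) (FQ n)
    (free_inl R) (free_inr R) free_outl free_outr
    (c (Suc (Suc n))) (f (Suc n)) (d (Suc n)) (D (Suc (Suc n))) (c (Suc n)) (f n) (d n) (D (Suc n))"
proof (intro two_cone_steps.intro two_cone_steps_axioms.intro)
  have "cone_shift S (Suc n) = S n" by (simp add: cone_shift_def)
  then show "cone_step R
    (FT (Suc (Suc n))) (FS (Suc n)) (FQ (Suc (Suc n)))
    (free_inl R) (free_inr R) free_outl free_outr
    (FT (Suc n)) (FS n) (FQ (Suc n))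
    (free_inl R) (free_inr R) free_outl free_outr
    (c (Suc (Suc n))) (f (Suc n)) (d (Suc n)) (D (Suc (Suc n)))"
    using cone_step[of "Suc n"] by simp
  show "c (Suc n) (f (Suc n) x) = f n (d (Suc n) x)" if "x \<in> carrier (FS (Suc n))" for x
    using cf[OF that] by simp
qed (rule cone_step)

lemma shift_zero_iff:
  assumes x: "x \<in> carrier (FS n)"
  shows "d n x = \<zero>\<^bsub>FZ n\<^esub> \<longleftrightarrow> d n x = \<zero>\<^bsub>FS (n - 1)\<^esub>"
  by (simp add: free_module_ops)

text \<open>Before tensoring, the zeros on both sides are the same function. Afterwards they are
  cosets in different modules, so degree 0 is treated apart: there both equations hold, since
  \<open>d 0\<close> is zero.\<close>

lemma tensor_shift_zero_iff:
  assumes N: "Module.module R N" and x: "x \<in> carrier (tensor_module R (FS n) N)"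
  shows "tensor_map R (FZ n) N (d n) x =
      \<zero>\<^bsub>tensor_module R (FZ n) N\<^esub> \<longleftrightarrow>
    tensor_map R (FS (n - 1)) N (d n) x = \<zero>\<^bsub>tensor_module R (FS (n - 1)) N\<^esub>"
proof (cases n)
  case 0
  have z: "d 0 = (\<lambda>x. \<zero>\<^bsub>free_module R X\<^esub>)" for X
    using resolvesD(3)[OF rA] by (simp add: free_module_ops fun_eq_iff)
  have "tensor_map R (free_module R X) N (d 0) x = \<zero>\<^bsub>tensor_module R (free_module R X) N\<^esub>" for X
    unfolding z[of X] by (rule tensor_map_zero[OF Free Free N x])
  then show ?thesis by (simp add: 0)
next
  case (Suc m)
  then show ?thesis by (simp add: cone_shift_def)
qed

text \<open>Once the cone is known to resolve the cokernel \<open>E\<close> of an injective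
  \<open>u\<close>, this yields what exactness of Tor_(n+1)(B) -> Tor_(n+1)(E) -> Tor_n(A) would
  yield.\<close>

lemma tor_exact_cone:
  assumes N: "Module.module R N" and T: "tor_exact R N T c (Suc n)" and S: "tor_exact R N S d n"
  shows "tor_exact R N Q D (Suc n)"
  unfolding tor_exact_def
proof (intro ballI impI)
  fix z assume z: "z \<in> carrier (tensor_module R (FQ (Suc n)) N)"
    and Dz: "tensor_map R (FQ (Suc n - 1)) N (D (Suc n)) z =
      \<zero>\<^bsub>tensor_module R (FQ (Suc n - 1)) N\<^esub>"
  show "\<exists>y\<in>carrier (tensor_module R (FQ (Suc (Suc n))) N).
      z = tensor_map R (FQ (Suc n)) N (D (Suc (Suc n))) y"
  proof (rule two_cone_steps.cone_exact[OF two_cone_steps_tensor[OF two_cone_steps[of n] N] _ _ z])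
    show "tensor_map R (FQ n) N (D (Suc n)) z = \<zero>\<^bsub>tensor_module R (FQ n) N\<^esub>"
      using Dz by simp
    fix y assume y: "y \<in> carrier (tensor_module R (FT (Suc n)) N)"
      "tensor_map R (FT n) N (c (Suc n)) y = \<zero>\<^bsub>tensor_module R (FT n) N\<^esub>"
    show "\<exists>y'\<in>carrier (tensor_module R (FT (Suc (Suc n))) N).
        y = tensor_map R (FT (Suc n)) N (c (Suc (Suc n))) y'"
      by (rule tor_exactD[OF T y(1)]) (use y(2) in simp)
  next
    fix x assume x: "x \<in> carrier (tensor_module R (FS n) N)"
      "tensor_map R (FZ n) N (d n) x =
        \<zero>\<^bsub>tensor_module R (FZ n) N\<^esub>"
    show "\<exists>x'\<in>carrier (tensor_module R (FS (Suc n)) N).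
        x = tensor_map R (FS n) N (d (Suc n)) x'"
      using x(2) unfolding tensor_shift_zero_iff[OF N x(1)] by (rule tor_exactD[OF S x(1)])
  qed
qed

text \<open>The counterpart of exactness of Tor_(n+1)(E) -> Tor_n(A) -> Tor_n(B). The image under
  \<open>f n\<close> of a cycle is again a cycle, hence a boundary by exactness of the complex for
  \<open>T\<close>, and this supplies the \<open>y\<close> required by
  \<open>source_exact\<close>.\<close>

lemma tor_exact_source:
  assumes N: "Module.module R N" and Q: "tor_exact R N Q D (Suc n)" and T: "tor_exact R N T c n"
  shows "tor_exact R N S d n"
  unfolding tor_exact_def
proof (intro ballI impI)
  let ?T = "\<lambda>X. tensor_module R (free_module R X) N"
  let ?t = "\<lambda>X. tensor_map R (free_module R X) N"
  fix x assume x: "x \<in> carrier (?T (S n))" and dx: "?t (S (n - 1)) (d n) x = \<zero>\<^bsub>?T (S (n - 1))\<^esub>"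
  have fx: "?t (T n) (f n) x \<in> carrier (?T (T n))"
    by (rule module_hom_closed[OF tensor_map_hom[OF Free Free N f] x])
  note cn = resolvesD(1)[OF rB, of n] and dn = resolvesD(1)[OF rA, of n]
  have "?t (T (n - 1)) (c n) (?t (T n) (f n) x) = ?t (T (n - 1)) (\<lambda>a. c n (f n a)) x"
    by (rule tensor_map_comp[OF Free Free Free N f cn x, symmetric])
  also have "\<dots> = ?t (T (n - 1)) (\<lambda>a. f (n - 1) (d n a)) x"
    by (rule tensor_map_cong[OF Free Free N module_hom_comp[OF f[of n] cn] module_hom_comp[OF dn f[of "n - 1"]] _ x])
      (rule cf)
  also have "\<dots> = ?t (T (n - 1)) (f (n - 1)) (?t (S (n - 1)) (d n) x)"
    by (rule tensor_map_comp[OF Free Free Free N dn f x])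
  also have "\<dots> = \<zero>\<^bsub>?T (T (n - 1))\<^esub>"
    unfolding dx
    by (rule module_hom_zero[OF tensor_module_module[OF Free N] tensor_module_module[OF Free N] tensor_map_hom[OF Free Free N f]])
  finally have "\<exists>y\<in>carrier (?T (T (Suc n))). ?t (T n) (f n) x = ?t (T n) (c (Suc n)) y"
    by (rule tor_exactD[OF T fx])
  then obtain y where y: "y \<in> carrier (?T (T (Suc n)))" "?t (T n) (f n) x = ?t (T n) (c (Suc n)) y"
    by (rule bexE)
  show "\<exists>y\<in>carrier (?T (S (Suc n))). x = ?t (S n) (d (Suc n)) y"
  proof (rule two_cone_steps.source_exact[OF two_cone_steps_tensor[OF two_cone_steps[of n] N] _ x _ y])
    show "?t (cone_shift S n) (d n) x = \<zero>\<^bsub>?T (cone_shift S n)\<^esub>"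
      using dx unfolding tensor_shift_zero_iff[OF N x] .
    fix z assume z: "z \<in> carrier (?T (Q (Suc n)))" "?t (Q n) (D (Suc n)) z = \<zero>\<^bsub>?T (Q n)\<^esub>"
    show "\<exists>w\<in>carrier (?T (Q (Suc (Suc n)))). z = ?t (Q (Suc n)) (D (Suc (Suc n))) w"
      by (rule tor_exactD[OF Q z(1)]) (use z(2) in simp)
  qed
qed

lemma module_hom_shift:
  assumes "\<psi> \<in> module_hom R (FS (n - 1)) N"
  shows "\<psi> \<in> module_hom R (FZ n) N"
proof -
  have sub: "x \<in> carrier (FS (n - 1))" if "x \<in> carrier (FZ n)" for x
    by (rule free_module_mono[OF _ that]) (simp add: cone_shift_def split: nat.splits)
  show ?thesis
  proof (rule module_homI)
    show "\<psi> x \<in> carrier N" if "x \<in> carrier (FZ n)" for x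
      by (rule module_hom_closed[OF assms sub[OF that]])
    show "\<psi> (x \<oplus>\<^bsub>FZ n\<^esub> y) = \<psi> x \<oplus>\<^bsub>N\<^esub> \<psi> y"
      if "x \<in> carrier (FZ n)" "y \<in> carrier (FZ n)" for x y
      using module_hom_add[OF assms sub[OF that(1)] sub[OF that(2)]] by (simp add: free_module_ops)
    show "\<psi> (r \<odot>\<^bsub>FZ n\<^esub> x) = r \<odot>\<^bsub>N\<^esub> \<psi> x"
      if "r \<in> carrier R" "x \<in> carrier (FZ n)" for r x
      using module_hom_smult[OF assms that(1) sub[OF that(2)]] by (simp add: free_module_ops)
  qed
qed

text \<open>A cocycle \<phi> on the cone is a pair (\<beta>, \<alpha>) of maps on its two summands.
  The component \<beta> is a cocycle for \<open>T\<close> and becomes a coboundary; after correction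
  by this choice, \<alpha> becomes a cocycle for \<open>S\<close>.\<close>

lemma ext_exact_cone:
  assumes N: "Module.module R N" and T: "ext_exact R N T c (Suc n)" and S: "ext_exact R N S d n"
  shows "ext_exact R N Q D (Suc n)"
  unfolding ext_exact_def
proof (intro ballI impI)
  interpret N: Module.module R N by (rule N)
  interpret two_cone_steps R
    "FT (Suc (Suc n))" "FS (Suc n)" "FQ (Suc (Suc n))"
    "free_inl R" "free_inr R" free_outl free_outr
    "FT (Suc n)" "FS n" "FQ (Suc n)"
    "free_inl R" "free_inr R" free_outl free_outr
    "FT n" "FZ n" "FQ n"
    "free_inl R" "free_inr R" free_outl free_outr
    "c (Suc (Suc n))" "f (Suc n)" "d (Suc n)" "D (Suc (Suc n))" "c (Suc n)" "f n" "d n" "D (Suc n)"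
    by (rule two_cone_steps)
  fix \<phi> assume \<phi>: "\<phi> \<in> module_hom R (FQ (Suc n)) N"
    and \<phi>D: "\<forall>x\<in>carrier (FQ (Suc (Suc n))). \<phi> (D (Suc (Suc n)) x) = \<zero>\<^bsub>N\<^esub>"
  let ?\<beta> = "\<lambda>y. \<phi> (free_inl R y)" and ?\<alpha> = "\<lambda>x. \<phi> (free_inr R x)"
  have \<beta>: "?\<beta> \<in> module_hom R (FT (Suc n)) N" by (rule module_hom_comp[OF S1.B0.i1 \<phi>])
  have \<alpha>: "?\<alpha> \<in> module_hom R (FS n) N" by (rule module_hom_comp[OF S1.B0.i2 \<phi>])
  have "\<exists>\<psi>\<in>module_hom R (FT (Suc n - 1)) N.
      \<forall>y\<in>carrier (FT (Suc n)). ?\<beta> y = \<psi> (c (Suc n) y)"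
  proof (rule ext_exactD[OF T \<beta>])
    fix y assume y: "y \<in> carrier (FT (Suc (Suc n)))"
    show "?\<beta> (c (Suc (Suc n)) y) = \<zero>\<^bsub>N\<^esub>"
      using bspec[OF \<phi>D module_hom_closed[OF S1.B1.i1 y]] by (simp add: S1.D_i1[OF y])
  qed
  then obtain \<beta>1 where \<beta>1: "\<beta>1 \<in> module_hom R (FT n) N"
    "\<And>y. y \<in> carrier (FT (Suc n)) \<Longrightarrow> ?\<beta> y = \<beta>1 (c (Suc n) y)" by auto
  \<comment> \<open>The cocycle condition on the second summand reads \<alpha> \<open>d\<close> =
    \<beta> \<open>f\<close>, and \<beta> \<open>f\<close> = \<open>\<beta>1\<close>
    \<open>c\<close> \<open>f\<close> = \<open>\<beta>1\<close> \<open>f\<close> \<open>d\<close>.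
    So subtracting \<open>\<beta>1\<close> \<open>f\<close> from \<alpha> leaves a cocycle.\<close>
  let ?\<alpha>' = "\<lambda>x. ?\<alpha> x \<ominus>\<^bsub>N\<^esub> \<beta>1 (f n x)"
  have \<alpha>': "?\<alpha>' \<in> module_hom R (FS n) N"
    by (rule module_hom_minus[OF N \<alpha> module_hom_comp[OF f \<beta>1(1)]])
  have "\<exists>\<psi>\<in>module_hom R (FS (n - 1)) N. \<forall>x\<in>carrier (FS n). ?\<alpha>' x = \<psi> (d n x)"
  proof (rule ext_exactD[OF S \<alpha>'])
    fix x assume x: "x \<in> carrier (FS (Suc n))"
    have dx: "d (Suc n) x \<in> carrier (FS n)" by (rule module_hom_closed[OF S1.d x])
    have fx: "f (Suc n) x \<in> carrier (FT (Suc n))" by (rule module_hom_closed[OF S1.f x])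
    have ndx: "\<ominus>\<^bsub>FS n\<^esub> d (Suc n) x \<in> carrier (FS n)"
      using dx abelian_group.a_inv_closed[OF module_group[OF Free]] by blast
    have "\<zero>\<^bsub>N\<^esub> = \<phi> (D (Suc (Suc n)) (free_inr R x))"
      using bspec[OF \<phi>D module_hom_closed[OF S1.B1.i2 x]] by simp
    also have "\<dots> = ?\<beta> (f (Suc n) x) \<oplus>\<^bsub>N\<^esub> ?\<alpha> (\<ominus>\<^bsub>FS n\<^esub> d (Suc n) x)"
      unfolding S1.D_i2[OF x]
      by (rule module_hom_add[OF \<phi> module_hom_closed[OF S1.B0.i1 fx] module_hom_closed[OF S1.B0.i2 ndx]])
    also have "?\<alpha> (\<ominus>\<^bsub>FS n\<^esub> d (Suc n) x) = \<ominus>\<^bsub>N\<^esub> ?\<alpha> (d (Suc n) x)"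
      by (rule module_hom_neg[OF Free N \<alpha> dx])
    finally have "?\<beta> (f (Suc n) x) \<ominus>\<^bsub>N\<^esub> ?\<alpha> (d (Suc n) x) = \<zero>\<^bsub>N\<^esub>" by (simp add: N.minus_eq)
    then have "?\<beta> (f (Suc n) x) = ?\<alpha> (d (Suc n) x)"
      using N.minus_eq_zero_iff[OF module_hom_closed[OF \<beta> fx] module_hom_closed[OF \<alpha> dx]] by simp
    then have "?\<alpha> (d (Suc n) x) = \<beta>1 (f n (d (Suc n) x))" using \<beta>1(2)[OF fx] comm[OF x] by simp
    then show "?\<alpha>' (d (Suc n) x) = \<zero>\<^bsub>N\<^esub>"
      using N.minus_eq_zero_iff[OF module_hom_closed[OF \<alpha> dx] module_hom_closed[OF \<beta>1(1) module_hom_closed[OF f dx]]]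
      by simp
  qed
  then obtain \<alpha>1 where \<alpha>1: "\<alpha>1 \<in> module_hom R (FS (n - 1)) N"
    "\<And>x. x \<in> carrier (FS n) \<Longrightarrow> ?\<alpha>' x = \<alpha>1 (d n x)" by auto
  have \<alpha>1s: "\<alpha>1 \<in> module_hom R (FZ n) N" by (rule module_hom_shift[OF \<alpha>1(1)])
  \<comment> \<open>The minus sign compensates the sign of \<open>d\<close> in the differential of
    the cone.\<close>
  let ?\<psi> = "\<lambda>w. \<beta>1 (free_outl w) \<ominus>\<^bsub>N\<^esub> \<alpha>1 (free_outr w)"
  have \<psi>: "?\<psi> \<in> module_hom R (FQ (Suc n - 1)) N"
    using module_hom_minus[OF N module_hom_comp[OF S0.B0.p1 \<beta>1(1)] module_hom_comp[OF S0.B0.p2 \<alpha>1s]] by simp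
  have "\<phi> w = ?\<psi> (D (Suc n) w)" if w: "w \<in> carrier (FQ (Suc n))" for w
  proof -
    let ?y = "free_outl w" and ?x = "free_outr w"
    have y: "?y \<in> carrier (FT (Suc n))" by (rule module_hom_closed[OF S1.B0.p1 w])
    have x: "?x \<in> carrier (FS n)" by (rule module_hom_closed[OF S1.B0.p2 w])
    have cy: "c (Suc n) ?y \<in> carrier (FT n)" by (rule module_hom_closed[OF S0.c y])
    have fx: "f n ?x \<in> carrier (FT n)" by (rule module_hom_closed[OF f x])
    have dx: "d n ?x \<in> carrier (FZ n)" by (rule module_hom_closed[OF S0.d x])
    note cl = module_hom_closed[OF \<beta>1(1) cy] module_hom_closed[OF \<beta>1(1) fx] module_hom_closed[OF \<alpha>1s dx]
      module_hom_closed[OF \<alpha> x] module_hom_closed[OF \<beta> y]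
    have "?\<psi> (D (Suc n) w) = (\<beta>1 (c (Suc n) ?y) \<oplus>\<^bsub>N\<^esub> \<beta>1 (f n ?x)) \<oplus>\<^bsub>N\<^esub> \<alpha>1 (d n ?x)"
      using cl by (simp add: S0.q1_D[OF w] S0.q2_D[OF w] module_hom_add[OF \<beta>1(1) cy fx]
          module_hom_neg[OF Free N \<alpha>1s dx] N.minus_eq)
    also have "\<dots> = ?\<beta> ?y \<oplus>\<^bsub>N\<^esub> (\<beta>1 (f n ?x) \<oplus>\<^bsub>N\<^esub> ?\<alpha>' ?x)"
      using cl by (simp add: \<alpha>1(2)[OF x] \<beta>1(2)[OF y] N.a_assoc)
    also have "\<beta>1 (f n ?x) \<oplus>\<^bsub>N\<^esub> ?\<alpha>' ?x = ?\<alpha> ?x"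
      using cl N.minus_eq_iff[of "?\<alpha> ?x" "\<beta>1 (f n ?x)" "?\<alpha>' ?x"] by (simp add: N.a_comm)
    also have "?\<beta> ?y \<oplus>\<^bsub>N\<^esub> ?\<alpha> ?x = \<phi> (free_inl R ?y \<oplus>\<^bsub>FQ (Suc n)\<^esub> free_inr R ?x)"
      by (rule module_hom_add[OF \<phi> module_hom_closed[OF S1.B0.i1 y] module_hom_closed[OF S1.B0.i2 x], symmetric])
    also have "\<dots> = \<phi> w" by (simp add: S1.B0.sum[OF w])
    finally show ?thesis by (rule sym)
  qed
  then show "\<exists>\<psi>\<in>module_hom R (FQ (Suc n - 1)) N.
      \<forall>w\<in>carrier (FQ (Suc n)). \<phi> w = \<psi> (D (Suc n) w)"
    by (intro bexI[OF _ \<psi>] ballI)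
qed

text \<open>A cocycle \<alpha> on \<open>S\<close>, composed with the projection, is a cocycle on
  the cone and so equals \<open>\<phi>1\<close> after \<open>D\<close>. The restriction of
  \<open>\<phi>1\<close> to the first summand is a cocycle for \<open>T\<close>, because \<alpha>
  does not see that summand. Writing it as \<open>\<beta>2\<close> after \<open>c\<close> and
  evaluating on the second summand expresses \<alpha> through \<open>d\<close>.\<close>

lemma ext_exact_source:
  assumes N: "Module.module R N" and Q: "ext_exact R N Q D (Suc n)" and T: "ext_exact R N T c n"
  shows "ext_exact R N S d n"
  unfolding ext_exact_def
proof (intro ballI impI)
  interpret N: Module.module R N by (rule N)
  interpret two_cone_steps R
    "FT (Suc (Suc n))" "FS (Suc n)" "FQ (Suc (Suc n))"
    "free_inl R" "free_inr R" free_outl free_outr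
    "FT (Suc n)" "FS n" "FQ (Suc n)"
    "free_inl R" "free_inr R" free_outl free_outr
    "FT n" "FZ n" "FQ n"
    "free_inl R" "free_inr R" free_outl free_outr
    "c (Suc (Suc n))" "f (Suc n)" "d (Suc n)" "D (Suc (Suc n))" "c (Suc n)" "f n" "d n" "D (Suc n)"
    by (rule two_cone_steps)
  fix \<alpha> assume \<alpha>: "\<alpha> \<in> module_hom R (FS n) N"
    and \<alpha>d: "\<forall>x\<in>carrier (FS (Suc n)). \<alpha> (d (Suc n) x) = \<zero>\<^bsub>N\<^esub>"
  let ?\<phi> = "\<lambda>w. \<alpha> (free_outr w)"
  have \<phi>: "?\<phi> \<in> module_hom R (FQ (Suc n)) N" by (rule module_hom_comp[OF S1.B0.p2 \<alpha>])
  have "\<exists>\<psi>\<in>module_hom R (FQ (Suc n - 1)) N.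
      \<forall>w\<in>carrier (FQ (Suc n)). ?\<phi> w = \<psi> (D (Suc n) w)"
  proof (rule ext_exactD[OF Q \<phi>])
    fix w assume w: "w \<in> carrier (FQ (Suc (Suc n)))"
    have x: "free_outr w \<in> carrier (FS (Suc n))" by (rule module_hom_closed[OF S1.B1.p2 w])
    show "?\<phi> (D (Suc (Suc n)) w) = \<zero>\<^bsub>N\<^esub>"
      using bspec[OF \<alpha>d x] by (simp add: S1.q2_D[OF w] module_hom_neg[OF Free N \<alpha> module_hom_closed[OF S1.d x]])
  qed
  then obtain \<phi>1 where \<phi>1: "\<phi>1 \<in> module_hom R (FQ n) N"
    "\<And>w. w \<in> carrier (FQ (Suc n)) \<Longrightarrow> ?\<phi> w = \<phi>1 (D (Suc n) w)" by auto
  let ?\<beta> = "\<lambda>y. \<phi>1 (free_inl R y)"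
  have \<beta>: "?\<beta> \<in> module_hom R (FT n) N" by (rule module_hom_comp[OF S0.B0.i1 \<phi>1(1)])
  have "\<exists>\<psi>\<in>module_hom R (FT (n - 1)) N. \<forall>y\<in>carrier (FT n). ?\<beta> y = \<psi> (c n y)"
  proof (rule ext_exactD[OF T \<beta>])
    fix y assume y: "y \<in> carrier (FT (Suc n))"
    show "?\<beta> (c (Suc n) y) = \<zero>\<^bsub>N\<^esub>"
      using \<phi>1(2)[OF module_hom_closed[OF S1.B0.i1 y]] module_hom_zero[OF Free N \<alpha>]
      by (simp add: S0.D_i1[OF y] S1.B0.p2_i1[OF y])
  qed
  then obtain \<beta>2 where \<beta>2: "\<beta>2 \<in> module_hom R (FT (n - 1)) N"
    "\<And>y. y \<in> carrier (FT n) \<Longrightarrow> ?\<beta> y = \<beta>2 (c n y)" by auto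
  have key: "\<alpha> x = \<beta>2 (f (n - 1) (d n x)) \<ominus>\<^bsub>N\<^esub> \<phi>1 (free_inr R (d n x))"
    if x: "x \<in> carrier (FS n)" for x
  proof -
    have fx: "f n x \<in> carrier (FT n)" by (rule module_hom_closed[OF f x])
    have dx: "d n x \<in> carrier (FZ n)" by (rule module_hom_closed[OF S0.d x])
    have ndx: "\<ominus>\<^bsub>FZ n\<^esub> d n x \<in> carrier (FZ n)"
      using dx abelian_group.a_inv_closed[OF module_group[OF Free]] by blast
    have ix: "free_inr R x \<in> carrier (FQ (Suc n))" by (rule module_hom_closed[OF S1.B0.i2 x])
    have "\<alpha> x = \<phi>1 (D (Suc n) (free_inr R x))" using \<phi>1(2)[OF ix] by (simp add: S1.B0.p2_i2[OF x])
    also have "\<dots> = ?\<beta> (f n x) \<oplus>\<^bsub>N\<^esub> \<phi>1 (free_inr R (\<ominus>\<^bsub>FZ n\<^esub> d n x))"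
      unfolding S0.D_i2[OF x]
      by (rule module_hom_add[OF \<phi>1(1) module_hom_closed[OF S0.B0.i1 fx] module_hom_closed[OF S0.B0.i2 ndx]])
    also have "\<phi>1 (free_inr R (\<ominus>\<^bsub>FZ n\<^esub> d n x)) = \<ominus>\<^bsub>N\<^esub> \<phi>1 (free_inr R (d n x))"
      by (rule module_hom_neg[OF Free N module_hom_comp[OF S0.B0.i2 \<phi>1(1)] dx])
    also have "?\<beta> (f n x) = \<beta>2 (f (n - 1) (d n x))" using \<beta>2(2)[OF fx] cf[OF x] by simp
    finally show ?thesis by (simp add: N.minus_eq)
  qed
  \<comment> \<open>The right-hand side of \<open>key\<close> factors through \<open>d n\<close>,
    but one part of it is defined on the shifted module only. That module is
    \<open>FS (n - 1)\<close> in positive degrees; in degree 0 the formula shows that \<alpha> is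
    zero.\<close>
  show "\<exists>\<psi>\<in>module_hom R (FS (n - 1)) N. \<forall>x\<in>carrier (FS n). \<alpha> x = \<psi> (d n x)"
  proof (cases n)
    case 0
    have "\<alpha> x = \<zero>\<^bsub>N\<^esub>" if x: "x \<in> carrier (FS n)" for x
    proof -
      have d0: "d n x = \<zero>\<^bsub>free_module R X\<^esub>" for X using 0 resolvesD(3)[OF rA] by (simp add: free_module_ops)
      have "\<beta>2 (f (n - 1) \<zero>\<^bsub>FS (n - 1)\<^esub>) = \<zero>\<^bsub>N\<^esub>"
        by (rule module_hom_zero[OF Free N module_hom_comp[OF f \<beta>2(1)]])
      moreover have "\<phi>1 (free_inr R \<zero>\<^bsub>FZ n\<^esub>) = \<zero>\<^bsub>N\<^esub>"
        by (rule module_hom_zero[OF Free N module_hom_comp[OF S0.B0.i2 \<phi>1(1)]])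
      ultimately show ?thesis
        using key[OF x] d0[of "S (n - 1)"] d0[of "cone_shift S n"] by (simp add: N.minus_eq)
    qed
    then show ?thesis by (intro bexI[OF _ module_hom_const_zero[OF N]]) simp
  next
    case (Suc m)
    then have s: "cone_shift S n = S (n - 1)" by (simp add: cone_shift_def)
    have "(\<lambda>z. \<beta>2 (f (n - 1) z) \<ominus>\<^bsub>N\<^esub> \<phi>1 (free_inr R z)) \<in> module_hom R (FS (n - 1)) N"
      by (rule module_hom_minus[OF N module_hom_comp[OF f \<beta>2(1)] module_hom_comp[OF S0.B0.i2[unfolded s] \<phi>1(1)]])
    then show ?thesis
      by (rule bexI[of _ "\<lambda>z. \<beta>2 (f (n - 1) z) \<ominus>\<^bsub>N\<^esub> \<phi>1 (free_inr R z)", rotated]) (rule ballI, rule key)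
  qed
qed

context
  fixes E :: "('r, 'x) module" and v
  assumes E: "Module.module R E" and v: "v \<in> module_hom R B E"
    and u_inj: "\<And>a. a \<in> carrier A \<Longrightarrow> u a = \<zero>\<^bsub>B\<^esub> \<Longrightarrow> a = \<zero>\<^bsub>A\<^esub>"
    and v_surj: "v ` carrier B = carrier E"
    and exact: "\<And>b. b \<in> carrier B \<Longrightarrow> v b = \<zero>\<^bsub>E\<^esub> \<longleftrightarrow> b \<in> u ` carrier A"
begin

abbreviation (input) "cone_augmentation \<equiv> \<lambda>w. v (q (free_outl w))"

text \<open>If \<open>v (q y)\<close> is zero, then \<open>q y = u a\<close> for some
  \<open>a = e x\<close>, and \<open>u (e x) = q (f x)\<close>. So \<open>y - f x\<close> is a cycle
  of the augmented resolution of \<open>B\<close>, say \<open>c y'\<close>, and \<open>y\<close> is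
  the first component of \<open>D (y', x)\<close>. Second components agree because the shifted
  module is zero in degree 0.\<close>

lemma cone_cycle_0:
  assumes w: "w \<in> carrier (FQ 0)"
  shows "cone_augmentation w = \<zero>\<^bsub>E\<^esub> \<longleftrightarrow> w \<in> D (Suc 0) ` carrier (FQ (Suc 0))"
proof
  interpret C: cone_step R "FT (Suc 0)" "FS 0" "FQ (Suc 0)"
    "free_inl R" "free_inr R" free_outl free_outr
    "FT 0" "FZ 0" "FQ 0"
    "free_inl R" "free_inr R" free_outl free_outr "c (Suc 0)" "f 0" "d 0" "D (Suc 0)" by (rule cone_step)
  interpret B: Module.module R B by (rule B)
  note q = resolvesD(4)[OF rB] and e = resolvesD(4)[OF rA]
  have shift0: "x = \<zero>\<^bsub>free_module R X\<^esub>" if "x \<in> carrier (FZ 0)" for x X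
    using that by (intro free_module_empty) (simp add: cone_shift_def)
  have y: "free_outl w \<in> carrier (FT 0)" by (rule module_hom_closed[OF C.B0.p1 w])
  {
    assume "cone_augmentation w = \<zero>\<^bsub>E\<^esub>"
    then obtain a where a: "a \<in> carrier A" "q (free_outl w) = u a"
      using exact[OF module_hom_closed[OF q y]] by auto
    obtain x where x: "x \<in> carrier (FS 0)" "a = e x"
      using resolvesD(5)[OF rA] a(1) by auto
    have fx: "f 0 x \<in> carrier (FT 0)" by (rule module_hom_closed[OF f x(1)])
    have yx: "free_outl w \<ominus>\<^bsub>FT 0\<^esub> f 0 x \<in> carrier (FT 0)"
      using y fx abelian_group.minus_closed[OF module_group[OF Free]] by blast
    have "q (free_outl w \<ominus>\<^bsub>FT 0\<^esub> f 0 x) = \<zero>\<^bsub>B\<^esub>"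
      using module_hom_closed[OF u a(1)] x
      by (simp add: module_hom_diff[OF Free B q y fx] a(2) qf B.minus_eq_zero_iff)
    then have "resolution_cycle R B T c q 0 (free_outl w \<ominus>\<^bsub>FT 0\<^esub> f 0 x)"
      using resolvesD(3)[OF rB] by (simp add: resolution_cycle_def)
    then obtain y' where y': "y' \<in> carrier (FT (Suc 0))"
      "free_outl w \<ominus>\<^bsub>FT 0\<^esub> f 0 x = c (Suc 0) y'"
      using resolvesD(6)[OF rB yx] by auto
    have cy': "c (Suc 0) y' \<in> carrier (FT 0)" by (rule module_hom_closed[OF C.c y'(1)])
    note p = C.B1.pair[OF y'(1) x(1)]
    have "w = D (Suc 0) (free_inl R y' \<oplus>\<^bsub>FQ (Suc 0)\<^esub> free_inr R x)"
    proof (rule C.B0.eqI[OF w module_hom_closed[OF C.D p(1)]])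
      show "free_outl w = free_outl (D (Suc 0) (free_inl R y' \<oplus>\<^bsub>FQ (Suc 0)\<^esub> free_inr R x))"
        using abelian_group.minus_eq_iff[OF module_group[OF Free] y fx cy'] y'(2)
        by (simp add: C.q1_D[OF p(1)] p(2,3))
      show "free_outr w = free_outr (D (Suc 0) (free_inl R y' \<oplus>\<^bsub>FQ (Suc 0)\<^esub> free_inr R x))"
        using shift0[OF module_hom_closed[OF C.B0.p2 w], of "{}"]
          shift0[OF module_hom_closed[OF C.B0.p2 module_hom_closed[OF C.D p(1)]], of "{}"] by (rule trans[OF _ sym])
    qed
    then show "w \<in> D (Suc 0) ` carrier (FQ (Suc 0))"
      by (rule image_eqI[of w "D (Suc 0)"]) (rule p(1))
  next
    assume "w \<in> D (Suc 0) ` carrier (FQ (Suc 0))"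
    then obtain z where z: "z \<in> carrier (FQ (Suc 0))" "w = D (Suc 0) z" by (rule imageE)
    have zl: "free_outl z \<in> carrier (FT (Suc 0))" by (rule module_hom_closed[OF C.B1.p1 z(1)])
    have zr: "free_outr z \<in> carrier (FS 0)" by (rule module_hom_closed[OF C.B1.p2 z(1)])
    have cz: "c (Suc 0) (free_outl z) \<in> carrier (FT 0)" by (rule module_hom_closed[OF C.c zl])
    have fz: "f 0 (free_outr z) \<in> carrier (FT 0)" by (rule module_hom_closed[OF f zr])
    have ez: "e (free_outr z) \<in> carrier A" by (rule module_hom_closed[OF e zr])
    have "q (c (Suc 0) (free_outl z)) = \<zero>\<^bsub>B\<^esub>"
      using resolves_dd(1)[OF rB zl] by (simp add: resolution_cycle_def)
    then have "q (free_outl w) = u (e (free_outr z))"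
      using module_hom_closed[OF u ez]
      by (simp add: z(2) C.q1_D[OF z(1)] module_hom_add[OF q cz fz] qf[OF zr])
    then show "cone_augmentation w = \<zero>\<^bsub>E\<^esub>"
      using exact[OF module_hom_closed[OF u ez]] ez by simp
  }
qed

lemma cone_cycle_Suc:
  assumes w: "w \<in> carrier (FQ (Suc n))"
  shows "D (Suc n) w = \<zero>\<^bsub>FQ n\<^esub> \<longleftrightarrow>
    w \<in> D (Suc (Suc n)) ` carrier (FQ (Suc (Suc n)))"
proof
  note q = resolvesD(4)[OF rB] and e = resolvesD(4)[OF rA]
  interpret B: Module.module R B by (rule B)
  assume w0: "D (Suc n) w = \<zero>\<^bsub>FQ n\<^esub>"
  have "\<exists>z\<in>carrier (FQ (Suc (Suc n))). w = D (Suc (Suc n)) z"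
  proof (rule two_cone_steps.cone_exact[OF two_cone_steps[of n] _ _ w])
    show "D (Suc n) w = \<zero>\<^bsub>FQ n\<^esub>" by (rule w0)
    fix y assume y: "y \<in> carrier (FT (Suc n))" "c (Suc n) y = \<zero>\<^bsub>FT n\<^esub>"
    then show "\<exists>y'\<in>carrier (FT (Suc (Suc n))). y = c (Suc (Suc n)) y'"
      using resolvesD(6)[OF rB y(1)] by (auto simp: resolution_cycle_def)
  next
    fix x y assume x: "x \<in> carrier (FS n)" and y: "y \<in> carrier (FT (Suc n))"
      and dx: "d n x = \<zero>\<^bsub>FZ n\<^esub>"
      and cyfx: "c (Suc n) y \<oplus>\<^bsub>FT n\<^esub> f n x = \<zero>\<^bsub>FT n\<^esub>"
    \<comment> \<open>In degree 0 the vanishing of \<open>d x\<close> is no information. Applying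
      \<open>q\<close> to \<open>c y + f x = 0\<close> gives \<open>u (e x) = 0\<close>, and here
      injectivity of \<open>u\<close> enters.\<close>
    have "e x = \<zero>\<^bsub>A\<^esub>" if n: "n = 0"
    proof -
      have x0: "x \<in> carrier (FS 0)" and y0: "y \<in> carrier (FT (Suc 0))"
        using x y n by simp_all
      have ex: "e x \<in> carrier A" by (rule module_hom_closed[OF e x0])
      have cy: "c (Suc 0) y \<in> carrier (FT 0)" by (rule module_hom_closed[OF resolvesD(2)[OF rB] y0])
      have fx: "f 0 x \<in> carrier (FT 0)" by (rule module_hom_closed[OF f x0])
      have qc: "q (c (Suc 0) y) = \<zero>\<^bsub>B\<^esub>" using resolves_dd(1)[OF rB y0] by (simp add: resolution_cycle_def)
      have "\<zero>\<^bsub>B\<^esub> = q (c (Suc 0) y \<oplus>\<^bsub>FT 0\<^esub> f 0 x)"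
        using cyfx n module_hom_zero[OF Free B q] by simp
      also have "\<dots> = u (e x)"
        using module_hom_closed[OF u ex] by (simp add: module_hom_add[OF q cy fx] qc qf[OF x0])
      finally show ?thesis using u_inj[OF ex] by simp
    qed
    then have "resolution_cycle R A S d e n x"
      using dx unfolding shift_zero_iff[OF x] by (simp add: resolution_cycle_def)
    then show "\<exists>x'\<in>carrier (FS (Suc n)). x = d (Suc n) x'"
      using resolvesD(6)[OF rA x] by auto
  qed
  then show "w \<in> D (Suc (Suc n)) ` carrier (FQ (Suc (Suc n)))" by auto
next
  assume "w \<in> D (Suc (Suc n)) ` carrier (FQ (Suc (Suc n)))"
  then obtain z where z: "z \<in> carrier (FQ (Suc (Suc n)))" "w = D (Suc (Suc n)) z" by (rule imageE)
  show "D (Suc n) w = \<zero>\<^bsub>FQ n\<^esub>"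
    unfolding z(2)
  proof (rule two_cone_steps.cone_boundary[OF two_cone_steps[of n] _ _ z(1)])
    show "c (Suc n) (c (Suc (Suc n)) y) = \<zero>\<^bsub>FT n\<^esub>"
      if "y \<in> carrier (FT (Suc (Suc n)))" for y
      using resolves_dd(2)[OF rB that] by simp
    show "d n (d (Suc n) x) = \<zero>\<^bsub>FZ n\<^esub>"
      if x: "x \<in> carrier (FS (Suc n))" for x
      using resolves_dd(2)[OF rA x] shift_zero_iff[OF module_hom_closed[OF resolvesD(2)[OF rA] x]] by simp
  qed
qed

lemma resolves_cone: "resolves R E Q D cone_augmentation"
  unfolding resolves_def
proof (intro conjI allI ballI)
  note q = resolvesD(4)[OF rB]
  have p: "free_outl \<in> module_hom R (FQ 0) (FT 0)"
    by (rule biproduct.p1[OF biproduct_shift])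
  show "D 0 x = \<zero>\<^bsub>FQ 0\<^esub>" for x
    by (simp add: cone_differential_def free_module_ops)
  show "D n \<in> module_hom R (FQ n) (FQ (n - 1))" for n
  proof (cases n)
    case 0
    have "D 0 x = \<zero>\<^bsub>FQ 0\<^esub>" for x
      by (simp add: cone_differential_def free_module_ops)
    then show ?thesis
      using module_hom_cong[OF Free module_hom_const_zero[OF Free], where g = "D 0"] 0 by simp
  next
    case (Suc m)
    then show ?thesis using cone_step.D[OF cone_step[of m]] by simp
  qed
  show aug: "cone_augmentation \<in> module_hom R (FQ 0) E"
    by (rule module_hom_comp[OF module_hom_comp[OF p q] v])
  show "cone_augmentation ` carrier (FQ 0) = carrier E"
  proof (intro equalityI subsetI)
    show "y \<in> carrier E" if "y \<in> cone_augmentation ` carrier (FQ 0)" for y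
      using that module_hom_closed[OF aug] by auto
    fix y assume "y \<in> carrier E"
    then obtain b where b: "b \<in> carrier B" "y = v b" using v_surj by auto
    then obtain x where x: "x \<in> carrier (FT 0)" "b = q x" using resolvesD(5)[OF rB] by auto
    have "y = cone_augmentation (free_inl R x :: 't + 's \<Rightarrow> 'r)"
      using b x biproduct.p1_i1[OF biproduct_shift x(1)] by simp
    then show "y \<in> cone_augmentation ` carrier (FQ 0)"
      by (rule image_eqI[of y cone_augmentation "free_inl R x"]) (rule module_hom_closed[OF biproduct.i1[OF biproduct_shift] x(1)])
  qed
  fix n w assume w: "w \<in> carrier (FQ n)"
  show "resolution_cycle R E Q D cone_augmentation n w \<longleftrightarrow>
      w \<in> D (Suc n) ` carrier (FQ (Suc n))"
  proof (cases n)
    case 0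
    have "D 0 w = \<zero>\<^bsub>FQ 0\<^esub>" by (simp add: cone_differential_def free_module_ops)
    then show ?thesis using cone_cycle_0 w 0 by (simp add: resolution_cycle_def)
  next
    case (Suc m)
    then show ?thesis using cone_cycle_Suc[of w m] w by (simp add: resolution_cycle_def)
  qed
qed

end

end

section \<open>Dimension shifting along a short exact sequence\<close>

locale short_exact =
  fixes R :: "'r ring" and A :: "('r, 'a) module" and B :: "('r, 'b) module" and E :: "('r, 'x) module"
    and u :: "'a \<Rightarrow> 'b" and v :: "'b \<Rightarrow> 'x"
  assumes A: "Module.module R A" and B: "Module.module R B" and E: "Module.module R E"
    and u: "u \<in> module_hom R A B" and v: "v \<in> module_hom R B E"
    and u_inj: "\<And>a. a \<in> carrier A \<Longrightarrow> u a = \<zero>\<^bsub>B\<^esub> \<Longrightarrow> a = \<zero>\<^bsub>A\<^esub>"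
    and v_surj: "v ` carrier B = carrier E"
    and exact: "\<And>b. b \<in> carrier B \<Longrightarrow> v b = \<zero>\<^bsub>E\<^esub> \<longleftrightarrow> b \<in> u ` carrier A"
begin

text \<open>Two segments of the long exact sequence in the first variable. Arrows run in opposite
  directions for Tor and Ext, but the degrees match: \<open>B\<close> and \<open>E\<close> in degree
  \<open>n + 1\<close> go with \<open>A\<close> in degree \<open>n\<close>, and \<open>B\<close> in
  degree \<open>n\<close> stands next to \<open>A\<close> in degree \<open>n\<close>. Hence one
  statement serves both functors.\<close>

lemma vanishes_shift:
  assumes N: "Module.module R N"
  shows "vanishes t R B N (int (Suc n)) \<Longrightarrow> vanishes t R A N (int n) \<Longrightarrow> vanishes t R E N (int (Suc n))"
    and "vanishes t R E N (int (Suc n)) \<Longrightarrow> vanishes t R B N (int n) \<Longrightarrow> vanishes t R A N (int n)"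
proof -
  note rA = standard_resolution[OF A] and rB = standard_resolution[OF B]
  obtain f where f: "\<And>n. f n \<in> module_hom R (free_module R (resolution_basis R A n)) (free_module R (resolution_basis R B n))"
    "\<And>x. x \<in> carrier (free_module R (resolution_basis R A 0)) \<Longrightarrow>
      resolution_augmentation R B (f 0 x) = u (resolution_augmentation R A x)"
    "\<And>n x. x \<in> carrier (free_module R (resolution_basis R A n)) \<Longrightarrow>
      standard_differential R n (f n x) = f (n - 1) (standard_differential R n x)"
    using resolution_lift[OF A B u rA rB] by metis
  have cone: "resolution_cone R A B u (resolution_basis R A) (standard_differential R) (resolution_augmentation R A)
    (resolution_basis R B) (standard_differential R) (resolution_augmentation R B) f"
    by (rule resolution_cone.intro[OF A B u rA rB f(1)]) (rule f(2), assumption, rule f(3), assumption)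
  have rE: "resolves R E (cone_basis (resolution_basis R B) (resolution_basis R A))
      (cone_differential R (standard_differential R) f (standard_differential R))
      (\<lambda>w. v (resolution_augmentation R B (free_outl w)))"
  proof (rule resolution_cone.resolves_cone[OF cone E v])
    show "a = \<zero>\<^bsub>A\<^esub>" if "a \<in> carrier A" "u a = \<zero>\<^bsub>B\<^esub>" for a by (rule u_inj[OF that])
    show "v ` carrier B = carrier E" by (rule v_surj)
    show "v b = \<zero>\<^bsub>E\<^esub> \<longleftrightarrow> b \<in> u ` carrier A" if "b \<in> carrier B" for b by (rule exact[OF that])
  qed
  note iffs = vanishes_iff[OF A N rA] vanishes_iff[OF B N rB] vanishes_iff[OF E N rE] functor_exact_def
  show "vanishes t R B N (int (Suc n)) \<Longrightarrow> vanishes t R A N (int n) \<Longrightarrow> vanishes t R E N (int (Suc n))"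
    unfolding iffs using resolution_cone.tor_exact_cone[OF cone N, of n] resolution_cone.ext_exact_cone[OF cone N, of n]
    by (cases t) simp_all
  show "vanishes t R E N (int (Suc n)) \<Longrightarrow> vanishes t R B N (int n) \<Longrightarrow> vanishes t R A N (int n)"
    unfolding iffs using resolution_cone.tor_exact_source[OF cone N, of n] resolution_cone.ext_exact_source[OF cone N, of n]
    by (cases t) simp_all
qed

end

section \<open>Direct sums\<close>

text \<open>The free module on \<open>T \<times> S\<close> is treated as a direct sum of copies of
  the free module on \<open>S\<close>; this is the projection to the summand at
  \<open>t\<close>.\<close>

definition slice :: "'t \<Rightarrow> ('t \<times> 's \<Rightarrow> 'r) \<Rightarrow> 's \<Rightarrow> 'r" where
  "slice t w = (\<lambda>s. w (t, s))"

definition slot :: "'r ring \<Rightarrow> 't \<Rightarrow> ('s \<Rightarrow> 'r) \<Rightarrow> 't \<times> 's \<Rightarrow> 'r" where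
  "slot R t v = (\<lambda>(t', s). if t' = t then v s else \<zero>\<^bsub>R\<^esub>)"

text \<open>The projection onto the summands in \<open>X\<close>, kept as an endomorphism. It
  expresses that an element of the tensor product involves finitely many summands.\<close>

definition block :: "'r ring \<Rightarrow> 't set \<Rightarrow> ('t \<times> 's \<Rightarrow> 'r) \<Rightarrow> 't \<times> 's \<Rightarrow> 'r" where
  "block R X w = (\<lambda>(t, s). if t \<in> X then w (t, s) else \<zero>\<^bsub>R\<^esub>)"

definition slicewise :: "(('s \<Rightarrow> 'r) \<Rightarrow> 's \<Rightarrow> 'r) \<Rightarrow> ('t \<times> 's \<Rightarrow> 'r) \<Rightarrow> 't \<times> 's \<Rightarrow> 'r" where
  "slicewise f w = (\<lambda>(t, s). f (slice t w) s)"

context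
  fixes R :: "'r ring"
  assumes R: "cring R"
begin

interpretation R: cring R by (rule R)

lemmas FM = free_module_module[OF R]

lemma slice_closed:
  assumes "w \<in> carrier (free_module R (T \<times> S))"
  shows "slice t w \<in> carrier (free_module R S)"
proof -
  have "finite (Pair t -` {x. w x \<noteq> \<zero>\<^bsub>R\<^esub>})"
    using assms by (intro finite_vimageI) (auto simp: free_module_carrier inj_on_def)
  moreover have "{s. slice t w s \<noteq> \<zero>\<^bsub>R\<^esub>} = Pair t -` {x. w x \<noteq> \<zero>\<^bsub>R\<^esub>}" by (auto simp: slice_def)
  ultimately show ?thesis using assms by (auto simp: free_module_carrier slice_def)
qed

lemma slice_support:
  assumes "w \<in> carrier (free_module R (T \<times> S))"
  shows "finite {t. slice t w \<noteq> \<zero>\<^bsub>free_module R S\<^esub>}" "{t. slice t w \<noteq> \<zero>\<^bsub>free_module R S\<^esub>} \<subseteq> T"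
proof -
  have sub: "{t. slice t w \<noteq> \<zero>\<^bsub>free_module R S\<^esub>} \<subseteq> fst ` {x. w x \<noteq> \<zero>\<^bsub>R\<^esub>}"
    by (auto simp: slice_def free_module_ops fun_eq_iff image_iff)
  then show "finite {t. slice t w \<noteq> \<zero>\<^bsub>free_module R S\<^esub>}"
    using assms by (intro finite_subset[OF sub]) (simp add: free_module_carrier)
  show "{t. slice t w \<noteq> \<zero>\<^bsub>free_module R S\<^esub>} \<subseteq> T"
    using assms by (intro subset_trans[OF sub]) (auto simp: free_module_carrier)
qed

lemma slices_closed:
  assumes g: "\<And>t. g t \<in> carrier (free_module R S)"
    and fin: "finite {t. g t \<noteq> \<zero>\<^bsub>free_module R S\<^esub>}" and T: "{t. g t \<noteq> \<zero>\<^bsub>free_module R S\<^esub>} \<subseteq> T"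
  shows "(\<lambda>(t, s). g t s) \<in> carrier (free_module R (T \<times> S))"
proof -
  let ?S = "SIGMA t:{t. g t \<noteq> \<zero>\<^bsub>free_module R S\<^esub>}. {s. g t s \<noteq> \<zero>\<^bsub>R\<^esub>}"
  have sub: "{x. (case x of (t, s) \<Rightarrow> g t s) \<noteq> \<zero>\<^bsub>R\<^esub>} \<subseteq> ?S"
    by (auto simp: free_module_ops fun_eq_iff)
  have "finite ?S" using fin g by (intro finite_SigmaI) (simp_all add: free_module_carrier)
  then have "finite {x. (case x of (t, s) \<Rightarrow> g t s) \<noteq> \<zero>\<^bsub>R\<^esub>}" by (rule finite_subset[OF sub])
  moreover have "?S \<subseteq> T \<times> S" using T g by (auto simp: free_module_carrier)
  ultimately show ?thesis
    using g subset_trans[OF sub] by (simp add: free_module_carrier split: prod.splits)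
qed

lemma slice_hom: "slice t \<in> module_hom R (free_module R (T \<times> S)) (free_module R S)"
  by (rule module_homI[OF slice_closed]) (simp_all add: slice_def free_module_ops)

lemma slot_closed:
  assumes "t \<in> T" "v \<in> carrier (free_module R S)"
  shows "slot R t v \<in> carrier (free_module R (T \<times> S))"
proof -
  let ?g = "\<lambda>t'. if t' = t then v else \<zero>\<^bsub>free_module R S\<^esub>"
  have sub: "{t'. ?g t' \<noteq> \<zero>\<^bsub>free_module R S\<^esub>} \<subseteq> {t}" by auto
  have "\<zero>\<^bsub>free_module R S\<^esub> \<in> carrier (free_module R S)"
    by (simp add: free_module_carrier free_module_ops)
  then have "(\<lambda>(t', s). ?g t' s) \<in> carrier (free_module R (T \<times> S))"
    using assms finite_subset[OF sub] by (intro slices_closed) auto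
  moreover have "slot R t v = (\<lambda>(t', s). ?g t' s)" by (auto simp: slot_def free_module_ops fun_eq_iff)
  ultimately show ?thesis by simp
qed

lemma slot_hom:
  assumes "t \<in> T"
  shows "slot R t \<in> module_hom R (free_module R S) (free_module R (T \<times> S))"
  by (rule module_homI[OF slot_closed[OF assms]]) (auto simp: slot_def free_module_ops fun_eq_iff)

lemma slot_basis: "slot R t (basis_vector R s) = basis_vector R (t, s)"
  by (auto simp: slot_def basis_vector_def fun_eq_iff)

lemma block_hom: "block R X \<in> module_hom R (free_module R (T \<times> S)) (free_module R (T \<times> S))"
proof (rule module_homI)
  fix w assume w: "w \<in> carrier (free_module R (T \<times> S))"
  have sub: "{x. block R X w x \<noteq> \<zero>\<^bsub>R\<^esub>} \<subseteq> {x. w x \<noteq> \<zero>\<^bsub>R\<^esub>}"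
    by (auto simp: block_def split: if_splits)
  then have "finite {x. block R X w x \<noteq> \<zero>\<^bsub>R\<^esub>}" using w by (intro finite_subset[OF sub]) (simp add: free_module_carrier)
  moreover have "{x. w x \<noteq> \<zero>\<^bsub>R\<^esub>} \<subseteq> T \<times> S" using w by (simp add: free_module_carrier)
  moreover have "block R X w x \<in> carrier R" for x using w by (auto simp: block_def free_module_carrier split: prod.splits)
  ultimately show "block R X w \<in> carrier (free_module R (T \<times> S))"
    using subset_trans[OF sub] by (simp add: free_module_carrier)
qed (auto simp: block_def free_module_ops fun_eq_iff)

lemma slice_slicewise: "slice t (slicewise f w) = f (slice t w)"
  by (simp add: slice_def slicewise_def)

lemma slice_eqI: "(\<And>t. slice t w = slice t w') \<Longrightarrow> w = w'"
  by (auto simp: slice_def fun_eq_iff)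

lemma slicewise_hom:
  assumes f: "f \<in> module_hom R (free_module R S) (free_module R S')"
  shows "slicewise f \<in> module_hom R (free_module R (T \<times> S)) (free_module R (T \<times> S'))"
proof (rule module_homI)
  fix w assume w: "w \<in> carrier (free_module R (T \<times> S))"
  let ?g = "\<lambda>t. f (slice t w)"
  have sub: "{t. ?g t \<noteq> \<zero>\<^bsub>free_module R S'\<^esub>} \<subseteq> {t. slice t w \<noteq> \<zero>\<^bsub>free_module R S\<^esub>}"
    using module_hom_zero[OF FM FM f] by auto
  show "slicewise f w \<in> carrier (free_module R (T \<times> S'))"
    unfolding slicewise_def
    by (rule slices_closed[OF module_hom_closed[OF f slice_closed[OF w]]
          finite_subset[OF sub slice_support(1)[OF w]] subset_trans[OF sub slice_support(2)[OF w]]])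
  show "slicewise f (w \<oplus>\<^bsub>free_module R (T \<times> S)\<^esub> w') =
      slicewise f w \<oplus>\<^bsub>free_module R (T \<times> S')\<^esub> slicewise f w'"
    if w': "w' \<in> carrier (free_module R (T \<times> S))" for w'
  proof (rule slice_eqI)
    fix t
    show "slice t (slicewise f (w \<oplus>\<^bsub>free_module R (T \<times> S)\<^esub> w')) =
        slice t (slicewise f w \<oplus>\<^bsub>free_module R (T \<times> S')\<^esub> slicewise f w')"
      unfolding slice_slicewise module_hom_add[OF slice_hom w w']
        module_hom_add[OF f slice_closed[OF w] slice_closed[OF w']]
      by (simp add: slice_def slicewise_def free_module_ops)
  qed
  show "slicewise f (r \<odot>\<^bsub>free_module R (T \<times> S)\<^esub> w) = r \<odot>\<^bsub>free_module R (T \<times> S')\<^esub> slicewise f w"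
    if r: "r \<in> carrier R" for r
  proof (rule slice_eqI)
    fix t
    show "slice t (slicewise f (r \<odot>\<^bsub>free_module R (T \<times> S)\<^esub> w)) =
        slice t (r \<odot>\<^bsub>free_module R (T \<times> S')\<^esub> slicewise f w)"
      unfolding slice_slicewise module_hom_smult[OF slice_hom r w] module_hom_smult[OF f r slice_closed[OF w]]
      by (simp add: slice_def slicewise_def free_module_ops)
  qed
qed

lemma slice_slot: "slice t' (slot R t v) = (if t' = t then v else \<zero>\<^bsub>free_module R S\<^esub>)"
  by (auto simp: slice_def slot_def free_module_ops)

lemma slicewise_slot:
  assumes f: "f \<in> module_hom R (free_module R S) (free_module R S')"
  shows "slicewise f (slot R t v) = slot R t (f v)"
proof (rule slice_eqI)
  fix t'
  show "slice t' (slicewise f (slot R t v)) = slice t' (slot R t (f v))"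
    using module_hom_zero[OF FM FM f]
    by (simp add: slice_slicewise slice_slot[of t' t v S] slice_slot[of t' t "f v" S'])
qed

lemma slice_block: "slice t (block R X w) = (if t \<in> X then slice t w else \<zero>\<^bsub>free_module R S\<^esub>)"
  by (auto simp: slice_def block_def free_module_ops)

lemma slicewise_block:
  assumes f: "f \<in> module_hom R (free_module R S) (free_module R S')"
  shows "slicewise f (block R X w) = block R X (slicewise f w)"
proof (rule slice_eqI)
  fix t
  show "slice t (slicewise f (block R X w)) = slice t (block R X (slicewise f w))"
    using module_hom_zero[OF FM FM f]
    by (cases "t \<in> X")
      (simp_all add: slice_slicewise slice_block[of t X w S] slice_block[of t X "slicewise f w" S'])
qed

text \<open>Surjectivity and exactness are checked slice by slice. The preimages must be chosen zero
  wherever the given slice is zero; otherwise the family of preimages need not have finite support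
  and would not be a vector.\<close>

lemma resolves_direct_sum:
  fixes C :: "('r, 'c) module" and S :: "nat \<Rightarrow> 's set" and T :: "'t set"
  assumes C: "Module.module R C" and rC: "resolves R C S d e"
  shows "resolves R (direct_sum C T) (\<lambda>n. T \<times> S n) (\<lambda>n. slicewise (d n)) (\<lambda>w t. e (slice t w))"
  unfolding resolves_def
proof (intro conjI allI ballI)
  note e = resolvesD(4)[OF rC]
  let ?D = "\<lambda>n. slicewise (d n) :: ('t \<times> 's \<Rightarrow> 'r) \<Rightarrow> _" and ?F = "\<lambda>n. free_module R (T \<times> S n)"
  let ?E = "\<lambda>w t. e (slice t (w :: 't \<times> 's \<Rightarrow> 'r))"
  show "?D n \<in> module_hom R (?F n) (?F (n - 1))" for n
    by (rule slicewise_hom[OF resolvesD(1)[OF rC]])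
  show "?D 0 x = \<zero>\<^bsub>?F 0\<^esub>" for x
    using resolvesD(3)[OF rC] by (simp add: slicewise_def free_module_ops fun_eq_iff)
  show E: "?E \<in> module_hom R (?F 0) (direct_sum C T)"
  proof (rule module_homI)
    fix w assume w: "w \<in> carrier (?F 0)"
    have sub: "{t. ?E w t \<noteq> \<zero>\<^bsub>C\<^esub>} \<subseteq> {t. slice t w \<noteq> \<zero>\<^bsub>free_module R (S 0)\<^esub>}"
      using module_hom_zero[OF FM C e] by auto
    show "?E w \<in> carrier (direct_sum C T)"
      using finite_subset[OF sub slice_support(1)[OF w]] subset_trans[OF sub slice_support(2)[OF w]]
        module_hom_closed[OF e slice_closed[OF w]] by (simp add: direct_sum_carrier)
    show "?E (w \<oplus>\<^bsub>?F 0\<^esub> w') = ?E w \<oplus>\<^bsub>direct_sum C T\<^esub> ?E w'" if w': "w' \<in> carrier (?F 0)" for w'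
      by (simp add: direct_sum_ops module_hom_add[OF slice_hom w w']
          module_hom_add[OF e slice_closed[OF w] slice_closed[OF w']])
    show "?E (r \<odot>\<^bsub>?F 0\<^esub> w) = r \<odot>\<^bsub>direct_sum C T\<^esub> ?E w" if r: "r \<in> carrier R" for r
      by (simp add: direct_sum_ops module_hom_smult[OF slice_hom r w] module_hom_smult[OF e r slice_closed[OF w]])
  qed
  show "?E ` carrier (?F 0) = carrier (direct_sum C T)"
  proof (intro equalityI subsetI)
    show "v \<in> carrier (direct_sum C T)" if "v \<in> ?E ` carrier (?F 0)" for v
      using that module_hom_closed[OF E] by auto
    fix v assume v: "v \<in> carrier (direct_sum C T)"
    have "\<exists>y. y \<in> carrier (free_module R (S 0)) \<and> e y = v t \<and> (v t = \<zero>\<^bsub>C\<^esub> \<longrightarrow> y = \<zero>\<^bsub>free_module R (S 0)\<^esub>)" for t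
    proof (cases "v t = \<zero>\<^bsub>C\<^esub>")
      case True
      then show ?thesis
        using module_hom_zero[OF FM C e]
        by (intro exI[of _ "\<zero>\<^bsub>free_module R (S 0)\<^esub>"]) (simp add: free_module_carrier free_module_ops)
    next
      case False
      have "v t \<in> e ` carrier (free_module R (S 0))" using v resolvesD(5)[OF rC] by (simp add: direct_sum_carrier)
      then show ?thesis using False by auto
    qed
    then obtain g where g: "\<And>t. g t \<in> carrier (free_module R (S 0)) \<and> e (g t) = v t \<and>
        (v t = \<zero>\<^bsub>C\<^esub> \<longrightarrow> g t = \<zero>\<^bsub>free_module R (S 0)\<^esub>)" by metis
    have sub: "{t. g t \<noteq> \<zero>\<^bsub>free_module R (S 0)\<^esub>} \<subseteq> {t. v t \<noteq> \<zero>\<^bsub>C\<^esub>}" using g by auto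
    have "(\<lambda>(t, s). g t s) \<in> carrier (?F 0)"
      using v g finite_subset[OF sub] subset_trans[OF sub] by (intro slices_closed) (simp_all add: direct_sum_carrier)
    moreover have "v = ?E (\<lambda>(t, s). g t s)" using g by (simp add: slice_def fun_eq_iff)
    ultimately show "v \<in> ?E ` carrier (?F 0)" by (rule image_eqI[of v ?E, rotated])
  qed
  fix n w assume w: "w \<in> carrier (?F n)"
  have sc: "slice t w \<in> carrier (free_module R (S n))" for t by (rule slice_closed[OF w])
  have cyc: "resolution_cycle R (direct_sum C T) (\<lambda>n. T \<times> S n) ?D ?E n w \<longleftrightarrow>
      (\<forall>t. resolution_cycle R C S d e n (slice t w))"
    by (auto simp: resolution_cycle_def free_module_ops direct_sum_ops slicewise_def fun_eq_iff)
  show "resolution_cycle R (direct_sum C T) (\<lambda>n. T \<times> S n) ?D ?E n w \<longleftrightarrow> w \<in> ?D (Suc n) ` carrier (?F (Suc n))"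
    unfolding cyc
  proof
    assume "w \<in> ?D (Suc n) ` carrier (?F (Suc n))"
    then obtain z where z: "z \<in> carrier (?F (Suc n))" "w = ?D (Suc n) z" by (rule imageE)
    show "\<forall>t. resolution_cycle R C S d e n (slice t w)"
      using resolves_dd(1)[OF rC slice_closed[OF z(1)]] by (simp add: z(2) slice_slicewise)
  next
    assume c: "\<forall>t. resolution_cycle R C S d e n (slice t w)"
    have "\<exists>y. y \<in> carrier (free_module R (S (Suc n))) \<and> d (Suc n) y = slice t w \<and>
        (slice t w = \<zero>\<^bsub>free_module R (S n)\<^esub> \<longrightarrow> y = \<zero>\<^bsub>free_module R (S (Suc n))\<^esub>)" for t
    proof (cases "slice t w = \<zero>\<^bsub>free_module R (S n)\<^esub>")
      case True
      then show ?thesis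
        using module_hom_zero[OF FM FM resolvesD(2)[OF rC]]
        by (intro exI[of _ "\<zero>\<^bsub>free_module R (S (Suc n))\<^esub>"]) (simp add: free_module_carrier free_module_ops)
    next
      case False
      have "slice t w \<in> d (Suc n) ` carrier (free_module R (S (Suc n)))"
        using resolvesD(6)[OF rC sc] c by simp
      then show ?thesis using False by auto
    qed
    then obtain g where g: "\<And>t. g t \<in> carrier (free_module R (S (Suc n))) \<and> d (Suc n) (g t) = slice t w \<and>
        (slice t w = \<zero>\<^bsub>free_module R (S n)\<^esub> \<longrightarrow> g t = \<zero>\<^bsub>free_module R (S (Suc n))\<^esub>)" by metis
    have sub: "{t. g t \<noteq> \<zero>\<^bsub>free_module R (S (Suc n))\<^esub>} \<subseteq> {t. slice t w \<noteq> \<zero>\<^bsub>free_module R (S n)\<^esub>}" using g by auto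
    have "(\<lambda>(t, s). g t s) \<in> carrier (?F (Suc n))"
      using g finite_subset[OF sub slice_support(1)[OF w]] subset_trans[OF sub slice_support(2)[OF w]]
      by (intro slices_closed) simp_all
    moreover have "w = ?D (Suc n) (\<lambda>(t, s). g t s)"
    proof (rule slice_eqI)
      fix t
      have "slice t (\<lambda>(t, s). g t s) = g t" by (simp add: slice_def)
      then show "slice t w = slice t (?D (Suc n) (\<lambda>(t, s). g t s))" using g by (simp add: slice_slicewise)
    qed
    ultimately show "w \<in> ?D (Suc n) ` carrier (?F (Suc n))" by (rule image_eqI[of w "?D (Suc n)", rotated])
  qed
qed

text \<open>Homomorphisms out of a direct sum are arbitrary families of homomorphisms, so a choice
  is made for each \<open>t\<close> independently. The family is glued along the basis.\<close>

lemma ext_exact_direct_sum: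
  fixes S :: "nat \<Rightarrow> 's set" and T :: "'t set"
  assumes N: "Module.module R N" and rC: "resolves R C S d e" and ex: "ext_exact R N S d n"
  shows "ext_exact R N (\<lambda>n. T \<times> S n) (\<lambda>n. slicewise (d n)) n"
  unfolding ext_exact_def
proof (intro ballI impI)
  let ?D = "\<lambda>n. slicewise (d n) :: ('t \<times> 's \<Rightarrow> 'r) \<Rightarrow> _" and ?F = "\<lambda>n. free_module R (T \<times> S n)"
  note D = slicewise_hom[OF resolvesD(1)[OF rC], where T = T]
  fix \<phi> assume \<phi>: "\<phi> \<in> module_hom R (?F n) N"
    and \<phi>D: "\<forall>x\<in>carrier (?F (Suc n)). \<phi> (?D (Suc n) x) = \<zero>\<^bsub>N\<^esub>"
  have "\<exists>\<psi>. \<psi> \<in> module_hom R (free_module R (S (n - 1))) N \<and>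
      (\<forall>x\<in>carrier (free_module R (S n)). \<phi> (slot R t x) = \<psi> (d n x))" if t: "t \<in> T" for t
  proof -
    have "\<exists>\<psi>\<in>module_hom R (free_module R (S (n - 1))) N.
      \<forall>x\<in>carrier (free_module R (S n)). \<phi> (slot R t x) = \<psi> (d n x)"
    proof (rule ext_exactD[OF ex module_hom_comp[OF slot_hom[OF t] \<phi>]])
      fix x assume x: "x \<in> carrier (free_module R (S (Suc n)))"
      show "\<phi> (slot R t (d (Suc n) x)) = \<zero>\<^bsub>N\<^esub>"
        using bspec[OF \<phi>D slot_closed[OF t x]] by (simp add: slicewise_slot[OF resolvesD(2)[OF rC]])
    qed
    then show ?thesis by auto
  qed
  then obtain \<psi> where \<psi>: "\<And>t. t \<in> T \<Longrightarrow> \<psi> t \<in> module_hom R (free_module R (S (n - 1))) N"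
    "\<And>t x. t \<in> T \<Longrightarrow> x \<in> carrier (free_module R (S n)) \<Longrightarrow> \<phi> (slot R t x) = \<psi> t (d n x)" by metis
  let ?b = "\<lambda>(t, s). \<psi> t (basis_vector R s)"
  have b: "?b x \<in> carrier N" if "x \<in> T \<times> S (n - 1)" for x
    using that module_hom_closed[OF \<psi>(1) basis_vector_closed[OF R]] by auto
  let ?\<psi> = "linear_extension R N ?b"
  have h: "?\<psi> \<in> module_hom R (?F (n - 1)) N" by (rule linear_extension_hom[OF N b])
  have slot: "?\<psi> (slot R t x) = \<psi> t x" if t: "t \<in> T" and x: "x \<in> carrier (free_module R (S (n - 1)))" for t x
  proof (rule free_module_hom_eq[OF N module_hom_comp[OF slot_hom[OF t] h] \<psi>(1)[OF t] _ x])
    fix s assume s: "s \<in> S (n - 1)"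
    then have "(t, s) \<in> T \<times> S (n - 1)" using t by simp
    then show "?\<psi> (slot R t (basis_vector R s)) = \<psi> t (basis_vector R s)"
      using linear_extension_basis[OF N, where S = "T \<times> S (n - 1)" and \<phi> = ?b and s = "(t, s)"] b
      by (simp add: slot_basis)
  qed
  have "\<phi> x = ?\<psi> (?D n x)" if x: "x \<in> carrier (?F n)" for x
  proof (rule free_module_hom_eq[OF N \<phi> module_hom_comp[OF D h] _ x])
    fix y assume "y \<in> T \<times> S n"
    then obtain t s where y: "y = (t, s)" "t \<in> T" "s \<in> S n" by auto
    have e: "basis_vector R s \<in> carrier (free_module R (S n))" by (rule basis_vector_closed[OF R y(3)])
    have "\<phi> (basis_vector R y) = \<psi> t (d n (basis_vector R s))"
      using \<psi>(2)[OF y(2) e] by (simp add: slot_basis y(1))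
    also have "\<dots> = ?\<psi> (slot R t (d n (basis_vector R s)))"
      by (rule slot[OF y(2) module_hom_closed[OF resolvesD(1)[OF rC] e], symmetric])
    also have "\<dots> = ?\<psi> (?D n (basis_vector R y))"
      by (simp add: y(1) slicewise_slot[OF resolvesD(1)[OF rC]] flip: slot_basis)
    finally show "\<phi> (basis_vector R y) = ?\<psi> (?D n (basis_vector R y))" .
  qed
  then show "\<exists>\<psi>\<in>module_hom R (?F (n - 1)) N. \<forall>x\<in>carrier (?F n). \<phi> x = \<psi> (?D n x)"
    by (intro bexI[OF _ h] ballI)
qed

text \<open>A pure tensor involves only the finitely many slices in the support of its first factor,
  and sums take unions. This replaces the isomorphism between the tensor product of a direct sum and
  the direct sum of the tensor products.\<close>

lemma tensor_block:
  fixes T :: "'t set" and S :: "'s set"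
  assumes N: "Module.module R N" and x: "x \<in> carrier (tensor_module R (free_module R (T \<times> S)) N)"
  shows "\<exists>X. finite X \<and> X \<subseteq> T \<and> tensor_map R (free_module R (T \<times> S)) N (block R X) x = x"
proof (rule tensor_induct[OF FM N x])
  fix w a assume pure: "w \<in> carrier (free_module R (T \<times> S))" "a \<in> carrier N"
  let ?X = "{t. slice t w \<noteq> \<zero>\<^bsub>free_module R S\<^esub>}"
  have "block R ?X w = w" by (rule slice_eqI) (simp add: slice_block[of _ ?X w S])
  then show "\<exists>X. finite X \<and> X \<subseteq> T \<and> tensor_map R (free_module R (T \<times> S)) N (block R X)
      (pure_tensor R (free_module R (T \<times> S)) N w a) = pure_tensor R (free_module R (T \<times> S)) N w a"
    using tensor_map_pure[OF FM FM N block_hom[of ?X T S] pure] slice_support[OF pure(1)]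
    by (intro exI[of _ ?X]) simp
next
  fix x y
  let ?t = "tensor_map R (free_module R (T \<times> S)) N"
  assume hyps: "x \<in> carrier (tensor_module R (free_module R (T \<times> S)) N)"
      "y \<in> carrier (tensor_module R (free_module R (T \<times> S)) N)"
    and IH: "\<exists>X. finite X \<and> X \<subseteq> T \<and> ?t (block R X) x = x" "\<exists>X. finite X \<and> X \<subseteq> T \<and> ?t (block R X) y = y"
  obtain X where X: "finite X" "X \<subseteq> T" "?t (block R X) x = x" using IH(1) by auto
  obtain Y where Y: "finite Y" "Y \<subseteq> T" "?t (block R Y) y = y" using IH(2) by auto
  have bb: "block R (X \<union> Y) (block R X w) = block R X w" "block R (X \<union> Y) (block R Y w) = block R Y w" for w :: "'t \<times> 's \<Rightarrow> 'r"
    by (auto simp: block_def fun_eq_iff)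
  have "?t (block R (X \<union> Y)) x = x"
    using tensor_map_comp[OF FM FM FM N block_hom block_hom hyps(1), of "X \<union> Y" X] X(3) bb(1) by simp
  moreover have "?t (block R (X \<union> Y)) y = y"
    using tensor_map_comp[OF FM FM FM N block_hom block_hom hyps(2), of "X \<union> Y" Y] Y(3) bb(2) by simp
  ultimately show "\<exists>X. finite X \<and> X \<subseteq> T \<and>
      ?t (block R X) (x \<oplus>\<^bsub>tensor_module R (free_module R (T \<times> S)) N\<^esub> y) =
      x \<oplus>\<^bsub>tensor_module R (free_module R (T \<times> S)) N\<^esub> y"
    using X Y module_hom_add[OF tensor_map_hom[OF FM FM N block_hom] hyps]
    by (intro exI[of _ "X \<union> Y"]) simp
qed

text \<open>By \<open>tensor_block\<close> a cycle is carried by finitely many summands, and these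
  are split off one at a time. Both the remainder and the split-off slice are again cycles, since
  blocks and slices commute with the differential.\<close>

lemma tor_exact_direct_sum:
  fixes S :: "nat \<Rightarrow> 's set" and T :: "'t set"
  assumes N: "Module.module R N" and rC: "resolves R C S d e" and ex: "tor_exact R N S d n"
  shows "tor_exact R N (\<lambda>n. T \<times> S n) (\<lambda>n. slicewise (d n)) n"
  unfolding tor_exact_def
proof (intro ballI impI)
  let ?F = "\<lambda>n. free_module R (T \<times> S n)" and ?G = "\<lambda>n. free_module R (S n)"
  let ?T = "\<lambda>A. tensor_module R A N"
  let ?D = "\<lambda>n. slicewise (d n) :: ('t \<times> 's \<Rightarrow> 'r) \<Rightarrow> _"
  note D = slicewise_hom[OF resolvesD(1)[OF rC], where T = T] slicewise_hom[OF resolvesD(2)[OF rC], where T = T]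
  note TM = tensor_module_module[OF FM N]
  note th = tensor_map_hom[OF FM FM N]
  let ?t = "\<lambda>A. tensor_map R A N"
  have main: "finite X \<Longrightarrow> X \<subseteq> T \<Longrightarrow> x \<in> carrier (?T (?F n)) \<Longrightarrow> ?t (?F n) (block R X) x = x \<Longrightarrow>
      ?t (?F (n - 1)) (?D n) x = \<zero>\<^bsub>?T (?F (n - 1))\<^esub> \<Longrightarrow>
      \<exists>y\<in>carrier (?T (?F (Suc n))). x = ?t (?F n) (?D (Suc n)) y" for X x
  proof (induction X arbitrary: x rule: finite_induct)
    case empty
    interpret T1: Module.module R "?T (?F (Suc n))" by (rule TM)
    have b: "block R {} = (\<lambda>w. \<zero>\<^bsub>?F n\<^esub>)" by (auto simp: block_def free_module_ops fun_eq_iff)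
    have "x = \<zero>\<^bsub>?T (?F n)\<^esub>"
      using empty.prems(3) tensor_map_zero[OF FM FM N empty.prems(2), of "T \<times> S n"] unfolding b by simp
    then have "x = ?t (?F n) (?D (Suc n)) \<zero>\<^bsub>?T (?F (Suc n))\<^esub>"
      using module_hom_zero[OF TM TM th[OF D(2)[of n]]] by simp
    then show ?case using T1.zero_closed by (rule bexI)
  next
    case (insert t X)
    have t: "t \<in> T" and XT: "X \<subseteq> T" using insert.prems(1) by auto
    note x = insert.prems(2)
    let ?x = "?t (?F n) (block R X) x"
    have xc: "?x \<in> carrier (?T (?F n))" by (rule module_hom_closed[OF th[OF block_hom[of X]] x])
    have bb: "block R X (block R X w) = block R X w" for w :: "'t \<times> 's \<Rightarrow> 'r" by (auto simp: block_def fun_eq_iff)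
    have "?t (?F n) (block R X) ?x = ?t (?F n) (\<lambda>w. block R X (block R X w)) x"
      by (rule tensor_map_comp[OF FM FM FM N block_hom[of X] block_hom[of X] x, symmetric])
    also have "\<dots> = ?x" by (simp only: bb)
    finally have 1: "?t (?F n) (block R X) ?x = ?x" .
    have "?t (?F (n - 1)) (?D n) ?x = ?t (?F (n - 1)) (\<lambda>w. ?D n (block R X w)) x"
      by (rule tensor_map_comp[OF FM FM FM N block_hom[of X] D(1)[of n] x, symmetric])
    also have "\<dots> = ?t (?F (n - 1)) (\<lambda>w. block R X (?D n w)) x"
      by (simp only: slicewise_block[OF resolvesD(1)[OF rC]])
    also have "\<dots> = ?t (?F (n - 1)) (block R X) (?t (?F (n - 1)) (?D n) x)"
      by (rule tensor_map_comp[OF FM FM FM N D(1)[of n] block_hom[of X] x])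
    also have "\<dots> = \<zero>\<^bsub>?T (?F (n - 1))\<^esub>"
      unfolding insert.prems(4) by (rule module_hom_zero[OF TM TM th[OF block_hom[of X]]])
    finally obtain y where y: "y \<in> carrier (?T (?F (Suc n)))" "?x = ?t (?F n) (?D (Suc n)) y"
      using insert.IH[OF XT xc 1] by auto
    let ?z = "?t (?G n) (slice t) x"
    have zc: "?z \<in> carrier (?T (?G n))" by (rule module_hom_closed[OF th[OF slice_hom[of t]] x])
    have "?t (?G (n - 1)) (d n) ?z = ?t (?G (n - 1)) (\<lambda>w. d n (slice t w)) x"
      by (rule tensor_map_comp[OF FM FM FM N slice_hom[of t] resolvesD(1)[OF rC, of n] x, symmetric])
    also have "\<dots> = ?t (?G (n - 1)) (\<lambda>w. slice t (?D n w)) x" by (simp only: slice_slicewise)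
    also have "\<dots> = ?t (?G (n - 1)) (slice t) (?t (?F (n - 1)) (?D n) x)"
      by (rule tensor_map_comp[OF FM FM FM N D(1)[of n] slice_hom[of t] x])
    also have "\<dots> = \<zero>\<^bsub>?T (?G (n - 1))\<^esub>"
      unfolding insert.prems(4) by (rule module_hom_zero[OF TM TM th[OF slice_hom[of t]]])
    finally have "\<exists>y\<in>carrier (?T (?G (Suc n))). ?z = ?t (?G n) (d (Suc n)) y" by (rule tor_exactD[OF ex zc])
    then obtain y' where y': "y' \<in> carrier (?T (?G (Suc n)))" "?z = ?t (?G n) (d (Suc n)) y'" by (rule bexE)
    have sc: "?t (?F (Suc n)) (slot R t) y' \<in> carrier (?T (?F (Suc n)))"
      by (rule module_hom_closed[OF th[OF slot_hom[OF t]] y'(1)])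
    have "?t (?F n) (slot R t) ?z = ?t (?F n) (\<lambda>w. slot R t (d (Suc n) w)) y'"
      unfolding y'(2) by (rule tensor_map_comp[OF FM FM FM N resolvesD(2)[OF rC, of n] slot_hom[OF t] y'(1), symmetric])
    also have "\<dots> = ?t (?F n) (\<lambda>w. ?D (Suc n) (slot R t w)) y'"
      by (simp only: slicewise_slot[OF resolvesD(2)[OF rC]])
    also have "\<dots> = ?t (?F n) (?D (Suc n)) (?t (?F (Suc n)) (slot R t) y')"
      by (rule tensor_map_comp[OF FM FM FM N slot_hom[OF t] D(2)[of n] y'(1)])
    finally have 2: "?t (?F n) (slot R t) ?z = ?t (?F n) (?D (Suc n)) (?t (?F (Suc n)) (slot R t) y')" .
    \<comment> \<open>Freshness of \<open>t\<close> makes the block over \<open>X\<close> and the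
      slot at \<open>t\<close> disjoint, so the projection splits as a sum.\<close>
    have dec: "block R (insert t X) w = block R X w \<oplus>\<^bsub>?F n\<^esub> slot R t (slice t w)"
      if "w \<in> carrier (?F n)" for w
      using that insert.hyps(2) by (auto simp: block_def slot_def slice_def free_module_ops free_module_carrier fun_eq_iff)
    note ss = module_hom_comp[OF slice_hom[of t T "S n"] slot_hom[OF t, of "S n"]]
    have "x = ?t (?F n) (block R (insert t X)) x" using insert.prems(3) by simp
    also have "\<dots> = ?t (?F n) (\<lambda>w. block R X w \<oplus>\<^bsub>?F n\<^esub> slot R t (slice t w)) x"
      by (rule tensor_map_cong[OF FM FM N block_hom[of "insert t X"] module_hom_plus[OF FM block_hom[of X] ss] _ x]) (rule dec)
    also have "\<dots> = ?x \<oplus>\<^bsub>?T (?F n)\<^esub> ?t (?F n) (\<lambda>w. slot R t (slice t w)) x"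
      by (rule tensor_map_plus[OF FM FM N block_hom[of X] ss x])
    also have "?t (?F n) (\<lambda>w. slot R t (slice t w)) x = ?t (?F n) (slot R t) ?z"
      by (rule tensor_map_comp[OF FM FM FM N slice_hom[of t] slot_hom[OF t] x])
    also have "?x \<oplus>\<^bsub>?T (?F n)\<^esub> ?t (?F n) (slot R t) ?z =
        ?t (?F n) (?D (Suc n)) (y \<oplus>\<^bsub>?T (?F (Suc n))\<^esub> ?t (?F (Suc n)) (slot R t) y')"
      unfolding y(2) 2 by (rule module_hom_add[OF th[OF D(2)[of n]] y(1) sc, symmetric])
    finally show ?case using module_add_closed[OF TM y(1) sc] by (rule bexI)
  qed
  fix x assume x: "x \<in> carrier (?T (?F n))" "?t (?F (n - 1)) (?D n) x = \<zero>\<^bsub>?T (?F (n - 1))\<^esub>"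
  obtain X where "finite X" "X \<subseteq> T" "?t (?F n) (block R X) x = x"
    using tensor_block[OF N x(1)] by (elim exE conjE)
  then show "\<exists>y\<in>carrier (?T (?F (Suc n))). x = ?t (?F n) (?D (Suc n)) y"
    using x by (intro main)
qed

end

text \<open>The index set may be infinite, as it must be for projective modules that are not
  finitely generated.\<close>

lemma vanishes_direct_sum:
  assumes C: "Module.module R C" and N: "Module.module R N" and van: "vanishes b R C N i"
  shows "vanishes b R (direct_sum C T) N i"
proof (cases "i < 0")
  case True
  then show ?thesis by (rule vanishes_neg[OF direct_sum_module[OF C] N])
next
  case False
  define n where "n = nat i"
  have n: "i = int n" using False by (simp add: n_def)
  have R: "cring R" using C by (rule module_ring)
  note rC = standard_resolution[OF C]
  note rS = resolves_direct_sum[OF R C rC, of T]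
  show ?thesis
    using van tor_exact_direct_sum[OF R N rC, of n T] ext_exact_direct_sum[OF R N rC, of n T]
    unfolding n vanishes_iff[OF C N rC] vanishes_iff[OF direct_sum_module[OF C] N rS] functor_exact_def
    by (cases b) simp_all
qed

text \<open>The zero module is resolved by free modules on empty bases, for which both exactness
  conditions are trivial; independence of the resolution does the rest.\<close>

lemma vanishes_zero_module:
  fixes A :: "('r, 'a) module"
  assumes A: "Module.module R A" and N: "Module.module R N" and zero: "zero_module A"
  shows "vanishes b R A N i"
proof (cases "i < 0")
  case True
  then show ?thesis by (rule vanishes_neg[OF A N])
next
  case False
  define n where "n = nat i"
  have n: "i = int n" using False by (simp add: n_def)
  interpret A: Module.module R A by (rule A)
  note F = free_module_module[OF A.is_cring]
  let ?S = "\<lambda>_ :: nat. {} :: unit set" and ?d = "\<lambda>(_ :: nat) (_ :: unit \<Rightarrow> 'r) (_ :: unit). \<zero>\<^bsub>R\<^esub>"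
  let ?F = "free_module R ({} :: unit set)"
  have Fz: "x \<in> carrier ?F \<longleftrightarrow> x = \<zero>\<^bsub>?F\<^esub>" for x
    by (auto simp: free_module_carrier free_module_ops)
  have Ac: "carrier A = {\<zero>\<^bsub>A\<^esub>}" using zero by (simp add: zero_module_def)
  have "(\<lambda>x. \<zero>\<^bsub>?F\<^esub>) \<in> module_hom R ?F ?F" by (rule module_hom_const_zero[OF F])
  then have d: "?d m \<in> module_hom R ?F ?F" for m by (simp add: free_module_ops)
  have res: "resolves R A ?S ?d (\<lambda>_. \<zero>\<^bsub>A\<^esub>)"
    unfolding resolves_def
  proof (intro conjI allI ballI)
    show "(\<lambda>_. \<zero>\<^bsub>A\<^esub>) \<in> module_hom R ?F A" by (rule module_hom_const_zero[OF A])
    show "(\<lambda>_. \<zero>\<^bsub>A\<^esub>) ` carrier ?F = carrier A" using Fz by (auto simp: Ac image_iff)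
    show "resolution_cycle R A ?S ?d (\<lambda>_. \<zero>\<^bsub>A\<^esub>) m x \<longleftrightarrow> x \<in> ?d (Suc m) ` carrier ?F"
      if "x \<in> carrier ?F" for m x
      using that Fz by (auto simp: resolution_cycle_def free_module_ops image_iff)
  qed (use d in \<open>simp_all add: free_module_ops\<close>)
  have "tor_exact R N ?S ?d n"
    unfolding tor_exact_def
  proof (intro ballI impI)
    interpret T: Module.module R "tensor_module R ?F N" by (rule tensor_module_module[OF F N])
    fix x assume x: "x \<in> carrier (tensor_module R ?F N)"
    have "x = tensor_map R ?F N (?d (Suc n)) \<zero>\<^bsub>tensor_module R ?F N\<^esub>"
      using zero_module_tensor[OF F N _ x] Fz
        module_hom_zero[OF tensor_module_module[OF F N] tensor_module_module[OF F N] tensor_map_hom[OF F F N d]]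
      by auto
    then show "\<exists>y\<in>carrier (tensor_module R ?F N). x = tensor_map R ?F N (?d (Suc n)) y"
      using T.zero_closed by (rule bexI)
  qed
  moreover have "ext_exact R N ?S ?d n"
    unfolding ext_exact_def
  proof (intro ballI impI)
    fix \<phi> assume \<phi>: "\<phi> \<in> module_hom R ?F N"
    have "\<phi> x = \<phi> (?d n x)" if "x \<in> carrier ?F" for x
      using that Fz by (simp add: free_module_ops)
    then show "\<exists>\<psi>\<in>module_hom R ?F N. \<forall>x\<in>carrier ?F. \<phi> x = \<psi> (?d n x)"
      by (intro bexI[OF _ \<phi>] ballI)
  qed
  ultimately show ?thesis
    unfolding n vanishes_iff[OF A N res] functor_exact_def by simp
qed

section \<open>Vanishing for the terms and the homology of the complex\<close>

lemma module_iso_inverse: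
  assumes A: "Module.module R A" and B: "Module.module R B" and f: "f \<in> module_iso R A B"
  obtains g where "g \<in> module_hom R B A" "\<And>a. a \<in> carrier A \<Longrightarrow> g (f a) = a"
    "\<And>b. b \<in> carrier B \<Longrightarrow> f (g b) = b"
proof -
  interpret A: Module.module R A by (rule A)
  have fh: "f \<in> module_hom R A B" and bij: "bij_betw f (carrier A) (carrier B)"
    using f by (simp_all add: module_iso_def)
  define g where "g = inv_into (carrier A) f"
  have gf: "g (f a) = a" if "a \<in> carrier A" for a
    using bij_betw_inv_into_left[OF bij that] by (simp add: g_def)
  have fg: "f (g b) = b" if "b \<in> carrier B" for b
    using bij_betw_inv_into_right[OF bij that] by (simp add: g_def)
  have gc: "g b \<in> carrier A" if "b \<in> carrier B" for b
    using bij_betw_apply[OF bij_betw_inv_into[OF bij] that] by (simp add: g_def)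
  have "g \<in> module_hom R B A"
  proof (rule module_homI[OF gc])
    fix x y assume x: "x \<in> carrier B" and y: "y \<in> carrier B"
    have "g (x \<oplus>\<^bsub>B\<^esub> y) = g (f (g x \<oplus>\<^bsub>A\<^esub> g y))"
      by (simp add: module_hom_add[OF fh gc[OF x] gc[OF y]] fg x y)
    then show "g (x \<oplus>\<^bsub>B\<^esub> y) = g x \<oplus>\<^bsub>A\<^esub> g y" using gc[OF x] gc[OF y] by (simp add: gf)
  next
    fix r x assume r: "r \<in> carrier R" and x: "x \<in> carrier B"
    have "g (r \<odot>\<^bsub>B\<^esub> x) = g (f (r \<odot>\<^bsub>A\<^esub> g x))"
      by (simp add: module_hom_smult[OF fh r gc[OF x]] fg x)
    then show "g (r \<odot>\<^bsub>B\<^esub> x) = r \<odot>\<^bsub>A\<^esub> g x" using gc[OF x] r by (simp add: gf)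
  qed
  then show thesis using gf fg by (rule that)
qed

lemma direct_power_carrier: "v \<in> carrier (direct_power M k) \<longleftrightarrow> v \<in> {..<k} \<rightarrow>\<^sub>E carrier M"
  by (simp add: direct_power_def)

lemma direct_power_ops:
  "\<zero>\<^bsub>direct_power M k\<^esub> = (\<lambda>j\<in>{..<k}. \<zero>\<^bsub>M\<^esub>)"
  "v \<oplus>\<^bsub>direct_power M k\<^esub> w = (\<lambda>j\<in>{..<k}. v j \<oplus>\<^bsub>M\<^esub> w j)"
  "r \<odot>\<^bsub>direct_power M k\<^esub> v = (\<lambda>j\<in>{..<k}. r \<odot>\<^bsub>M\<^esub> v j)"
  by (simp_all add: direct_power_def)

text \<open>Elements of a power are \<open>undefined\<close> outside the index range, elements of a
  direct sum are zero there. The two maps exchange these conventions and carry the module structure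
  and the vanishing results over.\<close>

lemma direct_power_retract:
  fixes R :: "'r ring" and M :: "('r, 'm) module"
  assumes M: "Module.module R M"
  shows "Module.module R (direct_power M k)"
    and "(\<lambda>v j. if j < k then v j else \<zero>\<^bsub>M\<^esub>) \<in> module_hom R (direct_power M k) (direct_sum M {..<k})"
    and "(\<lambda>v. restrict v {..<k}) \<in> module_hom R (direct_sum M {..<k}) (direct_power M k)"
    and "v \<in> carrier (direct_power M k) \<Longrightarrow> restrict (\<lambda>j. if j < k then v j else \<zero>\<^bsub>M\<^esub>) {..<k} = v"
proof -
  interpret M: Module.module R M by (rule M)
  let ?e = "\<lambda>v j. if j < k then v j else \<zero>\<^bsub>M\<^esub>" and ?r = "\<lambda>v. restrict v {..<k}"
  have e: "?e v \<in> carrier (direct_sum M {..<k})" if v: "v \<in> carrier (direct_power M k)" for v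
  proof -
    have sub: "{j. ?e v j \<noteq> \<zero>\<^bsub>M\<^esub>} \<subseteq> {..<k}" by (auto split: if_splits)
    have "?e v j \<in> carrier M" for j using v by (auto simp: direct_power_carrier PiE_iff)
    then show ?thesis using finite_subset[OF sub] sub by (simp add: direct_sum_carrier)
  qed
  have re: "?r (?e v) = v" if "v \<in> carrier (direct_power M k)" for v
  proof (rule extensionalityI[of _ "{..<k}"])
    show "v \<in> extensional {..<k}" using that by (simp add: direct_power_carrier PiE_iff)
  qed simp_all
  have r: "?r v \<in> carrier (direct_power M k)" if "v \<in> carrier (direct_sum M {..<k})" for v
    using that by (simp add: direct_sum_carrier direct_power_carrier)
  show rh: "?r \<in> module_hom R (direct_sum M {..<k}) (direct_power M k)"
    by (rule module_homI[OF r]) (auto simp: direct_sum_ops direct_power_ops)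
  show "?e \<in> module_hom R (direct_power M k) (direct_sum M {..<k})"
    by (rule module_homI[OF e]) (auto simp: direct_sum_ops direct_power_ops fun_eq_iff)
  show "v \<in> carrier (direct_power M k) \<Longrightarrow> ?r (?e v) = v" by (rule re)
  show "Module.module R (direct_power M k)"
  proof (rule module_surj_image[OF direct_sum_module[OF M]])
    show "?r ` carrier (direct_sum M {..<k}) = carrier (direct_power M k)"
    proof (intro equalityI subsetI)
      show "x \<in> carrier (direct_power M k)" if "x \<in> ?r ` carrier (direct_sum M {..<k})" for x
        using that r by auto
      show "x \<in> ?r ` carrier (direct_sum M {..<k})" if x: "x \<in> carrier (direct_power M k)" for x
        by (rule image_eqI[of x ?r "?e x", OF re[OF x, symmetric] e[OF x]])
    qed
  qed (auto simp: direct_sum_ops direct_power_ops)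
qed

lemma vanishes_direct_power:
  fixes R :: "'r ring" and M :: "('r, 'm) module"
  assumes M: "Module.module R M" and N: "Module.module R N"
  shows "vanishes b R M N i \<Longrightarrow> vanishes b R (direct_power M k) N i"
    and "0 < k \<Longrightarrow> vanishes b R (direct_power M k) N i \<Longrightarrow> vanishes b R M N i"
proof -
  interpret M: Module.module R M by (rule M)
  note D = direct_power_retract[OF M, where k = k]
  show "vanishes b R (direct_power M k) N i" if "vanishes b R M N i"
    by (rule vanishes_retract[OF D(1) direct_sum_module[OF M] N D(2,3) _ vanishes_direct_sum[OF M N that]]) (rule D(4))
  assume k: "0 < k" and v: "vanishes b R (direct_power M k) N i"
  \<comment> \<open>The diagonal followed by the coordinate 0 is the identity, so \<open>M\<close>
    is a retract of a nonempty power.\<close>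
  let ?u = "\<lambda>x. \<lambda>j\<in>{..<k}. x" and ?w = "\<lambda>v :: nat \<Rightarrow> 'm. v 0"
  have u: "?u \<in> module_hom R M (direct_power M k)"
    by (rule module_homI) (auto simp: direct_power_carrier direct_power_ops)
  have w: "?w \<in> module_hom R (direct_power M k) M"
    using k by (intro module_homI) (auto simp: direct_power_carrier direct_power_ops PiE_iff)
  show "vanishes b R M N i"
    by (rule vanishes_retract[OF M D(1) N u w _ v]) (simp add: k)
qed

lemma vanishes_iso:
  assumes A: "Module.module R A" and B: "Module.module R B" and N: "Module.module R N"
    and iso: "isomorphic_modules R A B"
  shows "vanishes b R A N i \<longleftrightarrow> vanishes b R B N i"
proof -
  obtain f where f: "f \<in> module_iso R A B" using iso by (auto simp: isomorphic_modules_def)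
  then have fh: "f \<in> module_hom R A B" by (simp add: module_iso_def)
  obtain g where g: "g \<in> module_hom R B A" "\<And>a. a \<in> carrier A \<Longrightarrow> g (f a) = a"
    "\<And>b. b \<in> carrier B \<Longrightarrow> f (g b) = b"
    using module_iso_inverse[OF A B f] by metis
  show ?thesis
    using vanishes_retract[OF A B N fh g(1,2)] vanishes_retract[OF B A N g(1) fh g(3)] by (rule iffI[rotated])
qed

text \<open>\<open>P\<close> is a retract of a free module on \<open>T\<close>, so
  \<open>P \<otimes> C\<close> is a retract of the direct sum of copies of \<open>C\<close> indexed
  by \<open>T\<close>. The inclusion comes from the bilinear map multiplying \<open>c\<close> by the
  coordinates of \<open>\<iota> x\<close>; the retraction sends \<open>c\<close> in the summand
  \<open>t\<close> to the pure tensor of \<pi> of the basis vector at \<open>t\<close> with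
  \<open>c\<close>.\<close>

lemma vanishes_projective_tensor:
  fixes R :: "'r ring" and C :: "('r, 'c) module" and P :: "('r, 'p) module"
  assumes P: "projective_module R P" and C: "Module.module R C" and N: "Module.module R N"
    and van: "vanishes b R C N i"
  shows "vanishes b R (tensor_module R P C) N i"
proof -
  obtain T :: "'p set" and \<iota> \<pi> where PM: "Module.module R P"
    and \<iota>: "\<iota> \<in> module_hom R P (free_module R T)" and \<pi>: "\<pi> \<in> module_hom R (free_module R T) P"
    and \<pi>\<iota>: "\<forall>x\<in>carrier P. \<pi> (\<iota> x) = x"
    using P unfolding projective_module_def by (elim conjE exE)
  interpret C: Module.module R C by (rule C)
  note R = C.is_cring
  note DS = direct_sum_module[OF C]
  let ?Q = "tensor_module R P C"
  note Q = tensor_module_module[OF PM C]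
  let ?s = "\<lambda>v c t. v t \<odot>\<^bsub>C\<^esub> c"
  have s_closed: "?s v c \<in> carrier (direct_sum C T)" if v: "v \<in> carrier (free_module R T)" and c: "c \<in> carrier C" for v c
  proof -
    have sub: "{t. ?s v c t \<noteq> \<zero>\<^bsub>C\<^esub>} \<subseteq> {t. v t \<noteq> \<zero>\<^bsub>R\<^esub>}" using c by auto
    have "finite {t. v t \<noteq> \<zero>\<^bsub>R\<^esub>}" "{t. v t \<noteq> \<zero>\<^bsub>R\<^esub>} \<subseteq> T" using v by (simp_all add: free_module_carrier)
    then show ?thesis
      using v c finite_subset[OF sub] subset_trans[OF sub] by (simp add: direct_sum_carrier free_module_carrier)
  qed
  have s_left: "(\<lambda>v. ?s v c) \<in> module_hom R (free_module R T) (direct_sum C T)" if c: "c \<in> carrier C" for c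
    by (rule module_homI[OF s_closed[OF _ c]])
      (use c in \<open>simp_all add: free_module_carrier free_module_ops direct_sum_ops C.smult_l_distr C.smult_assoc1\<close>)
  have s_right: "?s v \<in> module_hom R C (direct_sum C T)" if v: "v \<in> carrier (free_module R T)" for v
  proof (rule module_homI[OF s_closed[OF v]])
    have vc: "v t \<in> carrier R" for t using v by (simp add: free_module_carrier)
    show "?s v (x \<oplus>\<^bsub>C\<^esub> y) = ?s v x \<oplus>\<^bsub>direct_sum C T\<^esub> ?s v y" if "x \<in> carrier C" "y \<in> carrier C" for x y
      using that vc by (simp add: direct_sum_ops C.smult_r_distr)
    show "?s v (r \<odot>\<^bsub>C\<^esub> x) = r \<odot>\<^bsub>direct_sum C T\<^esub> ?s v x" if "r \<in> carrier R" "x \<in> carrier C" for r x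
      using that vc by (simp add: direct_sum_ops C.m_comm flip: C.smult_assoc1)
  qed
  let ?\<beta> = "\<lambda>x c. ?s (\<iota> x) c"
  have \<beta>: "bilinear_map R P C (direct_sum C T) ?\<beta>"
    unfolding bilinear_map_def
    using s_right[OF module_hom_closed[OF \<iota>]] module_hom_comp[OF \<iota> s_left] by simp
  let ?u = "tensor_lift R (direct_sum C T) ?\<beta>"
  have u: "?u \<in> module_hom R ?Q (direct_sum C T)" by (rule tensor_lift_hom[OF PM C DS \<beta>])
  let ?g = "\<lambda>t c. pure_tensor R P C (\<pi> (basis_vector R t)) c"
  have \<pi>e: "\<pi> (basis_vector R t) \<in> carrier P" if "t \<in> T" for t
    by (rule module_hom_closed[OF \<pi> basis_vector_closed[OF R that]])
  have g: "?g t \<in> module_hom R C ?Q" if "t \<in> T" for t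
    by (rule bilinear_right[OF PM C Q bilinear_pure_tensor[OF PM C] \<pi>e[OF that]])
  let ?w = "sum_lift C ?Q ?g"
  have w: "?w \<in> module_hom R (direct_sum C T) ?Q" by (rule sum_lift_hom[OF C Q g])
  \<comment> \<open>Both sides are linear in \<open>v\<close>, so basis vectors suffice. With
    \<open>v = \<iota> a\<close> the right-hand side is the pure tensor of \<open>a\<close> and
    \<open>c\<close>, which shows that \<open>?w\<close> inverts \<open>?u\<close> on one
    side.\<close>
  have ws: "?w (?s v c) = pure_tensor R P C (\<pi> v) c"
    if v: "v \<in> carrier (free_module R T)" and c: "c \<in> carrier C" for v c
  proof (rule free_module_hom_eq[OF Q module_hom_comp[OF s_left[OF c] w] _ _ v])
    show "(\<lambda>v. pure_tensor R P C (\<pi> v) c) \<in> module_hom R (free_module R T) ?Q"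
      by (rule module_hom_comp[OF \<pi> bilinear_left[OF PM C Q bilinear_pure_tensor[OF PM C] c]])
    fix t assume t: "t \<in> T"
    have e: "basis_vector R t \<in> carrier (free_module R T)" by (rule basis_vector_closed[OF R t])
    interpret Q: Module.module R ?Q by (rule Q)
    have "?w (?s (basis_vector R t) c) = (\<Oplus>\<^bsub>?Q\<^esub>t'\<in>{t}. ?g t' (?s (basis_vector R t) c t'))"
      by (rule sum_lift_superset[OF C Q g s_closed[OF e c]])
        (use t c in \<open>auto simp: basis_vector_def split: if_splits\<close>)
    also have "\<dots> = ?g t (?s (basis_vector R t) c t)"
      using c pure_tensor_closed[OF PM C \<pi>e[OF t]] by (simp add: basis_vector_def)
    also have "\<dots> = ?g t c" using c by (simp add: basis_vector_def)
    finally show "?w (?s (basis_vector R t) c) = ?g t c" .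
  qed
  have wu: "?w (?u x) = x" if x: "x \<in> carrier ?Q" for x
  proof (rule tensor_hom_eq[OF PM C Q module_hom_comp[OF u w] module_hom_id _ x])
    fix a c assume a: "a \<in> carrier P" and c: "c \<in> carrier C"
    show "?w (?u (pure_tensor R P C a c)) = pure_tensor R P C a c"
      using ws[OF module_hom_closed[OF \<iota> a] c] \<pi>\<iota> a by (simp add: tensor_lift_pure[OF PM C DS \<beta> a c])
  qed
  show ?thesis
    by (rule vanishes_retract[OF Q DS N u w _ vanishes_direct_sum[OF C N van]]) (rule wu)
qed

section \<open>Dimension shifting along the complex, and the bound\<close>

lemma (in short_exact) vanishes_quotient:
  assumes "Module.module R N" "vanishes t R B N i" "vanishes t R A N (i - 1)" "0 < i"
  shows "vanishes t R E N i"
proof -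
  define n where "n = nat (i - 1)"
  have n: "i = int (Suc n)" "i - 1 = int n" using assms(4) by (simp_all add: n_def)
  show ?thesis using vanishes_shift(1)[OF assms(1), of t n, folded n] assms(2,3) by blast
qed

lemma (in short_exact) vanishes_source:
  assumes "Module.module R N" "vanishes t R E N (i + 1)" "vanishes t R B N i"
  shows "vanishes t R A N i"
proof (cases "i < 0")
  case True
  then show ?thesis by (rule vanishes_neg[OF A assms(1)])
next
  case False
  define n where "n = nat i"
  have n: "i + 1 = int (Suc n)" "i = int n" using False by (simp_all add: n_def)
  show ?thesis using vanishes_shift(2)[OF assms(1), of t n, folded n] assms(2,3) by blast
qed

lemma complex_vanishing:
  fixes R :: "'r ring" and X :: "int \<Rightarrow> ('r, 'x) module" and s h l t :: int
  assumes ch: "chain_complex R X D" and N: "Module.module R N"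
    and VX: "\<And>i j. 0 < j \<Longrightarrow> vanishes b R (X i) N j"
    and top: "\<And>i. s < i \<Longrightarrow> zero_module (X i)" and bot: "\<And>i. i < l \<Longrightarrow> zero_module (X i)"
    and acyc: "\<And>i. h < i \<Longrightarrow> zero_module (homology X D i)"
    and VH: "\<And>i j. t < j \<Longrightarrow> vanishes b R (homology X D i) N j"
    and t: "s - h < t" and hs: "h \<le> s" and lh: "l \<le> h"
  shows "vanishes b R (homology X D h) N t"
proof -
  note X = chain_complexD(1)[OF ch] and D' = chain_complexD(3)[OF ch]
  define K where "K i = {x \<in> carrier (X i). D i x = \<zero>\<^bsub>X (i - 1)\<^esub>}" for i
  define I where "I i = D (i + 1) ` carrier (X (i + 1))" for i
  define Z where "Z i = (X i)\<lparr>carrier := K i\<rparr>" for i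
  define B where "B i = (X i)\<lparr>carrier := I i\<rparr>" for i
  note subK = cycles_submodule[OF ch, folded K_def] and subI = boundaries_submodule[OF ch, folded I_def]
  have Z: "Module.module R (Z i)" for i
    unfolding Z_def by (rule submodule.submodule_is_module[OF subK X])
  have B: "Module.module R (B i)" for i
    unfolding B_def by (rule submodule.submodule_is_module[OF subI X])
  have IK: "I i \<subseteq> K i" for i
    unfolding I_def K_def by (rule boundaries_subset_cycles[OF ch])
  have subZ: "submodule (I i) R (Z i)" for i
    unfolding I_def Z_def K_def by (rule boundaries_submodule_cycles[OF ch])
  have hom: "homology X D i = quotient_module (Z i) (I i)" for i
    by (simp add: homology_def a_kernel_def' Z_def K_def I_def)
  note H = homology_module[OF ch]
  have ZXB: "short_exact R (Z (i + 1)) (X (i + 1)) (B i) (\<lambda>x. x) (D (i + 1))" for i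
  proof (rule short_exact.intro[OF Z X B])
    show "(\<lambda>x. x) \<in> module_hom R (Z (i + 1)) (X (i + 1))"
      by (rule module_homI) (simp_all add: Z_def K_def)
    show "D (i + 1) \<in> module_hom R (X (i + 1)) (B i)"
      by (rule module_homI) (simp_all add: B_def I_def module_hom_add[OF D'] module_hom_smult[OF D'])
  qed (auto simp: Z_def B_def K_def I_def)
  have BZH: "short_exact R (B i) (Z i) (homology X D i) (\<lambda>x. x) (\<lambda>x. I i +>\<^bsub>Z i\<^esub> x)" for i
  proof (rule short_exact.intro[OF B Z H])
    show "(\<lambda>x. x) \<in> module_hom R (B i) (Z i)"
      using IK by (intro module_homI) (auto simp: Z_def B_def)
    show "(\<lambda>x. I i +>\<^bsub>Z i\<^esub> x) \<in> module_hom R (Z i) (homology X D i)"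
      unfolding hom by (rule coset_hom[OF Z subZ])
    show "(\<lambda>x. I i +>\<^bsub>Z i\<^esub> x) ` carrier (Z i) = carrier (homology X D i)"
      by (simp add: hom quotient_module_simps)
    show "I i +>\<^bsub>Z i\<^esub> x = \<zero>\<^bsub>homology X D i\<^esub> \<longleftrightarrow> x \<in> (\<lambda>x. x) ` carrier (B i)" if "x \<in> carrier (Z i)" for x
      using coset_eq_zero_iff[OF Z subZ that] by (simp add: hom quotient_module_simps B_def)
  qed (simp add: B_def Z_def)
  \<comment> \<open>Above degree \<open>h\<close> cycles and boundaries agree, even as records, so
    the result for \<open>B i\<close> can be fed into the next sequence without an
    isomorphism.\<close>
  have ZB: "Z i = B i" if "h < i" for i
  proof -
    have "K i \<subseteq> I i"
      using acyc[OF that] zero_module_quotient_iff[OF Z subZ] by (simp add: hom Z_def)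
    then show ?thesis using IK[of i] by (simp add: Z_def B_def)
  qed
  have zero_sub: "zero_module ((X i)\<lparr>carrier := Y\<rparr>)" if "submodule Y R (X i)" "Y \<subseteq> {\<zero>\<^bsub>X i\<^esub>}" for i Y
    using submodule_zero[OF that(1)] that(2) by (auto simp: zero_module_def)
  \<comment> \<open>The terms \<open>X (i + 1)\<close> to \<open>X s\<close> resolve
    \<open>B i\<close> for \<open>i \<ge> h\<close>, whence the bound \<open>s - i\<close>. Going
    from \<open>i\<close> to \<open>i - 1\<close> raises the degree by one. The restriction
    \<open>h \<le> i\<close> sits inside the induction because it starts at \<open>s\<close> and
    moves downwards.\<close>
  have VB: "h \<le> i \<longrightarrow> (\<forall>j \<ge> s - i. vanishes b R (B i) N j)" if "i \<le> s" for i
    using that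
  proof (induction i rule: int_le_induct)
    case base
    have "carrier (X (s + 1)) = {\<zero>\<^bsub>X (s + 1)\<^esub>}" using top[of "s + 1"] by (simp add: zero_module_def)
    then have "zero_module (B s)"
      unfolding B_def using module_hom_zero[OF X X D'] by (intro zero_sub[OF subI]) (simp add: I_def)
    then show ?case using vanishes_zero_module[OF B N] by blast
  next
    case (step i)
    show ?case
    proof (intro impI allI)
      fix j assume h: "h \<le> i - 1" and j: "s - (i - 1) \<le> j"
      interpret short_exact R "Z i" "X i" "B (i - 1)" "\<lambda>x. x" "D i" using ZXB[of "i - 1"] by simp
      have "vanishes b R (Z i) N (j - 1)" using step h j ZB[of i] by simp
      then show "vanishes b R (B (i - 1)) N j"
        using step.hyps j by (intro vanishes_quotient[OF N VX]) simp_all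
    qed
  qed
  \<comment> \<open>The induction starts one degree below the complex, where \<open>Z\<close> is
    zero. Each step upwards uses two dimension shifts at the same \<open>i\<close> and lowers the
    bound on the degree by one; the bound is normalised so that it is \<open>t\<close> in degree
    \<open>h\<close>.\<close>
  have VZ: "i \<le> h \<longrightarrow> (\<forall>j \<ge> t + h - i. vanishes b R (Z i) N j)" if "l - 1 \<le> i" for i
    using that
  proof (induction i rule: int_ge_induct)
    case base
    have "carrier (X (l - 1)) = {\<zero>\<^bsub>X (l - 1)\<^esub>}" using bot[of "l - 1"] by (simp add: zero_module_def)
    then have "zero_module (Z (l - 1))"
      unfolding Z_def by (intro zero_sub[OF subK]) (auto simp: K_def)
    then show ?case using vanishes_zero_module[OF Z N] by blast
  next
    case (step i)
    show ?case
    proof (intro impI allI)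
      fix j assume i: "i + 1 \<le> h" and j: "t + h - (i + 1) \<le> j"
      have "vanishes b R (Z i) N (j + 1)" using step i j by simp
      \<comment> \<open>As \<open>i < h\<close>, the bound on \<open>j\<close> gives
        \<open>j \<ge> t\<close>, so \<open>j + 2\<close> lies in the range where the homology is
        known to vanish.\<close>
      moreover have "vanishes b R (homology X D i) N (j + 1 + 1)" using i j by (intro VH) simp
      ultimately have "vanishes b R (B i) N (j + 1)" by (intro short_exact.vanishes_source[OF BZH N])
      moreover have "vanishes b R (X (i + 1)) N j" using i j t hs by (intro VX) simp
      ultimately show "vanishes b R (Z (i + 1)) N j" by (intro short_exact.vanishes_source[OF ZXB N])
    qed
  qed
  have "vanishes b R (Z h) N t" using VZ[of h] lh by simp
  \<comment> \<open>The degree \<open>t - 1\<close> is admissible because \<open>t\<close> exceeds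
    \<open>s - h\<close> strictly.\<close>
  moreover have "vanishes b R (B h) N (t - 1)" using VB[OF hs] t by simp
  ultimately show ?thesis using t hs by (intro short_exact.vanishes_quotient[OF BZH N]) simp_all
qed

lemma Sup_degrees:
  assumes "finite A" "A \<noteq> {}"
  shows "Sup {ereal (of_int i) | i. i \<in> A} = ereal (of_int (Max A))"
  by (rule cSup_eq_maximum) (use assms in auto)

text \<open>The bound is established for each resolution separately; passing to the infimum
  afterwards costs nothing, since an infimum below \<open>n\<close> is witnessed by some resolution
  with value below \<open>n\<close>.\<close>

lemma vanishes_above_resolution:
  fixes R :: "'r ring" and C :: "('r, 'c) module" and M :: "('r, 'm) module" and N :: "('r, 'n) module"
    and P :: "int \<Rightarrow> ('r, 'p) module"
  assumes C: "Module.module R C" and M: "Module.module R M" and N: "Module.module R N"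
    and qpr: "quasi_projective_resolution R C M P d"
    and VC: "\<And>j. 0 < j \<Longrightarrow> vanishes b R C N j"
    and VM: "\<forall>\<^sub>F j in at_top. vanishes b R M N j"
    and n: "complex_sup (tensor_complex R P C) -
      complex_hsup (tensor_complex R P C) (tensor_differential R P d C) < ereal (of_int n)"
  shows "vanishes b R M N n"
proof -
  let ?X = "tensor_complex R P C" and ?D = "tensor_differential R P d C"
  have ch: "chain_complex R P d" and bd: "bounded_complex P" and pr: "\<And>i. projective_module R (P i)"
    and ex: "\<exists>i. \<not> zero_module (homology ?X ?D i)"
    and iso: "\<And>i. \<exists>k. isomorphic_modules R (homology ?X ?D i) (direct_power M k)"
    using qpr by (simp_all add: quasi_projective_resolution_def Let_def)
  note chX = chain_complex_tensor[OF ch C]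
  note P = chain_complexD(1)[OF ch] and X = chain_complexD(1)[OF chX] and D' = chain_complexD(3)[OF chX]
  note H = homology_module[OF chX]
  define A where "A = {i. \<not> zero_module (?X i)}"
  define A' where "A' = {i. \<not> zero_module (homology ?X ?D i)}"
  \<comment> \<open>Boundedness is given for \<open>P\<close> and transfers to
    \<open>P \<otimes> C\<close>. With finitely many nonzero degrees the two suprema are maxima, and
    the subtraction takes place among integers.\<close>
  have "A \<subseteq> {i. \<not> zero_module (P i)}"
  proof
    fix i assume i: "i \<in> A"
    have "zero_module (?X i)" if "zero_module (P i)"
    proof -
      interpret T: Module.module R "?X i" by (rule X)
      have "carrier (P i) \<subseteq> {\<zero>\<^bsub>P i\<^esub>}" using that by (simp add: zero_module_def)
      then have "x = \<zero>\<^bsub>?X i\<^esub>" if "x \<in> carrier (?X i)" for x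
        using zero_module_tensor[OF P C] that by (simp add: tensor_complex_def)
      then show ?thesis using T.zero_closed by (auto simp: zero_module_def)
    qed
    then show "i \<in> {i. \<not> zero_module (P i)}" using i by (auto simp: A_def)
  qed
  then have finA: "finite A" using bd by (auto simp: bounded_complex_def intro: finite_subset)
  have A'A: "A' \<subseteq> A"
  proof
    fix i assume i: "i \<in> A'"
    have "zero_module (homology ?X ?D i)" if "zero_module (?X i)"
    proof -
      interpret T: Module.module R "?X (i + 1)" by (rule X)
      have "\<zero>\<^bsub>?X i\<^esub> \<in> ?D (i + 1) ` carrier (?X (i + 1))"
        by (rule image_eqI[of _ "?D (i + 1)", OF module_hom_zero[OF X X D', symmetric] T.zero_closed])
      then show ?thesis
        using that homology_zero_iff[OF chX, of i] by (simp add: zero_module_def)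
    qed
    then show "i \<in> A" using i by (auto simp: A_def A'_def)
  qed
  have A'0: "A' \<noteq> {}" using ex by (auto simp: A'_def)
  have finA': "finite A'" using finA A'A by (rule finite_subset[rotated])
  have A0: "A \<noteq> {}" using A'A A'0 by auto
  define s h where "s = Max A" and "h = Max A'"
  \<comment> \<open>Taking the minimum with \<open>h\<close> makes \<open>l \<le> h\<close>
    immediate.\<close>
  define l where "l = min (Min A) h"
  have hA': "h \<in> A'" using finA' A'0 by (simp add: h_def)
  have hs: "h \<le> s" using A'A hA' finA by (auto simp: s_def)
  have sn: "s - h < n"
    using n Sup_degrees[OF finA A0] Sup_degrees[OF finA' A'0]
    by (simp add: complex_sup_def complex_hsup_def A_def A'_def s_def h_def)
  have VHM: "vanishes b R (homology ?X ?D i) N j" if "vanishes b R M N j" for i j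
    using iso[of i] vanishes_iso[OF H direct_power_retract(1)[OF M] N] vanishes_direct_power(1)[OF M N that] by blast
  have VMH: "vanishes b R M N j" if V: "vanishes b R (homology ?X ?D h) N j" for j
  proof -
    obtain k where k: "isomorphic_modules R (homology ?X ?D h) (direct_power M k)" using iso by blast
    \<comment> \<open>The exponent 0 would make the homology in degree \<open>h\<close> isomorphic
      to a module with one element, but \<open>h\<close> is a degree of nonzero homology. A positive
      exponent is what lets vanishing descend from the power to \<open>M\<close>.\<close>
    have "k \<noteq> 0"
    proof
      assume "k = 0"
      obtain f where f: "bij_betw f (carrier (homology ?X ?D h)) (carrier (direct_power M k))"
        using k by (auto simp: isomorphic_modules_def module_iso_def)
      have one: "carrier (direct_power M k) = {\<lambda>_. undefined}" using \<open>k = 0\<close> by (simp add: direct_power_def)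
      interpret H: Module.module R "homology ?X ?D h" by (rule H)
      have "x = \<zero>\<^bsub>homology ?X ?D h\<^esub>" if "x \<in> carrier (homology ?X ?D h)" for x
        using bij_betw_imp_inj_on[OF f] bij_betw_apply[OF f that] bij_betw_apply[OF f H.zero_closed] that H.zero_closed
        unfolding one by (metis inj_onD singletonD)
      then have "zero_module (homology ?X ?D h)" using H.zero_closed by (auto simp: zero_module_def)
      then show False using hA' by (simp add: A'_def)
    qed
    then show ?thesis
      using vanishes_iso[OF H direct_power_retract(1)[OF M] N k] V vanishes_direct_power(2)[OF M N] by blast
  qed
  \<comment> \<open>All homology modules are powers of \<open>M\<close>, so vanishing for
    \<open>M\<close> above \<open>t\<close> gives vanishing for all of them above \<open>t\<close>.
    The complex then returns vanishing in degree \<open>t\<close> for its top homology, and hence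
    for \<open>M\<close>.\<close>
  have descend: "vanishes b R M N t" if nt: "n \<le> t" and Vt: "\<And>j. t < j \<Longrightarrow> vanishes b R M N j" for t
  proof (rule VMH, rule complex_vanishing[OF chX N, where s = s and l = l])
    show "vanishes b R (?X i) N j" if "0 < j" for i j
      unfolding tensor_complex_def by (rule vanishes_projective_tensor[OF pr C N VC[OF that]])
    show "zero_module (?X i)" if "s < i" for i
      using that Max_ge[OF finA] unfolding s_def[symmetric] by (fastforce simp: A_def)
    show "zero_module (?X i)" if "i < l" for i
      using that Min_le[OF finA] unfolding l_def by (fastforce simp: A_def)
    show "zero_module (homology ?X ?D i)" if "h < i" for i
      using that Max_ge[OF finA'] unfolding h_def[symmetric] by (fastforce simp: A'_def)
    show "vanishes b R (homology ?X ?D i) N j" if "t < j" for i j by (rule VHM[OF Vt[OF that]])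
  qed (use sn nt hs in \<open>simp_all add: l_def\<close>)
  obtain J where J: "\<And>j. J \<le> j \<Longrightarrow> vanishes b R M N j" using VM by (auto simp: eventually_at_top_linorder)
  \<comment> \<open>Descending induction from a degree beyond which vanishing is known. Allowing
    \<open>t = n - 1\<close> makes the last instance cover the degree \<open>n\<close>
    itself.\<close>
  have "n \<le> t + 1 \<longrightarrow> (\<forall>j>t. vanishes b R M N j)" if "t \<le> max J n" for t
    using that
  proof (induction t rule: int_le_induct)
    case base
    then show ?case using J by auto
  next
    case (step t)
    show ?case
    proof (intro impI allI)
      fix j assume n: "n \<le> t - 1 + 1" and j: "t - 1 < j"
      have IH: "vanishes b R M N j'" if "t < j'" for j' using step.IH n that by simp
      show "vanishes b R M N j"
      proof (cases "j = t")
        case True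
        show ?thesis unfolding True by (rule descend) (use n IH in simp_all)
      next
        case False
        then show ?thesis using j by (intro IH) simp
      qed
    qed
  qed
  from this[of "n - 1"] show ?thesis by simp
qed

theorem proposition5p12:
  fixes R :: "'r ring" and C :: "('r, 'c) module"
    and M :: "('r, 'm) module" and N :: "('r, 'n) module"
  assumes "cring R" and "noetherian_ring R"
    and "semidualizing R C"
    and "Module.module R M" and "Module.module R N"
    and "quasi_projective_dim TYPE('p) R C M < \<infinity>"
  shows
    "((\<forall>i>0. zero_module (Tor R C N i)) \<longrightarrow>
        (\<forall>\<^sub>F i in at_top. zero_module (Tor R M N i)) \<longrightarrow>
        (\<forall>i. ereal (of_int i) > quasi_projective_dim TYPE('p) R C M \<longrightarrow> zero_module (Tor R M N i))) \<and>
     ((\<forall>i>0. zero_module (Ext R C N i)) \<longrightarrow>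
        (\<forall>\<^sub>F i in at_top. zero_module (Ext R M N i)) \<longrightarrow>
        (\<forall>i. ereal (of_int i) > quasi_projective_dim TYPE('p) R C M \<longrightarrow> zero_module (Ext R M N i)))"
proof -
  have C: "Module.module R C" using assms(3) by (simp add: semidualizing_def)
  have main: "vanishes b R M N i"
    if VC: "\<forall>i>0. vanishes b R C N i" and VM: "\<forall>\<^sub>F i in at_top. vanishes b R M N i"
      and i: "ereal (of_int i) > quasi_projective_dim TYPE('p) R C M" for b i
  proof (cases "zero_module M")
    case True
    \<comment> \<open>The dimension is minus infinity here, so the claim concerns every integer
      degree.\<close>
    then show ?thesis by (rule vanishes_zero_module[OF assms(4,5)])
  next
    case False
    \<comment> \<open>An infimum below \<open>i\<close> provides a resolution whose own value is
      below \<open>i\<close>; attainment of the infimum plays no part in the argument.\<close>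
    then obtain P :: "int \<Rightarrow> ('r, 'p) module" and d where "quasi_projective_resolution R C M P d"
      "complex_sup (tensor_complex R P C) -
        complex_hsup (tensor_complex R P C) (tensor_differential R P d C) < ereal (of_int i)"
      using i by (auto simp: quasi_projective_dim_def Inf_less_iff)
    then show ?thesis using VC VM by (intro vanishes_above_resolution[OF C assms(4,5)]) simp_all
  qed
  show ?thesis
    using main[of True] main[of False] by (simp add: vanishes_def)
qed

end
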